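(* Let $G$ be a hyperbolic group, let $r\in\mathbb{N}$, and let $H\le G$ be a quasiconvex free subgroup. Then there are only finitely many subgroups $H'$ with $H\le H'\le G$ such that $H'$ is free and quasiconvex in $G$, $H'$ has rank $r$, and $H$ is not contained in a proper free factor of $H'$.
   Context: A subgroup $H$ of a hyperbolic group $G$ is quasiconvex if and only if $H$ is finitely generated and the inclusion $H\to G$ is a quasi-isometric embedding (with respect to word metrics). A free factor of a group $H'$ is a subgroup $A\le H'$ such that $H'=A*B$ for some subgroup $B\le H'$; it is proper if $A\ne H'$. *)

theory Defs
  imports Complex_Main "HOL-Algebra.Generated_Groups"
begin

section \<open>Words in generators and their inverses\<close>

text \<open>The letter \<open>(x, True)\<close> stands for \<open>x\<close> and \<open>(x, False)\<close> for its inverse.\<close>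

fun letter_val :: "('a, 'b) monoid_scheme \<Rightarrow> 'a \<times> bool \<Rightarrow> 'a" where
  "letter_val G (x, s) = (if s then x else inv\<^bsub>G\<^esub> x)"

definition word_val :: "('a, 'b) monoid_scheme \<Rightarrow> ('a \<times> bool) list \<Rightarrow> 'a" where
  "word_val G w = foldr (\<lambda>l g. letter_val G l \<otimes>\<^bsub>G\<^esub> g) w \<one>\<^bsub>G\<^esub>"

definition words :: "'a set \<Rightarrow> ('a \<times> bool) list set" where
  "words S = lists (S \<times> UNIV)"

definition reduced_words :: "'a set \<Rightarrow> ('a \<times> bool) list set" where
  "reduced_words S =
    {w \<in> words S. successively (\<lambda>(x, s) (y, t). \<not> (x = y \<and> s \<noteq> t)) w}"


section \<open>Hyperbolic groups and quasiconvex subgroups\<close>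

definition finite_generating_set :: "('a, 'b) monoid_scheme \<Rightarrow> 'a set \<Rightarrow> bool" where
  "finite_generating_set G S \<longleftrightarrow>
    finite S \<and> S \<subseteq> carrier G \<and> generate G S = carrier G"

text \<open>The value of \<open>word_length G S g\<close> is meaningful only for \<open>g\<close> in the subgroup
  generated by \<open>S\<close>.\<close>

definition word_length :: "('a, 'b) monoid_scheme \<Rightarrow> 'a set \<Rightarrow> 'a \<Rightarrow> nat" where
  "word_length G S g = (LEAST n. \<exists>w \<in> words S. length w = n \<and> word_val G w = g)"

definition word_metric :: "('a, 'b) monoid_scheme \<Rightarrow> 'a set \<Rightarrow> 'a \<Rightarrow> 'a \<Rightarrow> real" where
  "word_metric G S g h = real (word_length G S (inv\<^bsub>G\<^esub> g \<otimes>\<^bsub>G\<^esub> h))"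

definition gromov_product :: "('a \<Rightarrow> 'a \<Rightarrow> real) \<Rightarrow> 'a \<Rightarrow> 'a \<Rightarrow> 'a \<Rightarrow> real" where
  "gromov_product d x y w = (d x w + d y w - d x y) / 2"

definition gromov_hyperbolic :: "real \<Rightarrow> 'a set \<Rightarrow> ('a \<Rightarrow> 'a \<Rightarrow> real) \<Rightarrow> bool" where
  "gromov_hyperbolic \<delta> X d \<longleftrightarrow>
    (\<forall>x \<in> X. \<forall>y \<in> X. \<forall>z \<in> X. \<forall>w \<in> X.
      gromov_product d x z w \<ge> min (gromov_product d x y w) (gromov_product d y z w) - \<delta>)"

text \<open>Hyperbolicity of the word metric does not depend on the choice of the finite generating
  set, and being a quasi-isometric embedding does not depend on the choices of the two finite
  generating sets below; the definitions therefore ask for some choice.\<close>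

definition hyperbolic_group :: "('a, 'b) monoid_scheme \<Rightarrow> bool" where
  "hyperbolic_group G \<longleftrightarrow>
    group G \<and>
    (\<exists>S \<delta>. finite_generating_set G S \<and> \<delta> \<ge> 0 \<and>
      gromov_hyperbolic \<delta> (carrier G) (word_metric G S))"

definition quasi_isometric_embedding ::
  "'a set \<Rightarrow> ('a \<Rightarrow> 'a \<Rightarrow> real) \<Rightarrow> 'b set \<Rightarrow> ('b \<Rightarrow> 'b \<Rightarrow> real) \<Rightarrow> ('a \<Rightarrow> 'b) \<Rightarrow> bool" where
  "quasi_isometric_embedding X dX Y dY f \<longleftrightarrow>
    f \<in> X \<rightarrow> Y \<and>
    (\<exists>K C. K \<ge> 1 \<and> C \<ge> 0 \<and>
      (\<forall>x \<in> X. \<forall>y \<in> X.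
        dX x y / K - C \<le> dY (f x) (f y) \<and> dY (f x) (f y) \<le> K * dX x y + C))"

definition quasiconvex_subgroup :: "'a set \<Rightarrow> ('a, 'b) monoid_scheme \<Rightarrow> bool" where
  "quasiconvex_subgroup H G \<longleftrightarrow>
    subgroup H G \<and>
    (\<exists>S T. finite_generating_set G S \<and> finite_generating_set (G\<lparr>carrier := H\<rparr>) T \<and>
      quasi_isometric_embedding H (word_metric (G\<lparr>carrier := H\<rparr>) T)
        (carrier G) (word_metric G S) (\<lambda>h. h))"


section \<open>Free groups and free factors\<close>

text \<open>\<open>X\<close> is a basis iff the canonical map from the free group on \<open>X\<close>, realised by
  reduced words, is a bijection onto \<open>G\<close>.\<close>

definition free_basis :: "('a, 'b) monoid_scheme \<Rightarrow> 'a set \<Rightarrow> bool" where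
  "free_basis G X \<longleftrightarrow>
    X \<subseteq> carrier G \<and> bij_betw (word_val G) (reduced_words X) (carrier G)"

definition free_group :: "('a, 'b) monoid_scheme \<Rightarrow> bool" where
  "free_group G \<longleftrightarrow> group G \<and> (\<exists>X. free_basis G X)"

definition free_group_of_rank :: "('a, 'b) monoid_scheme \<Rightarrow> nat \<Rightarrow> bool" where
  "free_group_of_rank G r \<longleftrightarrow>
    group G \<and> (\<exists>X. free_basis G X \<and> finite X \<and> card X = r)"

text \<open>Normal forms of the free product of \<open>A\<close> and \<open>B\<close>: the constructor
  \<open>Inl\<close> marks a syllable from \<open>A\<close> and \<open>Inr\<close> one from \<open>B\<close>. The marks make
  \<open>A\<close> and \<open>B\<close> formally disjoint, so that injectivity in \<open>is_free_product\<close>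
  forces them to intersect trivially.\<close>

definition free_product_words ::
  "('a, 'b) monoid_scheme \<Rightarrow> 'a set \<Rightarrow> 'a set \<Rightarrow> ('a + 'a) list set" where
  "free_product_words G A B =
    {w \<in> lists ((A - {\<one>\<^bsub>G\<^esub>}) <+> (B - {\<one>\<^bsub>G\<^esub>})). successively (\<lambda>u v. isl u \<noteq> isl v) w}"

definition syllables_val :: "('a, 'b) monoid_scheme \<Rightarrow> ('a + 'a) list \<Rightarrow> 'a" where
  "syllables_val G w = foldr (\<lambda>u g. case_sum id id u \<otimes>\<^bsub>G\<^esub> g) w \<one>\<^bsub>G\<^esub>"

definition is_free_product :: "('a, 'b) monoid_scheme \<Rightarrow> 'a set \<Rightarrow> 'a set \<Rightarrow> bool" where
  "is_free_product G A B \<longleftrightarrow>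
    subgroup A G \<and> subgroup B G \<and>
    bij_betw (syllables_val G) (free_product_words G A B) (carrier G)"

definition free_factor :: "'a set \<Rightarrow> ('a, 'b) monoid_scheme \<Rightarrow> bool" where
  "free_factor A G \<longleftrightarrow> (\<exists>B. is_free_product G A B)"

definition proper_free_factor :: "'a set \<Rightarrow> ('a, 'b) monoid_scheme \<Rightarrow> bool" where
  "proper_free_factor A G \<longleftrightarrow> free_factor A G \<and> A \<noteq> carrier G"

end

(* Let H' be one of the subgroups in question. Choose a finite graph, labelled by elements of G, that
   represents H' with its rank, and whose total length is minimal. Contracting vertices of small
   valence bounds the number of edges in terms of r, so there is a large gap in the edge lengths on
   a scale that depends only on G, r and H. The components of the subgraph of short edges represent
   free factors of conjugates of H'. They are quasiconvex because H' is, and uniformly so because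
   they are generated by elements of bounded length, which leaves finitely many possibilities. By
   minimality a long edge is nearly perpendicular to these components, and two long edges leaving
   the same component diverge quickly (otherwise they could be folded). By hyperbolicity, a path that
   crosses long edges without backtracking then ends far away from its origin. Hence the generators
   of H lie in the free factor carried by the short edges at the base vertex. That factor must be all
   of H', so H' is generated by elements of bounded length. *)

theory Submission
  imports Defs
begin

text \<open>The obstacle is uniformity: a priori H' ranges over infinitely many groups without a
  common quasiconvexity constant. At a length scale N only finitely many generating sets occur, so
  the components of short edges share a constant Q(N); but the gap that the geometry requires
  depends on Q(N). Hence the scales are nested: N_{k+1} exceeds N_k by at least the gap determined
  by N_k and Q(N_k), and the pigeonhole principle for at most 3r edges finds some k <= 3r with no
  edge length between N_k and N_{k+1}. Topology is kept algebraic. A graph is unfolded to G x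
  vertices, and being a forest means that every prescription of permutations along the edges is
  integrated by a function on this set. The condition survives sliding, flipping and contracting
  edges by mere composition of permutations; applied to the free group acting on its reduced words,
  it returns a free basis. That basis is what makes the component groups quasiconvex: reduced words
  over a part of it are quasigeodesics of G that stay inside the factor.\<close>

section \<open>Values of words and generated subgroups\<close>

lemma (in group) inv_mult_cancel [simp]:
  "x \<in> carrier G \<Longrightarrow> y \<in> carrier G \<Longrightarrow> inv x \<otimes> (x \<otimes> y) = y"
  "x \<in> carrier G \<Longrightarrow> y \<in> carrier G \<Longrightarrow> x \<otimes> (inv x \<otimes> y) = y"
  by (simp_all add: m_assoc[symmetric])

lemma (in group) inv_mult_eq_one_iff:
  "x \<in> carrier G \<Longrightarrow> y \<in> carrier G \<Longrightarrow> inv x \<otimes> y = \<one> \<longleftrightarrow> x = y"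
  by (metis inv_closed inv_mult_cancel(2) l_inv r_one)

lemma (in group) letter_val_closed [simp, intro]:
  "fst l \<in> carrier G \<Longrightarrow> letter_val G l \<in> carrier G"
  by (cases l) auto

lemma (in group) word_val_Nil [simp]: "word_val G [] = \<one>"
  by (simp add: word_val_def)

lemma (in group) word_val_Cons [simp]: "word_val G (l # w) = letter_val G l \<otimes> word_val G w"
  by (simp add: word_val_def)

lemma words_Nil [simp]: "[] \<in> words S"
  by (simp add: words_def)

lemma words_Cons [simp]: "l # w \<in> words S \<longleftrightarrow> fst l \<in> S \<and> w \<in> words S"
  by (cases l) (auto simp: words_def)

lemma words_append [simp]: "u @ w \<in> words S \<longleftrightarrow> u \<in> words S \<and> w \<in> words S"
  by (auto simp: words_def)

lemma words_mono: "w \<in> words S \<Longrightarrow> S \<subseteq> T \<Longrightarrow> w \<in> words T"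
  by (auto simp: words_def)

lemma (in group) word_val_closed [simp, intro]:
  "w \<in> words S \<Longrightarrow> S \<subseteq> carrier G \<Longrightarrow> word_val G w \<in> carrier G"
  by (induction w) auto

lemma (in group) word_val_append:
  "\<lbrakk>u \<in> words S; w \<in> words S; S \<subseteq> carrier G\<rbrakk> \<Longrightarrow> word_val G (u @ w) = word_val G u \<otimes> word_val G w"
proof (induction u)
  case (Cons l u)
  then have "letter_val G l \<in> carrier G" "word_val G u \<in> carrier G" "word_val G w \<in> carrier G"
    by auto
  with Cons show ?case by (simp add: m_assoc)
qed auto

definition inv_letter :: "'a \<times> bool \<Rightarrow> 'a \<times> bool" where
  "inv_letter l = (fst l, \<not> snd l)"

definition inv_word :: "('a \<times> bool) list \<Rightarrow> ('a \<times> bool) list" where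
  "inv_word w = rev (map inv_letter w)"

lemma fst_inv_letter [simp]: "fst (inv_letter l) = fst l"
  and snd_inv_letter [simp]: "snd (inv_letter l) = (\<not> snd l)"
  and inv_letter_inv_letter [simp]: "inv_letter (inv_letter l) = l"
  and inv_letter_neq [simp]: "inv_letter l \<noteq> l" "l \<noteq> inv_letter l"
  by (auto simp: inv_letter_def prod_eq_iff)

lemma inv_letter_eq_iff: "inv_letter l = k \<longleftrightarrow> l = inv_letter k"
  by auto

lemma inv_word_words [simp]: "inv_word w \<in> words S \<longleftrightarrow> w \<in> words S"
  by (induction w) (auto simp: inv_word_def)

lemma length_inv_word [simp]: "length (inv_word w) = length w"
  by (simp add: inv_word_def)

lemma (in group) letter_val_inv:
  "fst l \<in> carrier G \<Longrightarrow> letter_val G (inv_letter l) = inv (letter_val G l)"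
  by (cases l) (auto simp: inv_letter_def)

lemma (in group) word_val_inv:
  "w \<in> words S \<Longrightarrow> S \<subseteq> carrier G \<Longrightarrow> word_val G (inv_word w) = inv (word_val G w)"
proof (induction w)
  case (Cons l w)
  have l: "fst l \<in> carrier G" and w: "word_val G w \<in> carrier G" using Cons by auto
  have "word_val G (inv_word (l # w)) = word_val G (inv_word w @ [inv_letter l])"
    by (simp add: inv_word_def)
  also have "\<dots> = word_val G (inv_word w) \<otimes> word_val G [inv_letter l]"
    by (rule word_val_append[of _ S]) (use Cons in auto)
  also have "\<dots> = inv (word_val G (l # w))"
    using Cons l w letter_val_closed[of l] by (simp add: letter_val_inv inv_mult_group)
  finally show ?case .
qed (simp add: inv_word_def)

lemma (in group) generate_eq_word_vals:
  assumes "S \<subseteq> carrier G"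
  shows "generate G S = word_val G ` words S"
proof (intro subset_antisym subsetI)
  fix g assume "g \<in> generate G S"
  then show "g \<in> word_val G ` words S"
  proof induction
    case one
    show ?case by (rule image_eqI[of _ _ "[]"]) auto
  next
    case (incl h)
    with assms show ?case by (intro image_eqI[of _ _ "[(h, True)]"]) auto
  next
    case (inv h)
    with assms show ?case by (intro image_eqI[of _ _ "[(h, False)]"]) auto
  next
    case (eng h1 h2)
    then obtain u w where "u \<in> words S" "w \<in> words S" "h1 = word_val G u" "h2 = word_val G w" by auto
    with assms show ?case
      by (intro image_eqI[of _ _ "u @ w"]) (auto simp: word_val_append)
  qed
next
  have *: "w \<in> words S \<Longrightarrow> word_val G w \<in> generate G S" for w
  proof (induction w)
    case (Cons l w)
    then have "letter_val G l \<in> generate G S"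
      by (cases l) (auto intro: generate.incl generate.inv)
    with Cons show ?case by (auto intro: generate.eng)
  qed (auto intro: generate.one)
  fix g assume "g \<in> word_val G ` words S"
  with * show "g \<in> generate G S" by auto
qed

lemma (in group) subgroup_word_vals:
  "S \<subseteq> carrier G \<Longrightarrow> subgroup (word_val G ` words S) G"
  using generate_is_subgroup generate_eq_word_vals by metis

lemma (in group) word_val_subgroup:
  assumes "subgroup H G" "w \<in> words H"
  shows "word_val (G\<lparr>carrier := H\<rparr>) w = word_val G w" and "word_val G w \<in> H"
proof -
  have l: "letter_val (G\<lparr>carrier := H\<rparr>) l = letter_val G l" if "fst l \<in> H" for l
    using that assms(1) by (cases l) (auto simp: m_inv_consistent)
  have l': "letter_val G l \<in> H" if "fst l \<in> H" for l
    using that assms(1) by (cases l) (auto simp: subgroup.m_inv_closed)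
  show "word_val (G\<lparr>carrier := H\<rparr>) w = word_val G w"
    using assms(2) by (induction w) (auto simp: word_val_def l simp del: letter_val.simps)
  show "word_val G w \<in> H"
    using assms(2) by (induction w) (auto simp: l' subgroup.m_closed[OF assms(1)] subgroup.one_closed[OF assms(1)])
qed

section \<open>Word metrics\<close>

locale gen_group = group G for G (structure) +
  fixes S :: "'a set"
  assumes fgs: "finite_generating_set G S"
begin

lemma S_finite: "finite S" and S_carrier: "S \<subseteq> carrier G"
  and S_gen: "carrier G = word_val G ` words S"
  using fgs generate_eq_word_vals by (auto simp: finite_generating_set_def)

definition len :: "'a \<Rightarrow> nat" where "len g = word_length G S g"

definition d :: "'a \<Rightarrow> 'a \<Rightarrow> real" where "d x y = real (len (inv x \<otimes> y))"

lemma d_word_metric: "word_metric G S = d"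
  by (auto simp: fun_eq_iff d_def len_def word_metric_def)

lemma len_le: "w \<in> words S \<Longrightarrow> len (word_val G w) \<le> length w"
  unfolding len_def word_length_def by (rule Least_le) auto

lemma len_word:
  assumes "g \<in> carrier G"
  obtains w where "w \<in> words S" "length w = len g" "word_val G w = g"
proof -
  obtain w0 where "w0 \<in> words S" "word_val G w0 = g" using assms S_gen by auto
  then have "\<exists>w\<in>words S. length w = length w0 \<and> word_val G w = g" by auto
  then have "\<exists>w\<in>words S. length w = len g \<and> word_val G w = g"
    unfolding len_def word_length_def by (rule LeastI)
  then show thesis using that by auto
qed

lemma len_one [simp]: "len \<one> = 0"
  using len_le[of "[]"] by simp

lemma len_mult: "g \<in> carrier G \<Longrightarrow> h \<in> carrier G \<Longrightarrow> len (g \<otimes> h) \<le> len g + len h"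
proof -
  assume g: "g \<in> carrier G" and h: "h \<in> carrier G"
  obtain u where u: "u \<in> words S" "length u = len g" "word_val G u = g" using len_word[OF g] .
  obtain w where w: "w \<in> words S" "length w = len h" "word_val G w = h" using len_word[OF h] .
  show ?thesis using len_le[of "u @ w"] u w word_val_append[OF u(1) w(1) S_carrier] by simp
qed

lemma len_inv [simp]: "g \<in> carrier G \<Longrightarrow> len (inv g) = len g"
proof -
  have *: "len (inv g) \<le> len g" if g: "g \<in> carrier G" for g
  proof -
    obtain u where u: "u \<in> words S" "length u = len g" "word_val G u = g" using len_word[OF g] .
    then show ?thesis using len_le[of "inv_word u"] word_val_inv[OF u(1) S_carrier] by simp
  qed
  assume "g \<in> carrier G"
  then show ?thesis using *[of g] *[of "inv g"] by simp
qed

text \<open>Cut a shortest word after m letters: the pieces have length at most m and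
  \<open>len g - m\<close>, and subadditivity forces equality.\<close>

lemma len_split:
  assumes "g \<in> carrier G" "m \<le> len g"
  obtains a b where "a \<in> carrier G" "b \<in> carrier G" "g = a \<otimes> b" "len a = m" "len b = len g - m"
proof -
  obtain u where u: "u \<in> words S" "length u = len g" "word_val G u = g" using len_word[OF assms(1)] .
  have tu: "take m u \<in> words S" "drop m u \<in> words S"
    using u(1) words_append[of "take m u" "drop m u" S] by auto
  define a b where "a = word_val G (take m u)" and "b = word_val G (drop m u)"
  have ab: "a \<in> carrier G" "b \<in> carrier G" using tu S_carrier by (auto simp: a_def b_def)
  have g: "g = a \<otimes> b" using word_val_append[OF tu S_carrier] u(3) unfolding a_def b_def by (metis append_take_drop_id)
  have "len a \<le> m" "len b \<le> len g - m"
    using len_le[OF tu(1)] len_le[OF tu(2)] u assms(2) by (auto simp: a_def b_def)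
  moreover have "len g \<le> len a + len b" using len_mult[OF ab] g by simp
  ultimately show thesis using that[OF ab g] assms(2) by simp
qed

lemma finite_len_ball: "finite {g \<in> carrier G. len g \<le> n}"
proof -
  have "{g \<in> carrier G. len g \<le> n} \<subseteq> word_val G ` {w. set w \<subseteq> S \<times> UNIV \<and> length w \<le> n}"
  proof
    fix g assume "g \<in> {g \<in> carrier G. len g \<le> n}"
    then have "g \<in> carrier G" "len g \<le> n" by auto
    moreover then obtain w where "w \<in> words S" "length w = len g" "word_val G w = g" using len_word by blast
    ultimately show "g \<in> word_val G ` {w. set w \<subseteq> S \<times> UNIV \<and> length w \<le> n}"
      by (intro image_eqI[of _ _ w]) (auto simp: words_def)
  qed
  moreover have "finite {w. set w \<subseteq> S \<times> (UNIV :: bool set) \<and> length w \<le> n}"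
    by (rule finite_lists_length_le) (use S_finite in auto)
  ultimately show ?thesis by (meson finite_imageI finite_subset)
qed

lemma d_nonneg [simp]: "0 \<le> d x y" by (simp add: d_def)

lemma d_refl [simp]: "x \<in> carrier G \<Longrightarrow> d x x = 0" by (simp add: d_def)

lemma d_sym: "x \<in> carrier G \<Longrightarrow> y \<in> carrier G \<Longrightarrow> d x y = d y x"
proof -
  assume xy: "x \<in> carrier G" "y \<in> carrier G"
  then have "inv y \<otimes> x = inv (inv x \<otimes> y)" by (simp add: inv_mult_group)
  with xy show ?thesis by (simp add: d_def)
qed

lemma d_triangle:
  "x \<in> carrier G \<Longrightarrow> y \<in> carrier G \<Longrightarrow> z \<in> carrier G \<Longrightarrow> d x z \<le> d x y + d y z"
proof -
  assume xyz: "x \<in> carrier G" "y \<in> carrier G" "z \<in> carrier G"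
  then have "inv x \<otimes> z = (inv x \<otimes> y) \<otimes> (inv y \<otimes> z)"
    by (simp add: m_assoc)
  then show ?thesis using xyz len_mult[of "inv x \<otimes> y" "inv y \<otimes> z"] by (simp add: d_def)
qed

lemma d_left [simp]:
  "g \<in> carrier G \<Longrightarrow> x \<in> carrier G \<Longrightarrow> y \<in> carrier G \<Longrightarrow> d (g \<otimes> x) (g \<otimes> y) = d x y"
proof -
  assume g: "g \<in> carrier G" "x \<in> carrier G" "y \<in> carrier G"
  then have "inv (g \<otimes> x) \<otimes> (g \<otimes> y) = inv x \<otimes> y"
    by (simp add: inv_mult_group m_assoc)
  then show ?thesis by (simp add: d_def)
qed

lemma d_one: "g \<in> carrier G \<Longrightarrow> d \<one> g = len g"
  by (simp add: d_def)

lemma d_mult_right: "x \<in> carrier G \<Longrightarrow> g \<in> carrier G \<Longrightarrow> d x (x \<otimes> g) = len g"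
  using d_left[of x \<one> g] by (simp add: d_one)

lemma d_int: obtains n where "d x y = real n"
  by (simp add: d_def)

text \<open>Stands in for geodesics: \<open>d\<close> lives on group elements only, so points
  between x and y are provided at integer distances.\<close>

lemma between_ex:
  assumes "x \<in> carrier G" "y \<in> carrier G" "real m \<le> d x y"
  obtains z where "z \<in> carrier G" "d x z = m" "d z y = d x y - m"
proof -
  have "m \<le> len (inv x \<otimes> y)" using assms(3) by (simp add: d_def)
  then obtain a b where ab: "a \<in> carrier G" "b \<in> carrier G" "inv x \<otimes> y = a \<otimes> b" "len a = m"
      "len b = len (inv x \<otimes> y) - m"
    using len_split[of "inv x \<otimes> y" m] assms by auto
  have y: "y = (x \<otimes> a) \<otimes> b"
    using ab(1,2) assms(1,2) by (simp add: m_assoc flip: ab(3))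
  have "d x (x \<otimes> a) = m" using ab(1,4) assms(1) by (simp add: d_mult_right)
  moreover have "d (x \<otimes> a) y = len b"
    unfolding y using ab(1,2) assms(1) by (intro d_mult_right) auto
  ultimately show thesis using that[of "x \<otimes> a"] ab assms by (simp add: d_def of_nat_diff)
qed

end

lemma (in gen_group) len_compare:
  assumes "T \<subseteq> carrier G" "finite T"
  obtains M where "M \<ge> 1" "\<And>w. w \<in> words T \<Longrightarrow> len (word_val G w) \<le> M * length w"
proof -
  define M where "M = Max (insert 1 (len ` T))"
  have M: "M \<ge> 1" "\<And>t. t \<in> T \<Longrightarrow> len t \<le> M" using assms by (auto simp: M_def)
  have "len (word_val G w) \<le> M * length w" if "w \<in> words T" for w
    using that
  proof (induction w)
    case (Cons l w)
    then have l: "fst l \<in> carrier G" and w: "word_val G w \<in> carrier G" using assms by auto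
    have "len (letter_val G l) \<le> M" using Cons M l by (cases l) auto
    with Cons len_mult[OF letter_val_closed[OF l] w] show ?case by simp
  qed auto
  with M show thesis using that by auto
qed

section \<open>Hyperbolic word metrics\<close>

lemma linear_le_power2:
  fixes a b :: real
  shows "\<exists>M. \<forall>m\<ge>M. a * real m + b \<le> 2 ^ m"
proof -
  \<comment> \<open>Squaring m <= 2 * 2 ^ (m div 2) yields a quadratic lower bound for the
    exponential, which beats every linear function.\<close>
  have sq: "real m * real m \<le> 4 * 2 ^ m" for m :: nat
  proof -
    define q where "q = m div 2"
    have q: "q + 1 \<le> 2 ^ q" by (simp add: Suc_leI)
    have "m \<le> 2 * (q + 1)" unfolding q_def by presburger
    also have "\<dots> \<le> 2 * 2 ^ q" using q by (rule mult_le_mono2)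
    finally have "m * m \<le> (2 * 2 ^ q) * (2 * 2 ^ q)" using mult_le_mono by blast
    also have "\<dots> = 4 * 2 ^ (2 * q)" by (simp add: power_even_eq power2_eq_square)
    also have "\<dots> \<le> 4 * 2 ^ m" by (simp add: q_def power_increasing)
    finally have "real (m * m) \<le> real (4 * 2 ^ m)" by (simp only: of_nat_le_iff)
    then show ?thesis by simp
  qed
  define M where "M = nat \<lceil>4 * (\<bar>a\<bar> + \<bar>b\<bar>)\<rceil> + 1"
  have "a * real m + b \<le> 2 ^ m" if "m \<ge> M" for m
  proof -
    have m1: "real m \<ge> 1" and m2: "real m \<ge> 4 * (\<bar>a\<bar> + \<bar>b\<bar>)"
      using that unfolding M_def by linarith+
    have "a * real m + b \<le> \<bar>a\<bar> * real m + \<bar>b\<bar> * real m"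
      using mult_left_mono[OF m1, of "\<bar>b\<bar>"] mult_right_mono[of a "\<bar>a\<bar>" "real m"] m1
      by linarith
    also have "\<dots> = (\<bar>a\<bar> + \<bar>b\<bar>) * real m" by (simp add: algebra_simps)
    also have "\<dots> \<le> (real m / 4) * real m" by (rule mult_right_mono) (use m2 in auto)
    also have "\<dots> \<le> 2 ^ m" using sq[of m] by simp
    finally show ?thesis .
  qed
  then show ?thesis by blast
qed

text \<open>Take m proportional to D: then \<open>2 ^ m\<close> outgrows the linear left side, while
  \<open>m * \<delta>\<close> is at most D / 2. In the stability argument
  \<open>K * (6 * D + 1)\<close> bounds the number of steps of a path piece and
  \<open>l / 2 + (m + 2) * \<delta>\<close> is the total loss in Gromov products.\<close>

lemma exponential_threshold:
  fixes \<delta> K l :: real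
  assumes "\<delta> \<ge> 0" "K \<ge> 0" "l \<ge> 0"
  obtains Q where "Q \<ge> 0" "\<And>D. D > Q \<Longrightarrow> \<exists>m::nat. K * (6 * D + 1) \<le> 2 ^ m \<and> l / 2 + (m + 2) * \<delta> < D"
proof -
  obtain M where M: "\<And>m. m \<ge> M \<Longrightarrow> (12 * K * (\<delta> + 1)) * real m + (12 * K * (\<delta> + 1) + K) \<le> 2 ^ m"
    using linear_le_power2 by metis
  define Q where "Q = l + 4 * \<delta> + 2 * (\<delta> + 1) * (M + 1)"
  have "\<exists>m::nat. K * (6 * D + 1) \<le> 2 ^ m \<and> l / 2 + (m + 2) * \<delta> < D" if D: "D > Q" for D
  proof -
    define m where "m = nat \<lfloor>D / (2 * (\<delta> + 1))\<rfloor>"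
    have pos: "2 * (\<delta> + 1) > 0" using assms by simp
    have "2 * (\<delta> + 1) * (M + 1) \<ge> 0" using assms by simp
    then have D0: "D > 0" "D > l + 4 * \<delta>" "D > 2 * (\<delta> + 1) * (M + 1)"
      using D assms unfolding Q_def by linarith+
    have m1: "real m \<le> D / (2 * (\<delta> + 1))" and m2: "D / (2 * (\<delta> + 1)) < real m + 1"
      using D0 pos unfolding m_def by (simp_all add: of_nat_floor)
    have m3: "real m * (2 * (\<delta> + 1)) \<le> D" and m4: "D < (real m + 1) * (2 * (\<delta> + 1))"
      using m1 m2 pos by (simp_all add: pos_le_divide_eq pos_divide_less_eq)
    have "2 * (\<delta> + 1) * (M + 1) < 2 * (\<delta> + 1) * (real m + 1)"
      using less_trans[OF D0(3) m4] by (simp only: mult.commute)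
    then have "M \<le> m" using pos by simp
    from M[OF this] have M': "12 * K * (\<delta> + 1) * real m + (12 * K * (\<delta> + 1) + K) \<le> 2 ^ m" .
    have "K * (6 * D + 1) \<le> K * (6 * ((real m + 1) * (2 * (\<delta> + 1))) + 1)"
      by (rule mult_left_mono) (use m4 assms in auto)
    also have "\<dots> = 12 * K * (\<delta> + 1) * real m + (12 * K * (\<delta> + 1) + K)"
      by (simp add: algebra_simps)
    finally have "K * (6 * D + 1) \<le> 2 ^ m" using M' by linarith
    moreover have "real m * \<delta> * 2 \<le> D" using m3 by (simp add: algebra_simps)
    then have "l / 2 + (m + 2) * \<delta> < D" using D0 by (simp add: algebra_simps)
    ultimately show ?thesis by blast
  qed
  moreover have "Q \<ge> 0" using assms by (simp add: Q_def)
  ultimately show thesis using that by blast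
qed

section \<open>Gromov products and stability of quasigeodesics\<close>

locale hyp_group = gen_group +
  fixes \<delta> :: real
  assumes \<delta>_nonneg: "\<delta> \<ge> 0"
    and hyperbolic: "gromov_hyperbolic \<delta> (carrier G) (word_metric G S)"
begin

abbreviation gp :: "'a \<Rightarrow> 'a \<Rightarrow> 'a \<Rightarrow> real" where
  "gp x y w \<equiv> gromov_product d x y w"

lemma gp_def: "gp x y w = (d x w + d y w - d x y) / 2"
  by (simp add: gromov_product_def)

lemma gp_hyp:
  "\<lbrakk>x \<in> carrier G; y \<in> carrier G; z \<in> carrier G; w \<in> carrier G\<rbrakk>
    \<Longrightarrow> gp x z w \<ge> min (gp x y w) (gp y z w) - \<delta>"
  using hyperbolic by (auto simp: gromov_hyperbolic_def d_word_metric)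

lemma gp_sym: "\<lbrakk>x \<in> carrier G; y \<in> carrier G\<rbrakk> \<Longrightarrow> gp x y w = gp y x w"
  by (simp add: gp_def d_sym[of x y])

text \<open>Bisecting the chain costs one \<delta> per level, so the loss is only logarithmic in the
  number of points. This is the source of the exponential length in the stability argument.\<close>

lemma gp_chain:
  assumes "\<And>i. i \<le> n \<Longrightarrow> c i \<in> carrier G" "z \<in> carrier G"
    and "\<And>i. i < n \<Longrightarrow> gp (c i) (c (Suc i)) z \<ge> P" and "0 < n" "n \<le> 2 ^ m"
  shows "gp (c 0) (c n) z \<ge> P - m * \<delta>"
  using assms
proof (induction m arbitrary: n c)
  case 0
  then have "n = 1" by simp
  with 0 show ?case by auto
next
  case (Suc m)
  have mono: "P - Suc m * \<delta> \<le> P - m * \<delta>" using \<delta>_nonneg by (simp add: algebra_simps)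
  show ?case
  proof (cases "n \<le> 2 ^ m")
    case True
    with Suc.IH[of n c] Suc.prems mono show ?thesis by force
  next
    case False
    define k :: nat where "k = 2 ^ m"
    have k: "0 < k" "k < n" "n - k \<le> 2 ^ m" using False Suc.prems by (auto simp: k_def)
    have "gp (c 0) (c k) z \<ge> P - m * \<delta>"
      using Suc.IH[of k c] Suc.prems k by (simp add: k_def)
    moreover have "gp (c k) (c n) z \<ge> P - m * \<delta>"
      using Suc.IH[of "n - k" "\<lambda>i. c (k + i)"] Suc.prems k by simp
    moreover have "gp (c 0) (c n) z \<ge> min (gp (c 0) (c k) z) (gp (c k) (c n) z) - \<delta>"
      by (rule gp_hyp) (use Suc.prems k in auto)
    ultimately show ?thesis by (simp add: algebra_simps)
  qed
qed

lemma finite_ball: "x \<in> carrier G \<Longrightarrow> finite {z \<in> carrier G. d x z \<le> r}"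
proof -
  assume x: "x \<in> carrier G"
  have "{z \<in> carrier G. d x z \<le> r} \<subseteq> (\<otimes>) x ` {g \<in> carrier G. len g \<le> nat \<lfloor>r\<rfloor>}"
  proof
    fix z assume "z \<in> {z \<in> carrier G. d x z \<le> r}"
    then have "z = x \<otimes> (inv x \<otimes> z)" "len (inv x \<otimes> z) \<le> nat \<lfloor>r\<rfloor>" "inv x \<otimes> z \<in> carrier G"
      using x by (auto simp: d_def le_nat_floor)
    then show "z \<in> (\<otimes>) x ` {g \<in> carrier G. len g \<le> nat \<lfloor>r\<rfloor>}" by blast
  qed
  then show ?thesis using finite_len_ball by (meson finite_imageI finite_subset)
qed

text \<open>Let \<open>z0\<close> be a point of the geodesic at maximal distance \<open>D\<close> from the path. Some piece of the path
  joins the two sides of \<open>z0\<close> outside the ball of radius \<open>D\<close> around \<open>z0\<close>. It has length linear in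
  \<open>D\<close>, but hyperbolicity makes it exponentially long.\<close>

lemma quasigeodesic_stability:
  assumes "K \<ge> 0" "l \<ge> 0"
  obtains Q where "\<And>n a z. \<lbrakk>\<And>i. i \<le> n \<Longrightarrow> a i \<in> carrier G; \<And>i. i < n \<Longrightarrow> d (a i) (a (Suc i)) \<le> l;
      \<And>i j. i \<le> j \<Longrightarrow> j \<le> n \<Longrightarrow> real (j - i) \<le> K * (d (a i) (a j) + 1);
      z \<in> carrier G; d (a 0) z + d z (a n) = d (a 0) (a n)\<rbrakk> \<Longrightarrow> \<exists>i\<le>n. d z (a i) \<le> Q"
proof -
  obtain Q where Q0: "Q \<ge> 0"
    and Q: "\<And>D. D > Q \<Longrightarrow> \<exists>m::nat. K * (6 * D + 1) \<le> 2 ^ m \<and> l / 2 + (m + 2) * \<delta> < D"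
    using exponential_threshold[OF \<delta>_nonneg assms] by metis
  have "\<exists>i\<le>n. d z (a i) \<le> Q"
    if a: "\<And>i. i \<le> n \<Longrightarrow> a i \<in> carrier G" and al: "\<And>i. i < n \<Longrightarrow> d (a i) (a (Suc i)) \<le> l"
      and aK: "\<And>i j. i \<le> j \<Longrightarrow> j \<le> n \<Longrightarrow> real (j - i) \<le> K * (d (a i) (a j) + 1)"
      and z: "z \<in> carrier G" "d (a 0) z + d z (a n) = d (a 0) (a n)" for n a z
  proof (rule ccontr)
    assume neg: "\<not> (\<exists>i\<le>n. d z (a i) \<le> Q)"
    have a0: "a 0 \<in> carrier G" and an: "a n \<in> carrier G" using a by auto
    \<comment> \<open>All points of all geodesics between the ends of the path, so that none has to
      be chosen. The set is finite, hence it has a worst point \<open>z0\<close>.\<close>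
    define B where "B = {z \<in> carrier G. d (a 0) z + d z (a n) = d (a 0) (a n)}"
    have "B \<subseteq> {z \<in> carrier G. d (a 0) z \<le> d (a 0) (a n)}"
      unfolding B_def by (smt (verit) Collect_mono d_nonneg)
    then have finB: "finite B" using finite_ball[OF a0] finite_subset by blast
    define f where "f z = Min ((\<lambda>i. d z (a i)) ` {..n})" for z
    have f_le: "i \<le> n \<Longrightarrow> f z \<le> d z (a i)" for z i by (auto simp: f_def intro: Min_le)
    have f_ex: "\<exists>i\<le>n. f z = d z (a i)" for z
    proof -
      have "f z \<in> (\<lambda>i. d z (a i)) ` {..n}" unfolding f_def by (rule Min_in) auto
      then show ?thesis by auto
    qed
    have "z \<in> B" using z by (simp add: B_def)
    obtain z0 where z0: "z0 \<in> B" "\<And>y. y \<in> B \<Longrightarrow> f y \<le> f z0"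
    proof -
      have "Max (f ` B) \<in> f ` B" using \<open>z \<in> B\<close> finB by (intro Max_in) auto
      then obtain z0 where "z0 \<in> B" "f z0 = Max (f ` B)" by auto
      then show thesis using that finB by simp
    qed
    define D where "D = f z0"
    obtain Dn :: nat where Dn: "D = real Dn" using f_ex[of z0] d_int unfolding D_def by metis
    have "f z > Q" using neg f_ex[of z] by force
    then have DQ: "D > Q" using z0(2)[OF \<open>z \<in> B\<close>] by (simp add: D_def)
    then have D0: "D > 0" using Q0 by simp
    have z0c: "z0 \<in> carrier G" and z0b: "d (a 0) z0 + d z0 (a n) = d (a 0) (a n)"
      using z0(1) by (auto simp: B_def)
    have Dle: "D \<le> d z0 (a i)" if "i \<le> n" for i using f_le that by (simp add: D_def)
    \<comment> \<open>Either the end itself, a path point, is within 2 * D of \<open>z0\<close>, or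
      the point y at distance 2 * D towards it lies in B and has a path point within D, by the
      choice of \<open>z0\<close>. As the path stays at distance at least D from \<open>z0\<close>,
      the product of y and \<open>a i\<close> is at least D.\<close>
    have ends: "\<exists>y i. y \<in> carrier G \<and> i \<le> n \<and> d e y + d y z0 = d e z0 \<and> d y z0 \<le> 2 * D
        \<and> d y (a i) \<le> D \<and> gp y (a i) z0 \<ge> D"
      if e: "e = a 0 \<or> e = a n" for e
    proof -
      have ec: "e \<in> carrier G" using e a0 an by auto
      obtain k where k: "k \<le> n" "e = a k" using e by auto
      show ?thesis
      proof (cases "d z0 e \<ge> 2 * D")
        case False
        have "d e z0 \<ge> D" using Dle[OF k(1)] k(2) d_sym[OF ec z0c] by simp
        then have "gp e e z0 \<ge> D" using ec by (simp add: gp_def)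
        with False show ?thesis
          using k ec D0 d_sym[OF ec z0c] by (intro exI[of _ e] exI[of _ k]) auto
      next
        case True
        then obtain y where y: "y \<in> carrier G" "d z0 y = 2 * D" "d y e = d z0 e - 2 * D"
          using between_ex[OF z0c ec, of "2 * Dn"] Dn by auto
        have ey: "d e y + d y z0 = d e z0"
          using y d_sym[OF ec z0c] d_sym[OF ec y(1)] d_sym[OF z0c y(1)] by simp
        have "y \<in> B"
          using e z0b ey d_triangle[OF a0 y(1) an] d_triangle[OF y(1) z0c an] d_triangle[OF a0 z0c y(1)]
            d_sym[OF a0 y(1)] d_sym[OF an y(1)] d_sym[OF z0c y(1)] d_sym[OF an z0c] y(1)
          unfolding B_def by auto
        then have "f y \<le> D" using z0(2) by (simp add: D_def)
        then obtain i where i: "i \<le> n" "d y (a i) \<le> D" using f_ex[of y] by auto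
        have "gp y (a i) z0 \<ge> D"
          using i Dle[OF i(1)] y d_sym[OF z0c y(1)] d_sym[OF z0c a[OF i(1)]] by (simp add: gp_def)
        with i y ey show ?thesis
          using d_sym[OF z0c y(1)] by (intro exI[of _ y] exI[of _ i]) auto
      qed
    qed
    obtain y1 i where y1: "y1 \<in> carrier G" "i \<le> n" "d (a 0) y1 + d y1 z0 = d (a 0) z0"
      "d y1 z0 \<le> 2 * D" "d y1 (a i) \<le> D" "gp y1 (a i) z0 \<ge> D" using ends[of "a 0"] by auto
    obtain y2 j where y2: "y2 \<in> carrier G" "j \<le> n" "d (a n) y2 + d y2 z0 = d (a n) z0"
      "d y2 z0 \<le> 2 * D" "d y2 (a j) \<le> D" "gp y2 (a j) z0 \<ge> D" using ends[of "a n"] by auto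
    note ai = a[OF y1(2)] and aj = a[OF y2(2)]
    \<comment> \<open>y1 and y2 lie on opposite sides of \<open>z0\<close>, so their product there
      is not positive; the chain y1, \<open>a i\<close>, \<open>a j\<close>, y2 will bound it below
      by a positive number.\<close>
    have "d y1 y2 \<ge> d y1 z0 + d y2 z0"
      using z0b y1(3) y2(3) d_triangle[OF a0 y1(1) an] d_triangle[OF y1(1) y2(1) an]
        d_sym[OF an y2(1)] d_sym[OF an z0c] by linarith
    then have gp0: "gp y1 y2 z0 \<le> 0" by (simp add: gp_def)
    obtain m :: nat where m: "K * (6 * D + 1) \<le> 2 ^ m" "l / 2 + (m + 2) * \<delta> < D"
      using Q[OF DQ] by blast
    have dij: "d (a i) (a j) \<le> 6 * D"
      using d_triangle[OF ai y1(1) aj] d_triangle[OF y1(1) z0c aj] d_triangle[OF z0c y2(1) aj]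
        d_sym[OF ai y1(1)] d_sym[OF z0c y2(1)] y1(4,5) y2(4,5) by linarith
    \<comment> \<open>Consecutive path points are at least D away from \<open>z0\<close> and at most
      l apart, and the quasigeodesic condition leaves at most \<open>2 ^ m\<close> steps. The
      indices are bound anew because the order of those found above is unknown.\<close>
    have piece: "gp (a i) (a j) z0 \<ge> D - l / 2 - m * \<delta>"
      if ij: "i \<le> j" "j \<le> n" "d (a i) (a j) \<le> 6 * D" for i j
    proof (cases "i = j")
      case True
      have "gp (a i) (a j) z0 \<ge> D"
        using True Dle[OF ij(2)] a[OF ij(2)] d_sym[OF z0c a[OF ij(2)]] by (simp add: gp_def)
      moreover have "m * \<delta> \<ge> 0" using \<delta>_nonneg by simp
      ultimately show ?thesis using assms(2) by linarith
    next
      case False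
      have "real (j - i) \<le> K * (d (a i) (a j) + 1)" using aK ij by simp
      also have "\<dots> \<le> K * (6 * D + 1)" by (rule mult_left_mono) (use ij assms in auto)
      finally have "real (j - i) \<le> real (2 ^ m)" using m(1) by (simp only: of_nat_power of_nat_numeral)
      then have "j - i \<le> 2 ^ m" by (simp only: of_nat_le_iff)
      moreover have "gp (a (i + k)) (a (i + Suc k)) z0 \<ge> D - l / 2" if "k < j - i" for k
      proof -
        have "i + k < n" using that ij by simp
        then show ?thesis
          using al[of "i + k"] Dle[of "i + k"] Dle[of "Suc (i + k)"]
            d_sym[OF z0c a[of "i + k"]] d_sym[OF z0c a[of "Suc (i + k)"]] by (simp add: gp_def)
      qed
      ultimately show ?thesis
        using gp_chain[of "j - i" "\<lambda>k. a (i + k)" z0 "D - l / 2" m] False ij a z0c by simp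
    qed
    have "gp (a i) (a j) z0 \<ge> D - l / 2 - m * \<delta>"
      using piece[of i j] piece[of j i] y1(2) y2(2) dij gp_sym[OF ai aj] d_sym[OF ai aj]
      by (cases "i \<le> j") auto
    moreover have "gp y1 (a j) z0 \<ge> min (gp y1 (a i) z0) (gp (a i) (a j) z0) - \<delta>"
      by (rule gp_hyp) (use y1 ai aj z0c in auto)
    moreover have "gp y1 y2 z0 \<ge> min (gp y1 (a j) z0) (gp (a j) y2 z0) - \<delta>"
      by (rule gp_hyp) (use y1 y2 aj z0c in auto)
    moreover have "gp (a j) y2 z0 \<ge> D" using y2 gp_sym[OF aj y2(1)] by simp
    moreover have "m * \<delta> \<ge> 0" using \<delta>_nonneg by simp
    ultimately have "gp y1 y2 z0 \<ge> D - l / 2 - m * \<delta> - 2 * \<delta>"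
      using y1(6) assms(2) \<delta>_nonneg by linarith
    with gp0 m(2) show False by (simp add: algebra_simps)
  qed
  then show thesis using that by blast
qed

end

section \<open>Free bases\<close>

definition reduced :: "('a \<times> bool) list \<Rightarrow> bool" where
  "reduced w \<longleftrightarrow> successively (\<lambda>l k. k \<noteq> inv_letter l) w"

lemma reduced_words_iff: "w \<in> reduced_words S \<longleftrightarrow> w \<in> words S \<and> reduced w"
proof -
  have "(\<lambda>(x, s) (y, t). \<not> (x = y \<and> s \<noteq> t)) = (\<lambda>l k :: 'a \<times> bool. k \<noteq> inv_letter l)"
    by (auto simp: fun_eq_iff inv_letter_def)
  then show ?thesis by (simp add: reduced_words_def reduced_def)
qed

lemma reduced_Nil [simp]: "reduced []"
  by (simp add: reduced_def)

lemma reduced_append: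
  "reduced (u @ w) \<longleftrightarrow> reduced u \<and> reduced w \<and> (u \<noteq> [] \<longrightarrow> w \<noteq> [] \<longrightarrow> hd w \<noteq> inv_letter (last u))"
  by (auto simp: reduced_def successively_append_iff)

lemma reduced_butlast: "reduced w \<Longrightarrow> reduced (butlast w)"
  by (metis append_butlast_last_id butlast.simps(1) reduced_append)

lemma words_butlast: "w \<in> words S \<Longrightarrow> butlast w \<in> words S"
  by (metis append_butlast_last_id butlast.simps(1) words_append)

definition rmul :: "('a \<times> bool) list \<Rightarrow> 'a \<times> bool \<Rightarrow> ('a \<times> bool) list" where
  "rmul w l = (if w \<noteq> [] \<and> last w = inv_letter l then butlast w else w @ [l])"

lemma reduced_rmul: "reduced w \<Longrightarrow> reduced (rmul w l)"
  using reduced_append[of w "[l]"] inv_letter_eq_iff[of "last w" l]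
  by (auto simp: rmul_def reduced_butlast reduced_def[of "[_]"])

lemma words_rmul: "w \<in> words S \<Longrightarrow> fst l \<in> S \<Longrightarrow> rmul w l \<in> words S"
  by (auto simp: rmul_def words_butlast)

lemma length_rmul: "length (rmul w l) \<le> length w + 1"
  by (auto simp: rmul_def)

lemma rmul_rmul_inv:
  assumes "reduced w"
  shows "rmul (rmul w l) (inv_letter l) = w"
proof (cases "w \<noteq> [] \<and> last w = inv_letter l")
  case True
  then have w: "w = butlast w @ [inv_letter l]" by (metis append_butlast_last_id)
  have "butlast w \<noteq> [] \<Longrightarrow> last (butlast w) \<noteq> l"
    using assms w reduced_append[of "butlast w" "[inv_letter l]"] by auto
  with True w show ?thesis by (auto simp: rmul_def)
qed (auto simp: rmul_def)

text \<open>Extended by the identity to words that are not reduced: the letter then permutes the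
  whole type of words, as \<open>acyclic_graph\<close> demands of its transitions.\<close>

definition ract :: "'a \<times> bool \<Rightarrow> ('a \<times> bool) list \<Rightarrow> ('a \<times> bool) list" where
  "ract l w = (if reduced w then rmul w l else w)"

lemma ract_ract_inv [simp]: "ract (inv_letter l) (ract l w) = w"
  by (simp add: ract_def reduced_rmul rmul_rmul_inv)

lemma bij_ract: "bij (ract l)"
  by (rule o_bij[of "ract (inv_letter l)"])
    (use ract_ract_inv[of "inv_letter l"] in \<open>auto simp: fun_eq_iff\<close>)

definition reduce :: "('a \<times> bool) list \<Rightarrow> ('a \<times> bool) list" where
  "reduce w = foldl rmul [] w"

lemma reduce_snoc: "reduce (w @ [l]) = rmul (reduce w) l"
  by (simp add: reduce_def)

lemma reduce_Nil [simp]: "reduce [] = []"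
  by (simp add: reduce_def)

lemma reduce_words: "w \<in> words S \<Longrightarrow> reduce w \<in> reduced_words S"
  by (induction w rule: rev_induct) (auto simp: reduced_words_iff reduce_snoc reduced_rmul words_rmul)

lemma length_reduce: "length (reduce w) \<le> length w"
proof (induction w rule: rev_induct)
  case (snoc l w)
  then show ?case using length_rmul[of "reduce w" l] by (simp add: reduce_snoc)
qed simp

context group
begin

lemma word_val_snoc:
  "w \<in> words S \<Longrightarrow> fst l \<in> S \<Longrightarrow> S \<subseteq> carrier G \<Longrightarrow> word_val G (w @ [l]) = word_val G w \<otimes> letter_val G l"
  by (subst word_val_append[of _ S]) (auto simp: subset_iff)

lemma word_val_rmul:
  assumes "w \<in> words S" "fst l \<in> S" "S \<subseteq> carrier G"
  shows "word_val G (rmul w l) = word_val G w \<otimes> letter_val G l"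
proof (cases "w \<noteq> [] \<and> last w = inv_letter l")
  case True
  then have w: "w = butlast w @ [inv_letter l]" by (metis append_butlast_last_id)
  have b: "butlast w \<in> words S" using assms words_butlast by blast
  have l: "fst l \<in> carrier G" using assms by auto
  have "word_val G w = word_val G (butlast w) \<otimes> inv (letter_val G l)"
    using word_val_snoc[OF b, of "inv_letter l"] assms w letter_val_inv[OF l] by auto
  then show ?thesis
    using True b assms l by (simp add: rmul_def m_assoc)
qed (use word_val_snoc[OF assms] in \<open>auto simp: rmul_def\<close>)

lemma word_val_reduce:
  "w \<in> words S \<Longrightarrow> S \<subseteq> carrier G \<Longrightarrow> word_val G (reduce w) = word_val G w"
proof (induction w rule: rev_induct)
  case (snoc l w)
  then have "reduce w \<in> words S" using reduce_words by (auto simp: reduced_words_iff)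
  with snoc show ?case by (simp add: reduce_snoc word_val_rmul[of _ S] word_val_snoc[of _ S])
qed simp

text \<open>A free basis of the subgroup H with words evaluated in the ambient group, which avoids
  changing carriers.\<close>

definition basis :: "'a set \<Rightarrow> 'a set \<Rightarrow> bool" where
  "basis X H \<longleftrightarrow> X \<subseteq> H \<and> bij_betw (word_val G) (reduced_words X) H"

lemma free_basis_iff_basis:
  assumes "subgroup H G"
  shows "free_basis (G\<lparr>carrier := H\<rparr>) X \<longleftrightarrow> basis X H"
proof -
  have "X \<subseteq> H \<Longrightarrow> bij_betw (word_val (G\<lparr>carrier := H\<rparr>)) (reduced_words X) H
      \<longleftrightarrow> bij_betw (word_val G) (reduced_words X) H"
    by (intro bij_betw_cong word_val_subgroup[OF assms]) (auto simp: reduced_words_iff intro: words_mono)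
  then show ?thesis by (auto simp: free_basis_def basis_def)
qed

end

section \<open>Subgroups with a fixed free basis\<close>

locale based_group = group G for G (structure) +
  fixes H X
  assumes H: "subgroup H G" and basis: "basis X H"
begin

lemma H_carrier: "H \<subseteq> carrier G" and X_H: "X \<subseteq> H" and X_carrier: "X \<subseteq> carrier G"
  using H basis subgroup.subset by (auto simp: basis_def)

lemma val_H: "w \<in> words X \<Longrightarrow> word_val G w \<in> H"
  using word_val_subgroup(2)[OF H] words_mono[OF _ X_H] by blast

definition rw :: "'a \<Rightarrow> ('a \<times> bool) list" where
  "rw = inv_into (reduced_words X) (word_val G)"

lemma rw: "h \<in> H \<Longrightarrow> rw h \<in> reduced_words X" "h \<in> H \<Longrightarrow> word_val G (rw h) = h"
  using basis unfolding rw_def basis_def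
  by (auto simp: bij_betw_def f_inv_into_f inv_into_into)

lemma rw_words: "h \<in> H \<Longrightarrow> rw h \<in> words X" and rw_reduced: "h \<in> H \<Longrightarrow> reduced (rw h)"
  using rw by (auto simp: reduced_words_iff)

lemma rw_eqI: "w \<in> reduced_words X \<Longrightarrow> word_val G w = h \<Longrightarrow> rw h = w"
  using basis unfolding rw_def basis_def by (auto simp: bij_betw_def)

lemma rw_val: "w \<in> words X \<Longrightarrow> rw (word_val G w) = reduce w"
  by (rule rw_eqI) (auto simp: reduce_words word_val_reduce X_carrier)

lemma rw_one [simp]: "rw \<one> = []"
  by (rule rw_eqI) (auto simp: reduced_words_iff)

lemma rw_mult_letter:
  "h \<in> H \<Longrightarrow> fst l \<in> X \<Longrightarrow> rw (h \<otimes> letter_val G l) = rmul (rw h) l"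
  by (rule rw_eqI)
    (auto simp: reduced_words_iff rw_words rw_reduced words_rmul reduced_rmul
      word_val_rmul[OF _ _ X_carrier] rw)

text \<open>By \<open>rw_val\<close> the reduced word is the reduction of u, and reduction never
  lengthens a word.\<close>

lemma reduced_shortest:
  "w \<in> reduced_words X \<Longrightarrow> u \<in> words X \<Longrightarrow> word_val G u = word_val G w \<Longrightarrow> length w \<le> length u"
  using rw_eqI[of w "word_val G w"] rw_val[of u] length_reduce[of u] by auto

lemma conj_pow:
  "g \<in> carrier G \<Longrightarrow> h \<in> carrier G \<Longrightarrow> (g \<otimes> h \<otimes> inv g) [^] (n::nat) = g \<otimes> h [^] n \<otimes> inv g"
  by (induction n) (auto simp: m_assoc)

lemma conj_eq_one: "g \<in> carrier G \<Longrightarrow> h \<in> carrier G \<Longrightarrow> g \<otimes> h \<otimes> inv g = \<one> \<Longrightarrow> h = \<one>"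
proof -
  assume gh: "g \<in> carrier G" "h \<in> carrier G" "g \<otimes> h \<otimes> inv g = \<one>"
  have "h = inv g \<otimes> (g \<otimes> h \<otimes> inv g) \<otimes> g" using gh(1,2) by (simp add: m_assoc)
  then show "h = \<one>" using gh by simp
qed

text \<open>Conjugate away a first letter that cancels the last one and induct on the length; if
  there is none, the word is cyclically reduced and its powers are reduced and nonempty.\<close>

lemma torsion_free_word:
  "w \<in> reduced_words X \<Longrightarrow> w \<noteq> [] \<Longrightarrow> 0 < n \<Longrightarrow> word_val G w [^] (n::nat) \<noteq> \<one>"
proof (induction "length w" arbitrary: w rule: less_induct)
  case less
  have w: "w \<in> words X" "reduced w" using less.prems by (auto simp: reduced_words_iff)
  show ?case
  proof (cases "last w = inv_letter (hd w)")
    case True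
    then have "butlast w \<noteq> []"
      using less.prems(2) by (cases w rule: rev_cases) (auto simp: hd_append split: if_splits)
    then obtain m where m: "w = hd w # m @ [inv_letter (hd w)]"
      using True less.prems(2)
      by (metis append_butlast_last_id butlast.simps(2) list.collapse last_ConsR)
    then have mw: "m \<in> words X" "reduced m" and l: "fst (hd w) \<in> X"
      using w words_append[of "[hd w]" "m @ [inv_letter (hd w)]" X]
        reduced_append[of "[hd w]" "m @ [inv_letter (hd w)]"] reduced_append[of m "[inv_letter (hd w)]"]
      by auto
    have lc: "fst (hd w) \<in> carrier G" using l X_carrier by auto
    have mc: "word_val G m \<in> carrier G" using mw X_carrier by auto
    have "word_val G w = word_val G (hd w # (m @ [inv_letter (hd w)]))" using m by simp
    also have "\<dots> = letter_val G (hd w) \<otimes> (word_val G m \<otimes> inv (letter_val G (hd w)))"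
      using l word_val_snoc[OF mw(1) _ X_carrier, of "inv_letter (hd w)"] letter_val_inv[OF lc] by simp
    finally have val: "word_val G w = letter_val G (hd w) \<otimes> word_val G m \<otimes> inv (letter_val G (hd w))"
      using lc mc by (simp add: m_assoc)
    have "m \<noteq> []"
    proof
      assume "m = []"
      then have w2: "w = [hd w, inv_letter (hd w)]" using m by (metis append_Nil)
      have "\<not> reduced w" by (subst w2) (simp add: reduced_def)
      with w show False by simp
    qed
    moreover have "length m < length w" using arg_cong[OF m, of length] by simp
    ultimately have *: "word_val G m [^] n \<noteq> \<one>"
      using less.hyps[of m] less.prems mw by (simp add: reduced_words_iff)
    show ?thesis
    proof
      assume "word_val G w [^] n = \<one>"
      then have "letter_val G (hd w) \<otimes> word_val G m [^] n \<otimes> inv (letter_val G (hd w)) = \<one>"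
        using val lc mc by (simp add: conj_pow)
      then have "word_val G m [^] n = \<one>"
        using conj_eq_one[of "letter_val G (hd w)" "word_val G m [^] n"] lc mc by auto
      with * show False by simp
    qed
  next
    case False
    define p where "p k = concat (replicate k w)" for k
    have hdw: "hd w \<noteq> inv_letter (last w)" using False by (auto simp: inv_letter_eq_iff)
    have p: "p k \<in> words X \<and> word_val G (p k) = word_val G w [^] k \<and> reduced (p k)
        \<and> (k > 0 \<longrightarrow> p k \<noteq> [] \<and> hd (p k) = hd w)" for k
    proof (induction k)
      case (Suc k)
      have "word_val G (p (Suc k)) = word_val G w \<otimes> word_val G w [^] k"
        using Suc word_val_append[OF w(1) _ X_carrier, of "p k"] by (simp add: p_def)
      also have "\<dots> = word_val G w [^] Suc k"
        using w(1) X_carrier nat_pow_mult[of "word_val G w" 1 k] by auto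
      finally show ?case
        using Suc w less.prems(2) hdw by (cases k) (auto simp: p_def reduced_append)
    qed (simp add: p_def)
    show ?thesis
    proof
      assume "word_val G w [^] n = \<one>"
      then have "rw \<one> = p n" using p[of n] by (intro rw_eqI) (auto simp: reduced_words_iff)
      with p[of n] less.prems show False by simp
    qed
  qed
qed

lemma torsion_free: "h \<in> H \<Longrightarrow> h \<noteq> \<one> \<Longrightarrow> 0 < n \<Longrightarrow> h [^] (n::nat) \<noteq> \<one>"
  using torsion_free_word[of "rw h"] rw[of h] by fastforce

text \<open>The universal property of a free group: permutations assigned to the basis extend to a
  right action of H, and \<psi> is an orbit map. Folding \<open>act\<close> along
  \<open>rw h\<close> respects multiplication because a cancelling pair of letters acts
  trivially.\<close>

lemma potential:
  assumes f: "bij_betw f K X" and \<sigma>: "\<And>e. e \<in> K \<Longrightarrow> bij (\<sigma> e :: 'w \<Rightarrow> 'w)"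
  obtains \<psi> where "\<psi> \<one> = w0" "\<And>h e. h \<in> H \<Longrightarrow> e \<in> K \<Longrightarrow> \<psi> (h \<otimes> f e) = \<sigma> e (\<psi> h)"
proof -
  define act where "act l = (let s = \<sigma> (inv_into K f (fst l)) in if snd l then s else inv_into UNIV s)" for l
  have act: "act (inv_letter l) (act l v) = v" if "fst l \<in> X" for l v
  proof -
    have "inv_into K f (fst l) \<in> K" using f that by (metis bij_betw_imp_surj_on inv_into_into)
    from \<sigma>[OF this] show ?thesis
      by (auto simp: act_def Let_def bij_is_inj bij_is_surj surj_f_inv_f)
  qed
  define \<psi> where "\<psi> h = fold act (rw h) w0" for h
  have fold: "fold act (rmul w l) w0 = act l (fold act w w0)" if "w \<in> words X" "fst l \<in> X" for w l
  proof (cases "w \<noteq> [] \<and> last w = inv_letter l")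
    case True
    then have w: "w = butlast w @ [inv_letter l]" by (metis append_butlast_last_id)
    have "fold act w w0 = act (inv_letter l) (fold act (butlast w) w0)"
      by (subst w) simp
    with True act[of "inv_letter l"] that show ?thesis by (simp add: rmul_def)
  qed (auto simp: rmul_def)
  have "\<psi> (h \<otimes> f e) = \<sigma> e (\<psi> h)" if "h \<in> H" "e \<in> K" for h e
  proof -
    have "f e \<in> X" using f that by (auto simp: bij_betw_def)
    then show ?thesis
      using that rw_mult_letter[of h "(f e, True)"] fold[OF rw_words[of h], of "(f e, True)"] f
      by (simp add: \<psi>_def act_def bij_betw_inv_into_left)
  qed
  then show thesis using that[of \<psi>] by (simp add: \<psi>_def)
qed

end

text \<open>Converse of \<open>potential\<close>: with the transitions \<open>ract\<close>, \<phi>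
  reads a reduced word off its value, so evaluation of reduced words is injective.\<close>

lemma (in group) basis_of_potential:
  fixes f :: "'i \<Rightarrow> 'a" and \<phi> :: "'a \<Rightarrow> ('i \<times> bool) list"
  assumes f: "f ` K \<subseteq> carrier G" and one: "\<phi> \<one> = []"
    and \<phi>: "\<And>x e. x \<in> carrier G \<Longrightarrow> e \<in> K \<Longrightarrow> \<phi> (x \<otimes> f e) = ract (e, True) (\<phi> x)"
  shows "inj_on f K" "basis (f ` K) (word_val G ` words (f ` K))"
proof -
  define fl where "fl = map_prod f (id :: bool \<Rightarrow> bool)"
  have \<phi>l: "\<phi> (x \<otimes> letter_val G (fl l)) = ract l (\<phi> x)" if "x \<in> carrier G" "fst l \<in> K" for x l
  proof (cases l)
    case (Pair e b)
    show ?thesis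
    proof (cases b)
      case True
      with Pair that \<phi> show ?thesis by (simp add: fl_def)
    next
      case False
      have e: "f e \<in> carrier G" "e \<in> K" using f that Pair by auto
      have "\<phi> x = ract (e, True) (\<phi> (x \<otimes> inv (f e)))"
        using \<phi>[of "x \<otimes> inv (f e)" e] e that by (simp add: m_assoc)
      then have "ract (e, False) (\<phi> x) = \<phi> (x \<otimes> inv (f e))"
        using ract_ract_inv[of "(e, True)"] by (simp add: inv_letter_def)
      with Pair False show ?thesis by (simp add: fl_def)
    qed
  qed
  have words: "map fl u \<in> words (f ` K)" if "u \<in> words K" for u
    using that by (induction u) (auto simp: fl_def)
  have \<phi>u: "\<phi> (word_val G (map fl u)) = u" if "u \<in> words K" "reduced u" for u
    using that
  proof (induction u rule: rev_induct)
    case (snoc l u)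
    then have u: "u \<in> words K" "reduced u" "fst l \<in> K" by (auto simp: reduced_append)
    have "word_val G (map fl (u @ [l])) = word_val G (map fl u) \<otimes> letter_val G (fl l)"
      using word_val_snoc[OF words[OF u(1)] _ f, of "fl l"] u by (simp add: fl_def)
    then have "\<phi> (word_val G (map fl (u @ [l]))) = ract l u"
      using \<phi>l[of "word_val G (map fl u)" l] words[OF u(1)] f u snoc.IH by auto
    also have "\<dots> = u @ [l]"
      using snoc.prems u by (auto simp: ract_def rmul_def reduced_append)
    finally show ?case .
  qed (simp add: one)
  show inj: "inj_on f K"
  proof (rule inj_onI)
    fix a b assume ab: "a \<in> K" "b \<in> K" "f a = f b"
    have "\<phi> (word_val G (map fl [(a, True)])) = [(a, True)]" "\<phi> (word_val G (map fl [(b, True)])) = [(b, True)]"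
      using ab by (intro \<phi>u; simp add: reduced_def)+
    with ab show "a = b" by (simp add: fl_def)
  qed
  define gl where "gl = map_prod (inv_into K f) (id :: bool \<Rightarrow> bool)"
  have gl: "gl ` (f ` K \<times> UNIV) \<subseteq> K \<times> UNIV" "l \<in> f ` K \<times> UNIV \<Longrightarrow> fl (gl l) = l" for l
    using inj by (auto simp: gl_def fl_def f_inv_into_f)
  have lift: "map gl w \<in> words K \<and> reduced (map gl w) \<and> map fl (map gl w) = w"
    if "w \<in> reduced_words (f ` K)" for w
  proof -
    have w: "set w \<subseteq> f ` K \<times> UNIV" "reduced w" using that by (auto simp: reduced_words_iff words_def)
    have "gl ` set w \<subseteq> K \<times> UNIV" using w(1) gl(1) by blast
    then have "map gl w \<in> words K" unfolding words_def in_lists_conv_set by auto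
    moreover have m: "map fl (map gl w) = w"
      using w(1) gl(2) by (induction w) auto
    moreover have "reduced (map gl w)"
    proof -
      have "reduced (map fl u) \<Longrightarrow> reduced u" for u
        unfolding reduced_def successively_map
        by (erule successively_mono) (auto simp: fl_def inv_letter_def)
      with m w(2) show ?thesis by metis
    qed
    ultimately show ?thesis by blast
  qed
  have "inj_on (word_val G) (reduced_words (f ` K))"
  proof (rule inj_onI)
    fix w v assume wv: "w \<in> reduced_words (f ` K)" "v \<in> reduced_words (f ` K)" "word_val G w = word_val G v"
    then have "map gl w = map gl v" using \<phi>u lift by metis
    with lift wv show "w = v" by metis
  qed
  moreover have "word_val G ` reduced_words (f ` K) = word_val G ` words (f ` K)"
  proof (intro subset_antisym subsetI)
    fix g assume "g \<in> word_val G ` words (f ` K)"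
    then obtain w where w: "w \<in> words (f ` K)" "g = word_val G w" by blast
    show "g \<in> word_val G ` reduced_words (f ` K)"
      by (rule image_eqI[of _ _ "reduce w"]) (use w reduce_words word_val_reduce[OF w(1) f] in auto)
  qed (auto simp: reduced_words_iff)
  moreover have "x \<in> word_val G ` words (f ` K)" if "x \<in> f ` K" for x
    by (rule image_eqI[of _ _ "[(x, True)]"]) (use that f in auto)
  ultimately show "basis (f ` K) (word_val G ` words (f ` K))"
    unfolding basis_def bij_betw_def by blast
qed

text \<open>A reduced word splits uniquely into maximal runs of letters from Y and from Z; the
  values of the runs are the syllables of a normal form.\<close>

lemma (in based_group) free_product_of_basis:
  assumes XYZ: "X = Y \<union> Z" "Y \<inter> Z = {}"
  shows "is_free_product (G\<lparr>carrier := H\<rparr>) (word_val G ` words Y) (word_val G ` words Z)"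
proof -
  \<comment> \<open>\<open>True\<close> stands for Y and for \<open>Inl\<close>, so that the class
    of a letter can be compared with \<open>isl\<close> of a syllable.\<close>
  define V where "V c = (if c then Y else Z)" for c
  define A where "A c = word_val G ` words (V c)" for c
  define cls where "cls l = (fst l \<in> Y)" for l :: "'a \<times> bool"
  have VX: "V c \<subseteq> X" for c using XYZ by (auto simp: V_def)
  have cls: "cls l = c" if "l \<in> set w" "w \<in> words (V c)" for l w c
  proof -
    have "l \<in> V c \<times> UNIV" using that by (auto simp: words_def)
    then show ?thesis using XYZ by (auto simp: cls_def V_def split: if_splits)
  qed
  have wordsV: "w \<in> words (V c)" if "w \<in> words X" "\<And>l. l \<in> set w \<Longrightarrow> cls l = c" for w c
    using that XYZ by (force simp: cls_def V_def words_def in_lists_conv_set)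
  have A_H: "A c \<subseteq> H" for c
    unfolding A_def using val_H words_mono[OF _ VX] by blast
  have rwA: "rw a \<in> reduced_words (V c)" if "a \<in> A c" for a c
    using that rw_val[OF words_mono[OF _ VX]] reduce_words by (auto simp: A_def)
  have sub: "subgroup (A c) (G\<lparr>carrier := H\<rparr>)" for c
    using subgroup_incl[OF subgroup_word_vals H A_H[unfolded A_def]] VX X_carrier
    unfolding A_def by blast
  define F where "F = free_product_words G (A True) (A False)"
  define el where "el u = case_sum id id u" for u :: "'a + 'a"
  define flat where "flat w = concat (map (\<lambda>u. rw (el u)) w)" for w
  have F_Cons: "u # w \<in> F \<longleftrightarrow> el u \<in> A (isl u) \<and> el u \<noteq> \<one> \<and> w \<in> F \<and> (w \<noteq> [] \<longrightarrow> isl (hd w) \<noteq> isl u)" for u w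
    by (cases u; cases w) (auto simp: F_def free_product_words_def el_def)
  have F_Nil: "[] \<in> F" by (simp add: F_def free_product_words_def)
  have nonempty: "rw (el u) \<noteq> []" if "el u \<in> A (isl u)" "el u \<noteq> \<one>" for u
  proof
    assume "rw (el u) = []"
    moreover have "el u \<in> H" using that A_H by blast
    ultimately show False using rw(2)[of "el u"] that by simp
  qed
  have flat: "flat w \<in> reduced_words X \<and> word_val G (flat w) = syllables_val G w
      \<and> (w \<noteq> [] \<longrightarrow> flat w \<noteq> [] \<and> cls (hd (flat w)) = isl (hd w))" if "w \<in> F" for w
    using that
  proof (induction w)
    case (Cons u w)
    then have u: "el u \<in> A (isl u)" "el u \<noteq> \<one>" "w \<in> F" "w \<noteq> [] \<longrightarrow> isl (hd w) \<noteq> isl u"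
      by (auto simp: F_Cons)
    note IH = Cons.IH[OF u(3)]
    have r: "rw (el u) \<in> words (V (isl u))" "reduced (rw (el u))"
      using rwA[OF u(1)] by (auto simp: reduced_words_iff)
    have ne: "rw (el u) \<noteq> []" using nonempty u by auto
    have cu: "cls (hd (rw (el u))) = isl u" "cls (last (rw (el u))) = isl u"
      using cls[OF _ r(1)] ne by auto
    have eq: "flat (u # w) = rw (el u) @ flat w" by (simp add: flat_def)
    have "hd (flat w) \<noteq> inv_letter (last (rw (el u)))" if "flat w \<noteq> []"
    proof
      assume "hd (flat w) = inv_letter (last (rw (el u)))"
      then have "cls (hd (flat w)) = isl u" using cu(2) by (simp add: cls_def)
      moreover have "w \<noteq> []" using that by (auto simp: flat_def)
      ultimately show False using IH u(4) by auto
    qed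
    then have red: "flat (u # w) \<in> reduced_words X"
      using IH r words_mono[OF r(1) VX] by (auto simp: eq reduced_words_iff reduced_append)
    have "word_val G (flat (u # w)) = word_val G (rw (el u)) \<otimes> word_val G (flat w)"
      unfolding eq using IH words_mono[OF r(1) VX] X_carrier
      by (intro word_val_append[of _ X]) (auto simp: reduced_words_iff)
    also have "word_val G (rw (el u)) = el u" using u(1) A_H by (intro rw(2)) blast
    also have "el u \<otimes> word_val G (flat w) = syllables_val G (u # w)"
      using IH by (simp add: syllables_val_def el_def)
    finally show ?case using red ne cu by (simp add: eq)
  qed (simp add: flat_def syllables_val_def reduced_words_iff)
  have inj: "inj_on flat F"
  proof (rule inj_onI)
    show "w \<in> F \<Longrightarrow> v \<in> F \<Longrightarrow> flat w = flat v \<Longrightarrow> w = v" for w v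
    proof (induction w arbitrary: v)
      case Nil
      then show ?case using flat[of v] by (auto simp: flat_def)
    next
      case (Cons u w)
      have "v \<noteq> []" using Cons.prems flat[of "u # w"] by (auto simp: flat_def)
      then obtain u' w' where v: "v = u' # w'" by (cases v) auto
      \<comment> \<open>The first syllable is recovered as the initial run of its class, since the
        next syllable starts with a letter of the other class.\<close>
      have tw: "takeWhile (\<lambda>l. cls l = isl u) (flat (u # w)) = rw (el u)" if "u # w \<in> F" for u w
      proof -
        have u: "el u \<in> A (isl u)" "w \<in> F" "w \<noteq> [] \<longrightarrow> isl (hd w) \<noteq> isl u" "el u \<noteq> \<one>"
          using that by (auto simp: F_Cons)
        have r: "rw (el u) \<in> words (V (isl u))" using rwA[OF u(1)] by (auto simp: reduced_words_iff)
        have "takeWhile (\<lambda>l. cls l = isl u) (flat w) = []"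
        proof (cases "w = []")
          case False
          with flat[OF u(2)] u(3) show ?thesis by (cases "flat w") auto
        qed (simp add: flat_def)
        then show ?thesis
          using cls[OF _ r] by (simp add: flat_def takeWhile_append2)
      qed
      have iu: "isl u = isl u'"
        using flat[OF Cons.prems(1)] flat[OF Cons.prems(2)] Cons.prems(3) v by auto
      have "rw (el u) = rw (el u')"
        using tw[of u w] tw[of u' w'] Cons.prems v iu by simp
      moreover have "el u \<in> H" "el u' \<in> H" using Cons.prems A_H by (auto simp: v F_Cons)
      ultimately have "el u = el u'" using rw(2) by metis
      with iu have "u = u'" by (cases u; cases u') (auto simp: el_def)
      with Cons.prems v have "flat w = flat w'" by (simp add: flat_def)
      with Cons.IH[of w'] Cons.prems v \<open>u = u'\<close> show ?case by (auto simp: F_Cons)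
    qed
  qed
  have surj: "\<exists>w \<in> F. flat w = v" if "v \<in> reduced_words X" for v
    using that
  proof (induction "length v" arbitrary: v rule: less_induct)
    case less
    show ?case
    proof (cases "v = []")
      case True
      then show ?thesis using F_Nil by (intro bexI[of _ "[]"]) (auto simp: flat_def)
    next
      case False
      define c p q where "c = cls (hd v)" and "p = takeWhile (\<lambda>l. cls l = c) v"
        and "q = dropWhile (\<lambda>l. cls l = c) v"
      have v: "v = p @ q" by (simp add: p_def q_def)
      have p0: "p \<noteq> []" using False by (cases v) (auto simp: p_def c_def)
      have pq: "p \<in> words X" "q \<in> words X" "reduced p" "reduced q"
        using less.prems by (auto simp: v reduced_words_iff reduced_append)
      then obtain w where w: "w \<in> F" "flat w = q"
        using less.hyps[of q] p0 v by (auto simp: reduced_words_iff)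
      have pV: "p \<in> words (V c)"
        using wordsV[OF pq(1), of c] set_takeWhileD unfolding p_def by fastforce
      define a where "a = word_val G p"
      have rwa: "rw a = p" using pq by (intro rw_eqI) (auto simp: a_def reduced_words_iff)
      define u where "u = (if c then Inl a else Inr a :: 'a + 'a)"
      have u: "el u = a" "isl u = c" by (auto simp: u_def el_def)
      have "isl (hd w) \<noteq> c" if "w \<noteq> []"
      proof -
        have "cls (hd q) = isl (hd w)" "q \<noteq> []" using flat[OF w(1)] w(2) that by auto
        moreover have "cls (hd q) \<noteq> c" using \<open>q \<noteq> []\<close> unfolding q_def by (rule hd_dropWhile)
        ultimately show ?thesis by simp
      qed
      moreover have "a \<noteq> \<one>" using rwa p0 by auto
      ultimately have "u # w \<in> F" using w pV by (auto simp: F_Cons u A_def a_def)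
      moreover have "flat (u # w) = v" using w rwa u v by (simp add: flat_def)
      ultimately show ?thesis by blast
    qed
  qed
  have "bij_betw flat F (reduced_words X)"
    using inj flat surj by (auto simp: bij_betw_def image_iff)
  moreover have "bij_betw (word_val G) (reduced_words X) H" using basis by (simp add: basis_def)
  ultimately have "bij_betw (word_val G \<circ> flat) F H" by (rule bij_betw_trans)
  then have "bij_betw (syllables_val G) F H"
    by (rule iffD1[OF bij_betw_cong, rotated]) (use flat in auto)
  moreover have "syllables_val (G\<lparr>carrier := H\<rparr>) = syllables_val G"
    "free_product_words (G\<lparr>carrier := H\<rparr>) (A True) (A False) = F"
    by (auto simp: fun_eq_iff syllables_val_def F_def free_product_words_def)
  ultimately show ?thesis
    using sub[of True] sub[of False] by (simp add: is_free_product_def A_def V_def)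
qed

section \<open>Undistorted subgroups\<close>

context hyp_group
begin

text \<open>Quasi-isometric embedding in the form used below: lengths in G refer to the fixed S, and
  the additive constant is absorbed in \<open>len h + 1\<close>.\<close>

definition undistorted :: "'a set \<Rightarrow> bool" where
  "undistorted H \<longleftrightarrow> (\<exists>T C. finite T \<and> T \<subseteq> H \<and>
    (\<forall>h \<in> H. \<exists>w \<in> words T. word_val G w = h \<and> length w \<le> C * (len h + 1)))"

lemma undistorted_of_quasiconvex:
  assumes "quasiconvex_subgroup H G"
  shows "undistorted H"
proof -
  obtain S' T where H: "subgroup H G" and S': "finite_generating_set G S'"
    and T: "finite_generating_set (G\<lparr>carrier := H\<rparr>) T"
    and qi: "quasi_isometric_embedding H (word_metric (G\<lparr>carrier := H\<rparr>) T) (carrier G) (word_metric G S') (\<lambda>h. h)"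
    using assms by (auto simp: quasiconvex_subgroup_def)
  interpret G': gen_group G S' by unfold_locales (rule S')
  interpret H': group "G\<lparr>carrier := H\<rparr>" using H subgroup.subgroup_is_group by blast
  interpret H': gen_group "G\<lparr>carrier := H\<rparr>" T by unfold_locales (rule T)
  obtain K C where KC: "K \<ge> 1" "C \<ge> 0"
    "\<And>x y. x \<in> H \<Longrightarrow> y \<in> H \<Longrightarrow> H'.d x y / K - C \<le> G'.d x y"
    using qi by (auto simp: quasi_isometric_embedding_def H'.d_word_metric G'.d_word_metric)
  obtain M where M: "\<And>w. w \<in> words S \<Longrightarrow> G'.len (word_val G w) \<le> M * length w"
    using G'.len_compare[OF S_carrier S_finite] by metis
  \<comment> \<open>The length of h over T is at most \<open>K * (M * len h + C)\<close>, where M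
    compares S with the generating set S' chosen in the definition; the additive part goes into
    \<open>len h + 1\<close>.\<close>
  define C' where "C' = nat \<lceil>K * (M + C)\<rceil>"
  have one: "\<one> \<in> H" using H subgroup.one_closed by blast
  have TH: "T \<subseteq> H" using H'.S_carrier by simp
  have "\<exists>w \<in> words T. word_val G w = h \<and> length w \<le> C' * (len h + 1)" if h: "h \<in> H" for h
  proof -
    have hc: "h \<in> carrier G" by (rule subgroup.mem_carrier[OF H h])
    obtain w where w: "w \<in> words T" "length w = H'.len h" "word_val (G\<lparr>carrier := H\<rparr>) w = h"
      using H'.len_word[of h] h by auto
    obtain u where u: "u \<in> words S" "length u = len h" "word_val G u = h" using len_word[OF hc] .
    have "G'.len h \<le> M * len h" using M[OF u(1)] u by simp
    then have 1: "real (G'.len h) \<le> real M * real (len h)" by (simp only: of_nat_mult[symmetric] of_nat_le_iff)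
    have "H'.d \<one> h = H'.len h" using H'.d_one[of h] h by simp
    then have "real (H'.len h) / K - C \<le> G'.len h"
      using KC(3)[OF one h] G'.d_one[OF hc] by simp
    then have "real (H'.len h) / K \<le> real M * real (len h) + C" using 1 by linarith
    then have "real (H'.len h) \<le> K * (real M * real (len h) + C)"
      using KC(1) by (simp add: divide_le_eq mult.commute)
    also have "\<dots> \<le> K * ((M + C) * (len h + 1))"
      using KC(1,2) by (intro mult_left_mono) (auto simp: algebra_simps)
    also have "\<dots> = (K * (M + C)) * (len h + 1)" by simp
    also have "\<dots> \<le> real C' * (len h + 1)"
      unfolding C'_def by (rule mult_right_mono[OF real_nat_ceiling_ge]) simp
    finally have "real (length w) \<le> real (C' * (len h + 1))" using w(2) by (simp add: algebra_simps)
    then have "length w \<le> C' * (len h + 1)" by (simp only: of_nat_le_iff)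
    moreover have "word_val G w = h" using w word_val_subgroup(1)[OF H words_mono[OF w(1) TH]] by simp
    ultimately show ?thesis using w(1) by blast
  qed
  then show ?thesis
    unfolding undistorted_def using TH H'.S_finite by blast
qed

lemma word_val_conj:
  assumes "x \<in> carrier G" "w \<in> words T" "T \<subseteq> carrier G"
  shows "word_val G (map (map_prod (\<lambda>h. inv x \<otimes> h \<otimes> x) id) w) = inv x \<otimes> word_val G w \<otimes> x"
  using assms(2)
proof (induction w)
  case (Cons l w)
  define c where "c = (\<lambda>h. inv x \<otimes> h \<otimes> x)"
  have l: "fst l \<in> carrier G" and w: "word_val G w \<in> carrier G" using Cons assms(3) by auto
  have "letter_val G (map_prod c id l) = inv x \<otimes> letter_val G l \<otimes> x"
    using l assms(1) by (cases l) (auto simp: c_def inv_mult_group m_assoc)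
  with Cons l w assms(1) letter_val_closed[OF l] show ?case
    by (simp add: m_assoc c_def id_def del: letter_val.simps)
qed (use assms in simp)

text \<open>Needed because the loops at a vertex other than the base lie in a conjugate of the
  represented subgroup. Conjugation by x changes lengths by at most 2 * len x.\<close>

lemma undistorted_conj:
  assumes "undistorted H" "H \<subseteq> carrier G" and x: "x \<in> carrier G"
  shows "undistorted ((\<lambda>h. inv x \<otimes> h \<otimes> x) ` H)"
proof -
  define c where "c = (\<lambda>h. inv x \<otimes> h \<otimes> x)"
  obtain T C where T: "finite T" "T \<subseteq> H"
    "\<And>h. h \<in> H \<Longrightarrow> \<exists>w \<in> words T. word_val G w = h \<and> length w \<le> C * (len h + 1)"
    using assms(1) unfolding undistorted_def by metis
  have "\<exists>w \<in> words (c ` T). word_val G w = k \<and> length w \<le> (C * (2 * len x + 1)) * (len k + 1)"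
    if k: "k \<in> c ` H" for k
  proof -
    obtain h where h: "h \<in> H" "k = c h" using k by blast
    have hc: "h \<in> carrier G" using h assms(2) by auto
    obtain w where w: "w \<in> words T" "word_val G w = h" "length w \<le> C * (len h + 1)" using T(3) h by blast
    have "h = x \<otimes> (k \<otimes> inv x)" using h hc x by (simp add: c_def m_assoc)
    moreover have kc: "k \<in> carrier G" using h hc x by (simp add: c_def)
    ultimately have "len h \<le> len x + (len k + len x)"
      using len_mult[of x "k \<otimes> inv x"] len_mult[of k "inv x"] x by simp
    then have "C * (len h + 1) \<le> C * ((2 * len x + 1) * (len k + 1))"
      by (intro mult_le_mono2) (simp add: algebra_simps)
    then have "length w \<le> (C * (2 * len x + 1)) * (len k + 1)"
      unfolding mult.assoc by (rule order.trans[OF w(3)])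
    moreover have "map (map_prod c id) w \<in> words (c ` T)"
      using w(1) by (induction w) auto
    moreover have "word_val G (map (map_prod c id) w) = k"
      using word_val_conj[OF x w(1)] T(2) assms(2) w(2) h(2) by (auto simp: c_def)
    ultimately show ?thesis by (intro bexI[of _ "map (map_prod c id) w"]) auto
  qed
  then show ?thesis
    unfolding undistorted_def c_def[symmetric] using T by (intro exI[of _ "c ` T"]) blast
qed

text \<open>Classical quasiconvexity for geodesics starting at \<one>, whose points are those with
  equality in the triangle inequality. For a subgroup, left translation reduces all geodesics with
  ends in A to these.\<close>

definition qconvex :: "real \<Rightarrow> 'a set \<Rightarrow> bool" where
  "qconvex Q A \<longleftrightarrow> (\<forall>a \<in> A. \<forall>z \<in> carrier G. d \<one> z + d z a = d \<one> a \<longrightarrow> (\<exists>a' \<in> A. d z a' \<le> Q))"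

lemma words_factor_bound:
  assumes bg: "based_group G H X" and T: "finite T" "T \<subseteq> H"
  obtains M where "\<And>t. t \<in> words T \<Longrightarrow> \<exists>u \<in> words X. word_val G u = word_val G t \<and> length u \<le> M * length t"
proof -
  interpret based_group G H X by (rule bg)
  define f where "f l = rw (letter_val G l)" for l
  define M where "M = Max (insert 0 ((\<lambda>l. length (f l)) ` (T \<times> UNIV)))"
  have fin: "finite (T \<times> (UNIV :: bool set))" using T by simp
  have TH: "letter_val G l \<in> H" if "fst l \<in> T" for l
    using that T H by (cases l) (auto simp: subgroup.m_inv_closed)
  have "\<exists>u \<in> words X. word_val G u = word_val G t \<and> length u \<le> M * length t" if "t \<in> words T" for t
    using that
  proof (induction t)
    case (Cons l t)
    then obtain u where u: "u \<in> words X" "word_val G u = word_val G t" "length u \<le> M * length t" by auto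
    have l: "letter_val G l \<in> H" using Cons TH by auto
    have "length (f l) \<le> M"
      unfolding M_def using fin Cons.prems by (intro Max_ge) (auto intro!: imageI simp: mem_Times_iff)
    moreover have "word_val G (f l @ u) = word_val G (l # t)"
      using word_val_append[OF rw_words[OF l] u(1) X_carrier] rw(2)[OF l] u by (simp add: f_def)
    ultimately show ?case
      using u rw_words[OF l] by (intro bexI[of _ "f l @ u"]) (auto simp: f_def)
  qed auto
  then show thesis using that by blast
qed

text \<open>The prefixes of a reduced word over Y form a path inside the factor. Its subwords are
  reduced over X, hence shortest, and since H is undistorted the path is a quasigeodesic of G; by
  \<open>quasigeodesic_stability\<close> every geodesic point is near a prefix.\<close>

lemma free_factor_qconvex:
  assumes bg: "based_group G H X" and "finite X" "Y \<subseteq> X" "undistorted H"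
  shows "\<exists>Q. qconvex Q (word_val G ` words Y)"
proof -
  interpret based_group G H X by (rule bg)
  obtain T C where T: "finite T" "T \<subseteq> H"
    "\<And>h. h \<in> H \<Longrightarrow> \<exists>w \<in> words T. word_val G w = h \<and> length w \<le> C * (len h + 1)"
    using assms(4) unfolding undistorted_def by metis
  obtain M where M: "\<And>t. t \<in> words T \<Longrightarrow> \<exists>u \<in> words X. word_val G u = word_val G t \<and> length u \<le> M * length t"
    using words_factor_bound[OF bg T(1,2)] by metis
  obtain l where l: "\<And>w. w \<in> words X \<Longrightarrow> len (word_val G w) \<le> l * length w"
    using len_compare[OF X_carrier assms(2)] by metis
  \<comment> \<open>Rewriting an economical word over T in the basis multiplies its length by at
    most M, and no word over X is shorter than the reduced one.\<close>
  have short: "length w \<le> M * C * (len (word_val G w) + 1)" if w: "w \<in> reduced_words X" for w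
  proof -
    have "word_val G w \<in> H" using w val_H by (auto simp: reduced_words_iff)
    then obtain t where t: "t \<in> words T" "word_val G t = word_val G w" "length t \<le> C * (len (word_val G w) + 1)"
      using T(3) by blast
    obtain u where u: "u \<in> words X" "word_val G u = word_val G t" "length u \<le> M * length t" using M[OF t(1)] by blast
    have "length w \<le> length u" using reduced_shortest[OF w u(1)] u t by simp
    also have "\<dots> \<le> M * (C * (len (word_val G w) + 1))" using u(3) t(3) by (meson le_trans mult_le_mono2)
    finally show ?thesis by (simp only: mult.assoc)
  qed
  obtain Q where Q: "\<And>n a z. \<lbrakk>\<And>i. i \<le> n \<Longrightarrow> a i \<in> carrier G; \<And>i. i < n \<Longrightarrow> d (a i) (a (Suc i)) \<le> l;
      \<And>i j. i \<le> j \<Longrightarrow> j \<le> n \<Longrightarrow> real (j - i) \<le> real (M * C) * (d (a i) (a j) + 1);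
      z \<in> carrier G; d (a 0) z + d z (a n) = d (a 0) (a n)\<rbrakk> \<Longrightarrow> \<exists>i\<le>n. d z (a i) \<le> Q"
    using quasigeodesic_stability[of "real (M * C)" "real l"] by (metis of_nat_0_le_iff)
  have Yc: "Y \<subseteq> carrier G" using assms(3) X_carrier by auto
  have "\<exists>a' \<in> word_val G ` words Y. d z a' \<le> Q"
    if a: "a \<in> word_val G ` words Y" and z: "z \<in> carrier G" "d \<one> z + d z a = d \<one> a" for a z
  proof -
    obtain v where v: "v \<in> words Y" "a = word_val G v" using a by auto
    define w where "w = reduce v"
    have w: "w \<in> words Y" "reduced w" "word_val G w = a"
      using reduce_words[OF v(1)] word_val_reduce[OF v(1) Yc] v(2) by (auto simp: w_def reduced_words_iff)
    define p where "p i = word_val G (take i w)" for i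
    have tw: "take i w \<in> words Y" "drop i w \<in> words Y" for i
      using w(1) words_append[of "take i w" "drop i w" Y] by auto
    have seg: "drop i (take j w) \<in> words Y \<and> reduced (drop i (take j w))
        \<and> inv (p i) \<otimes> p j = word_val G (drop i (take j w))" if "i \<le> j" for i j
    proof -
      have eq: "take j w = take i w @ drop i (take j w)"
        using that by (metis append_take_drop_id min.absorb1 take_take)
      have "w = take i w @ drop i (take j w) @ drop j w"
        by (metis eq append_take_drop_id append_assoc)
      then have 1: "drop i (take j w) \<in> words Y" "reduced (drop i (take j w))"
        using w(1,2) by (metis words_append, metis reduced_append)
      have "p j = p i \<otimes> word_val G (drop i (take j w))"
        unfolding p_def by (subst eq) (rule word_val_append[OF tw(1) 1(1) Yc])
      moreover have "p i \<in> carrier G" "word_val G (drop i (take j w)) \<in> carrier G"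
        using tw(1) 1 Yc by (auto simp: p_def)
      ultimately show ?thesis using 1 by simp
    qed
    have "\<exists>i\<le>length w. d z (p i) \<le> Q"
    proof (rule Q)
      show "p i \<in> carrier G" for i using tw Yc by (auto simp: p_def)
      show "d (p i) (p (Suc i)) \<le> l" if "i < length w" for i
      proof -
        have "length (drop i (take (Suc i) w)) = 1" using that by simp
        then show ?thesis
          using seg[of i "Suc i"] l[of "drop i (take (Suc i) w)"] words_mono[OF _ assms(3)]
          by (simp add: d_def)
      qed
      show "real (j - i) \<le> real (M * C) * (d (p i) (p j) + 1)" if "i \<le> j" "j \<le> length w" for i j
      proof -
        have "length (drop i (take j w)) = j - i" using that by simp
        moreover have "drop i (take j w) \<in> reduced_words X"
          using seg[OF that(1)] words_mono[OF _ assms(3)] by (auto simp: reduced_words_iff)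
        ultimately have "j - i \<le> M * C * (len (inv (p i) \<otimes> p j) + 1)"
          using short[of "drop i (take j w)"] seg[OF that(1)] by simp
        then have "real (j - i) \<le> real (M * C * (len (inv (p i) \<otimes> p j) + 1))" by (simp only: of_nat_le_iff)
        then show ?thesis by (simp add: d_def algebra_simps)
      qed
    qed (use z w in \<open>auto simp: p_def\<close>)
    then show ?thesis using tw by (auto simp: p_def)
  qed
  then show ?thesis unfolding qconvex_def by blast
qed

end

section \<open>Carrier graphs\<close>

text \<open>A graph \<open>\<Gamma>\<close> with edges labelled by elements of \<open>G\<close> represents the subgroup of labels of
  closed paths at a base vertex. Instead of universal covers we use the graph on
  \<open>G \<times> verts \<Gamma>\<close> in which an edge \<open>e\<close> joins \<open>(x, src e)\<close> to \<open>(x \<otimes> lab e, tgt e)\<close>;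
  \<open>conn \<Gamma> F\<close> is connectedness in it along edges from \<open>F\<close>.\<close>

record 'a lgraph =
  verts :: "nat set"
  edges :: "nat set"
  src :: "nat \<Rightarrow> nat"
  tgt :: "nat \<Rightarrow> nat"
  lab :: "nat \<Rightarrow> 'a"

context group
begin

definition adj :: "'a lgraph \<Rightarrow> nat set \<Rightarrow> (('a \<times> nat) \<times> ('a \<times> nat)) set" where
  "adj \<Gamma> F = {((x, src \<Gamma> e), (x \<otimes> lab \<Gamma> e, tgt \<Gamma> e)) | x e. x \<in> carrier G \<and> e \<in> F}"

definition conn :: "'a lgraph \<Rightarrow> nat set \<Rightarrow> (('a \<times> nat) \<times> ('a \<times> nat)) set" where
  "conn \<Gamma> F = (adj \<Gamma> F \<union> (adj \<Gamma> F)\<inverse>)\<^sup>*"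

definition wf_graph :: "'a lgraph \<Rightarrow> bool" where
  "wf_graph \<Gamma> \<longleftrightarrow> finite (verts \<Gamma>) \<and> finite (edges \<Gamma>) \<and>
    (\<forall>e \<in> edges \<Gamma>. src \<Gamma> e \<in> verts \<Gamma> \<and> tgt \<Gamma> e \<in> verts \<Gamma> \<and> lab \<Gamma> e \<in> carrier G)"

text \<open>One transition \<sigma> e serves all lifts of e. With the free group on the edges as
  target, a potential is a developing map that records which edges are crossed.\<close>

definition potential :: "'a lgraph \<Rightarrow> nat set \<Rightarrow> (nat \<Rightarrow> 'w \<Rightarrow> 'w) \<Rightarrow> ('a \<times> nat \<Rightarrow> 'w) \<Rightarrow> bool" where
  "potential \<Gamma> F \<sigma> \<phi> \<longleftrightarrow> (\<forall>x \<in> carrier G. \<forall>e \<in> F. \<phi> (x \<otimes> lab \<Gamma> e, tgt \<Gamma> e) = \<sigma> e (\<phi> (x, src \<Gamma> e)))"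

text \<open>Existence of potentials for arbitrary bijections expresses that the graph on
  \<open>G \<times> verts \<Gamma>\<close> is a forest. The values are words so that the Cayley graph of a free group
  on the edges can be used as a target.\<close>

definition acyclic_graph :: "'a lgraph \<Rightarrow> nat \<Rightarrow> bool" where
  "acyclic_graph \<Gamma> b \<longleftrightarrow> (\<forall>\<sigma> :: nat \<Rightarrow> (nat \<times> bool) list \<Rightarrow> (nat \<times> bool) list.
    (\<forall>e \<in> edges \<Gamma>. bij (\<sigma> e)) \<longrightarrow> (\<forall>w. \<exists>\<phi>. \<phi> (\<one>, b) = w \<and> potential \<Gamma> (edges \<Gamma>) \<sigma> \<phi>))"

definition loops :: "'a lgraph \<Rightarrow> nat set \<Rightarrow> nat \<Rightarrow> 'a set" where
  "loops \<Gamma> F b = {x \<in> carrier G. ((\<one>, b), (x, b)) \<in> conn \<Gamma> F}"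

text \<open>For a connected graph the inequality says that the first Betti number is at most r. By
  \<open>acyclic_graph\<close> the fundamental group injects into G, with image H.\<close>

definition carrier_graph :: "'a lgraph \<Rightarrow> nat \<Rightarrow> 'a set \<Rightarrow> nat \<Rightarrow> bool" where
  "carrier_graph \<Gamma> b H r \<longleftrightarrow> wf_graph \<Gamma> \<and> b \<in> verts \<Gamma> \<and>
    (\<forall>i \<in> verts \<Gamma>. \<exists>x \<in> carrier G. ((\<one>, b), (x, i)) \<in> conn \<Gamma> (edges \<Gamma>)) \<and>
    loops \<Gamma> (edges \<Gamma>) b = H \<and> card (edges \<Gamma>) + 1 \<le> card (verts \<Gamma>) + r \<and> acyclic_graph \<Gamma> b"

lemma conn_refl [simp]: "(v, v) \<in> conn \<Gamma> F"
  by (simp add: conn_def)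

lemma conn_trans: "(u, v) \<in> conn \<Gamma> F \<Longrightarrow> (v, w) \<in> conn \<Gamma> F \<Longrightarrow> (u, w) \<in> conn \<Gamma> F"
  unfolding conn_def by (rule rtrancl_trans)

lemma conn_sym: "(u, v) \<in> conn \<Gamma> F \<Longrightarrow> (v, u) \<in> conn \<Gamma> F"
  unfolding conn_def by (rule symD[OF sym_rtrancl]) (auto simp: sym_def)

lemma conn_edge: "x \<in> carrier G \<Longrightarrow> e \<in> F \<Longrightarrow> ((x, src \<Gamma> e), (x \<otimes> lab \<Gamma> e, tgt \<Gamma> e)) \<in> conn \<Gamma> F"
  unfolding conn_def adj_def by (intro r_into_rtrancl) auto

text \<open>The equivalence in \<open>step\<close> covers crossing an edge in either
  direction.\<close>

lemma conn_induct [consumes 1, case_names refl step]: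
  assumes "(u, v) \<in> conn \<Gamma> F" "P u"
    and step: "\<And>x e. x \<in> carrier G \<Longrightarrow> e \<in> F \<Longrightarrow> P (x, src \<Gamma> e) \<longleftrightarrow> P (x \<otimes> lab \<Gamma> e, tgt \<Gamma> e)"
  shows "P v"
  using assms(1) unfolding conn_def
proof (induction rule: rtrancl_induct)
  case (step y z)
  then show ?case using assms(3) by (auto simp: adj_def)
qed (rule assms(2))

lemma conn_map:
  assumes "(u, v) \<in> conn \<Gamma> F"
    and "\<And>x e. x \<in> carrier G \<Longrightarrow> e \<in> F \<Longrightarrow> (p (x, src \<Gamma> e), p (x \<otimes> lab \<Gamma> e, tgt \<Gamma> e)) \<in> conn \<Gamma>' F'"
  shows "(p u, p v) \<in> conn \<Gamma>' F'"
  using assms(1)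
proof (induction rule: conn_induct)
  case (step x e)
  show ?case using assms(2)[OF step] conn_trans conn_sym by metis
qed simp

lemma conn_subset:
  assumes "\<And>x e. x \<in> carrier G \<Longrightarrow> e \<in> F \<Longrightarrow> ((x, src \<Gamma> e), (x \<otimes> lab \<Gamma> e, tgt \<Gamma> e)) \<in> conn \<Gamma>' F'"
  shows "conn \<Gamma> F \<subseteq> conn \<Gamma>' F'"
  using conn_map[where p = "\<lambda>v. v"] assms by auto

lemma conn_mono: "F \<subseteq> F' \<Longrightarrow> conn \<Gamma> F \<subseteq> conn \<Gamma> F'"
  by (rule conn_subset) (auto intro: conn_edge)

lemma conn_cong:
  assumes "\<And>e. e \<in> F \<Longrightarrow> src \<Gamma> e = src \<Gamma>' e \<and> tgt \<Gamma> e = tgt \<Gamma>' e \<and> lab \<Gamma> e = lab \<Gamma>' e"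
  shows "conn \<Gamma> F = conn \<Gamma>' F"
  by (rule subset_antisym; rule conn_subset) (use assms conn_edge in metis)+

lemma conn_left:
  assumes "((x, i), (y, j)) \<in> conn \<Gamma> F" "F \<subseteq> edges \<Gamma>" "wf_graph \<Gamma>" "g \<in> carrier G"
  shows "((g \<otimes> x, i), (g \<otimes> y, j)) \<in> conn \<Gamma> F"
proof -
  have "(map_prod ((\<otimes>) g) id (x, i), map_prod ((\<otimes>) g) id (y, j)) \<in> conn \<Gamma> F"
    using assms(1)
  proof (rule conn_map)
    fix x e assume xe: "x \<in> carrier G" "e \<in> F"
    then have "lab \<Gamma> e \<in> carrier G" using assms by (auto simp: wf_graph_def)
    then show "(map_prod ((\<otimes>) g) id (x, src \<Gamma> e), map_prod ((\<otimes>) g) id (x \<otimes> lab \<Gamma> e, tgt \<Gamma> e)) \<in> conn \<Gamma> F"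
      using xe assms(4) conn_edge[of "g \<otimes> x" e F \<Gamma>] by (simp add: m_assoc)
  qed
  then show ?thesis by simp
qed

lemma conn_closed:
  assumes "((x, i), (y, j)) \<in> conn \<Gamma> F" "F \<subseteq> edges \<Gamma>" "wf_graph \<Gamma>" "x \<in> carrier G"
  shows "y \<in> carrier G"
proof -
  have "fst (y, j) \<in> carrier G"
    using assms(1)
  proof (induction rule: conn_induct)
    case (step x e)
    then show ?case using assms by (auto simp: wf_graph_def)
  qed (use assms in auto)
  then show ?thesis by simp
qed

lemma conn_vertex:
  assumes "((x, i), (y, j)) \<in> conn \<Gamma> F" "F \<subseteq> edges \<Gamma>" "wf_graph \<Gamma>" "i \<in> verts \<Gamma>"
  shows "j \<in> verts \<Gamma>"
proof -
  have "snd (y, j) \<in> verts \<Gamma>"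
    using assms(1)
  proof (induction rule: conn_induct)
    case (step x e)
    then show ?case using assms by (auto simp: wf_graph_def)
  qed (use assms in auto)
  then show ?thesis by simp
qed

lemma wf_graphD:
  "wf_graph \<Gamma> \<Longrightarrow> e \<in> edges \<Gamma> \<Longrightarrow> src \<Gamma> e \<in> verts \<Gamma>"
  "wf_graph \<Gamma> \<Longrightarrow> e \<in> edges \<Gamma> \<Longrightarrow> tgt \<Gamma> e \<in> verts \<Gamma>"
  "wf_graph \<Gamma> \<Longrightarrow> e \<in> edges \<Gamma> \<Longrightarrow> lab \<Gamma> e \<in> carrier G"
  by (auto simp: wf_graph_def)

lemma subgroup_loops:
  assumes "wf_graph \<Gamma>" "F \<subseteq> edges \<Gamma>"
  shows "subgroup (loops \<Gamma> F b) G"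
proof (rule subgroupI)
  show "loops \<Gamma> F b \<subseteq> carrier G" "loops \<Gamma> F b \<noteq> {}"
    by (auto simp: loops_def intro!: exI[of _ \<one>])
next
  fix a c assume a: "a \<in> loops \<Gamma> F b" and c: "c \<in> loops \<Gamma> F b"
  have ac: "a \<in> carrier G" "c \<in> carrier G" using a c by (auto simp: loops_def)
  have "((inv a \<otimes> \<one>, b), (inv a \<otimes> a, b)) \<in> conn \<Gamma> F"
    using a assms by (intro conn_left) (auto simp: loops_def)
  then show "inv a \<in> loops \<Gamma> F b" using ac by (auto simp: loops_def intro: conn_sym)
  have "((a \<otimes> \<one>, b), (a \<otimes> c, b)) \<in> conn \<Gamma> F"
    using a c assms by (intro conn_left) (auto simp: loops_def)
  then show "a \<otimes> c \<in> loops \<Gamma> F b"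
    using a ac by (auto simp: loops_def intro: conn_trans)
qed

text \<open>Compose the transitions along a path, inverted where an edge is crossed backwards. The
  result depends only on the path, so one \<tau> serves all potentials and all left translates of
  the path.\<close>

lemma potential_transport:
  assumes "((x, i), (y, j)) \<in> conn \<Gamma> F" "F \<subseteq> edges \<Gamma>" "wf_graph \<Gamma>" "x \<in> carrier G"
    and \<sigma>: "\<And>e. e \<in> F \<Longrightarrow> bij (\<sigma> e :: 'w \<Rightarrow> 'w)"
  obtains \<tau> where "bij \<tau>"
    "\<And>g \<phi>. g \<in> carrier G \<Longrightarrow> potential \<Gamma> F \<sigma> \<phi> \<Longrightarrow> \<phi> (g \<otimes> y, j) = \<tau> (\<phi> (g \<otimes> x, i))"
proof -
  define P where "P v \<longleftrightarrow> (\<exists>\<tau>. bij \<tau> \<and> (\<forall>g \<in> carrier G. \<forall>\<phi>. potential \<Gamma> F \<sigma> \<phi> \<longrightarrow>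
      \<phi> (g \<otimes> fst v, snd v) = \<tau> (\<phi> (g \<otimes> x, i))))" for v
  have "P (y, j)"
    using assms(1)
  proof (induction rule: conn_induct)
    case refl
    show ?case unfolding P_def by (intro exI[of _ id]) auto
  next
    case (step z e)
    have l: "lab \<Gamma> e \<in> carrier G" using step assms by (auto simp: wf_graph_def)
    have *: "\<phi> (g \<otimes> (z \<otimes> lab \<Gamma> e), tgt \<Gamma> e) = \<sigma> e (\<phi> (g \<otimes> z, src \<Gamma> e))"
      if "g \<in> carrier G" "potential \<Gamma> F \<sigma> \<phi>" for g \<phi>
      using that step l unfolding potential_def by (auto simp flip: m_assoc)
    have b: "bij (\<sigma> e)" using \<sigma> step by auto
    show ?case
    proof
      assume "P (z, src \<Gamma> e)"
      then obtain \<tau> where \<tau>: "bij \<tau>" "\<And>g \<phi>. g \<in> carrier G \<Longrightarrow> potential \<Gamma> F \<sigma> \<phi> \<Longrightarrow>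
          \<phi> (g \<otimes> z, src \<Gamma> e) = \<tau> (\<phi> (g \<otimes> x, i))" by (auto simp: P_def)
      show "P (z \<otimes> lab \<Gamma> e, tgt \<Gamma> e)"
        unfolding P_def by (intro exI[of _ "\<sigma> e \<circ> \<tau>"]) (use \<tau> b * in \<open>auto intro: bij_comp\<close>)
    next
      assume "P (z \<otimes> lab \<Gamma> e, tgt \<Gamma> e)"
      then obtain \<tau> where \<tau>: "bij \<tau>" "\<And>g \<phi>. g \<in> carrier G \<Longrightarrow> potential \<Gamma> F \<sigma> \<phi> \<Longrightarrow>
          \<phi> (g \<otimes> (z \<otimes> lab \<Gamma> e), tgt \<Gamma> e) = \<tau> (\<phi> (g \<otimes> x, i))" by (auto simp: P_def)
      have "\<phi> (g \<otimes> z, src \<Gamma> e) = inv_into UNIV (\<sigma> e) (\<tau> (\<phi> (g \<otimes> x, i)))"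
        if "g \<in> carrier G" "potential \<Gamma> F \<sigma> \<phi>" for g \<phi>
        using *[OF that] \<tau>(2)[OF that] b by (metis bij_inv_eq_iff)
      then show "P (z, src \<Gamma> e)"
        unfolding P_def
        by (intro exI[of _ "inv_into UNIV (\<sigma> e) \<circ> \<tau>"]) (use \<tau>(1) b in \<open>auto intro: bij_comp bij_imp_bij_inv\<close>)
    qed
  qed
  then show thesis using that by (auto simp: P_def)
qed

subsection \<open>Elementary moves\<close>

definition slide :: "'a lgraph \<Rightarrow> nat \<Rightarrow> nat \<Rightarrow> 'a \<Rightarrow> 'a lgraph" where
  "slide \<Gamma> e k v = \<Gamma>\<lparr>src := (src \<Gamma>)(e := k), lab := (lab \<Gamma>)(e := v \<otimes> lab \<Gamma> e)\<rparr>"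

lemma slide_simps [simp]:
  "verts (slide \<Gamma> e k v) = verts \<Gamma>" "edges (slide \<Gamma> e k v) = edges \<Gamma>"
  "src (slide \<Gamma> e k v) = (src \<Gamma>)(e := k)" "tgt (slide \<Gamma> e k v) = tgt \<Gamma>"
  "lab (slide \<Gamma> e k v) = (lab \<Gamma>)(e := v \<otimes> lab \<Gamma> e)"
  by (simp_all add: slide_def)

text \<open>A path from k to the old origin, with label v and avoiding e, is put in front of e. The
  path survives in the new graph, so connectedness in the unfolded graph does not change.\<close>

lemma carrier_graph_slide:
  assumes \<Gamma>: "carrier_graph \<Gamma> b H r" and e: "e \<in> edges \<Gamma>" and k: "k \<in> verts \<Gamma>" and v: "v \<in> carrier G"
    and c: "((\<one>, k), (v, src \<Gamma> e)) \<in> conn \<Gamma> (edges \<Gamma> - {e})"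
  shows "carrier_graph (slide \<Gamma> e k v) b H r"
proof -
  define \<Gamma>' where "\<Gamma>' = slide \<Gamma> e k v"
  have wf: "wf_graph \<Gamma>" using \<Gamma> by (simp add: carrier_graph_def)
  have wf': "wf_graph \<Gamma>'"
    using wf e k v by (auto simp: \<Gamma>'_def wf_graph_def)
  have le: "lab \<Gamma> e \<in> carrier G" using wf e wf_graphD by blast
  have same: "conn \<Gamma>' (edges \<Gamma> - {e}) = conn \<Gamma> (edges \<Gamma> - {e})"
    by (rule conn_cong) (auto simp: \<Gamma>'_def)
  have cx: "((x, k), (x \<otimes> v, src \<Gamma> e)) \<in> conn \<Gamma> (edges \<Gamma> - {e})" if "x \<in> carrier G" for x
    using conn_left[OF c _ wf that] that by auto
  have cx': "((x \<otimes> inv v, k), (x, src \<Gamma> e)) \<in> conn \<Gamma> (edges \<Gamma> - {e})" if "x \<in> carrier G" for x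
    using cx[of "x \<otimes> inv v"] that v by (simp add: m_assoc)
  have sub: "conn \<Gamma> (edges \<Gamma> - {e}) \<subseteq> conn \<Gamma> (edges \<Gamma>)" "conn \<Gamma> (edges \<Gamma> - {e}) \<subseteq> conn \<Gamma>' (edges \<Gamma>)"
    using conn_mono[of "edges \<Gamma> - {e}" "edges \<Gamma>"] same by blast+
  have conn: "conn \<Gamma>' (edges \<Gamma>) = conn \<Gamma> (edges \<Gamma>)"
  proof (rule subset_antisym; rule conn_subset)
    fix x e' assume x: "x \<in> carrier G" and e': "e' \<in> edges \<Gamma>"
    show "((x, src \<Gamma>' e'), (x \<otimes> lab \<Gamma>' e', tgt \<Gamma>' e')) \<in> conn \<Gamma> (edges \<Gamma>)"
    proof (cases "e' = e")
      case True
      have "((x \<otimes> v, src \<Gamma> e), (x \<otimes> v \<otimes> lab \<Gamma> e, tgt \<Gamma> e)) \<in> conn \<Gamma> (edges \<Gamma>)"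
        using x v e by (intro conn_edge) auto
      with True cx[OF x] sub(1) x v le show ?thesis
        by (auto simp: \<Gamma>'_def m_assoc intro: conn_trans)
    qed (use conn_edge[OF x e', of \<Gamma>] in \<open>auto simp: \<Gamma>'_def\<close>)
    show "((x, src \<Gamma> e'), (x \<otimes> lab \<Gamma> e', tgt \<Gamma> e')) \<in> conn \<Gamma>' (edges \<Gamma>)"
    proof (cases "e' = e")
      case True
      have "((x \<otimes> inv v, k), (x, src \<Gamma> e)) \<in> conn \<Gamma>' (edges \<Gamma>)" using cx'[OF x] sub(2) by auto
      moreover have "((x \<otimes> inv v, k), (x \<otimes> lab \<Gamma> e, tgt \<Gamma> e)) \<in> conn \<Gamma>' (edges \<Gamma>)"
        using conn_edge[of "x \<otimes> inv v" e "edges \<Gamma>" \<Gamma>'] x v e le by (simp add: \<Gamma>'_def m_assoc)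
      ultimately show ?thesis using True conn_sym conn_trans by blast
    qed (use conn_edge[OF x e', of \<Gamma>'] in \<open>auto simp: \<Gamma>'_def\<close>)
  qed
  have "acyclic_graph \<Gamma>' b"
    unfolding acyclic_graph_def
  proof (intro allI impI)
    fix \<sigma> :: "nat \<Rightarrow> (nat \<times> bool) list \<Rightarrow> (nat \<times> bool) list" and w
    assume "\<forall>e \<in> edges \<Gamma>'. bij (\<sigma> e)"
    then have \<sigma>: "bij (\<sigma> e)" if "e \<in> edges \<Gamma>" for e using that by (simp add: \<Gamma>'_def)
    obtain \<tau> where \<tau>: "bij \<tau>" "\<And>g \<phi>. g \<in> carrier G \<Longrightarrow> potential \<Gamma> (edges \<Gamma> - {e}) \<sigma> \<phi> \<Longrightarrow>
        \<phi> (g \<otimes> \<one>, k) = \<tau> (\<phi> (g \<otimes> v, src \<Gamma> e))"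
      using potential_transport[OF conn_sym[OF c] _ wf v, of \<sigma>] \<sigma> by auto
    \<comment> \<open>\<tau> carries the value at the old origin to the value at k, so a potential
      of the old graph with this transition on e is a potential of the new graph with \<sigma>
      e.\<close>
    define \<sigma>' where "\<sigma>' = \<sigma>(e := \<sigma> e \<circ> \<tau>)"
    have "\<forall>e \<in> edges \<Gamma>. bij (\<sigma>' e)" using \<sigma> \<tau>(1) by (auto simp: \<sigma>'_def intro: bij_comp)
    then obtain \<phi> where \<phi>: "\<phi> (\<one>, b) = w" "potential \<Gamma> (edges \<Gamma>) \<sigma>' \<phi>"
      using \<Gamma> unfolding carrier_graph_def acyclic_graph_def by blast
    have p: "potential \<Gamma> (edges \<Gamma> - {e}) \<sigma> \<phi>" using \<phi>(2) by (auto simp: potential_def \<sigma>'_def)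
    have "\<phi> (x \<otimes> (v \<otimes> lab \<Gamma> e), tgt \<Gamma> e) = \<sigma> e (\<phi> (x, k))" if x: "x \<in> carrier G" for x
    proof -
      have "\<phi> (x \<otimes> v \<otimes> lab \<Gamma> e, tgt \<Gamma> e) = \<sigma> e (\<tau> (\<phi> (x \<otimes> v, src \<Gamma> e)))"
        using \<phi>(2) e x v unfolding potential_def by (auto simp: \<sigma>'_def)
      with \<tau>(2)[OF x p] x v le show ?thesis by (simp add: m_assoc)
    qed
    then have "potential \<Gamma>' (edges \<Gamma>') \<sigma> \<phi>" using p by (auto simp: potential_def \<Gamma>'_def)
    with \<phi>(1) show "\<exists>\<phi>. \<phi> (\<one>, b) = w \<and> potential \<Gamma>' (edges \<Gamma>') \<sigma> \<phi>" by blast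
  qed
  then show ?thesis
    using \<Gamma> wf' conn unfolding carrier_graph_def loops_def \<Gamma>'_def by simp
qed

definition flip :: "'a lgraph \<Rightarrow> nat \<Rightarrow> 'a lgraph" where
  "flip \<Gamma> e = \<Gamma>\<lparr>src := (src \<Gamma>)(e := tgt \<Gamma> e), tgt := (tgt \<Gamma>)(e := src \<Gamma> e),
    lab := (lab \<Gamma>)(e := inv (lab \<Gamma> e))\<rparr>"

lemma flip_simps [simp]:
  "verts (flip \<Gamma> e) = verts \<Gamma>" "edges (flip \<Gamma> e) = edges \<Gamma>"
  "src (flip \<Gamma> e) = (src \<Gamma>)(e := tgt \<Gamma> e)" "tgt (flip \<Gamma> e) = (tgt \<Gamma>)(e := src \<Gamma> e)"
  "lab (flip \<Gamma> e) = (lab \<Gamma>)(e := inv (lab \<Gamma> e))"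
  by (simp_all add: flip_def)

lemma conn_flip:
  assumes "wf_graph \<Gamma>" "e \<in> edges \<Gamma>" "F \<subseteq> edges \<Gamma>"
  shows "conn (flip \<Gamma> e) F = conn \<Gamma> F"
proof (rule subset_antisym; rule conn_subset)
  have l: "lab \<Gamma> e \<in> carrier G" using assms wf_graphD by blast
  fix x e' assume x: "x \<in> carrier G" and e': "e' \<in> F"
  show "((x, src (flip \<Gamma> e) e'), (x \<otimes> lab (flip \<Gamma> e) e', tgt (flip \<Gamma> e) e')) \<in> conn \<Gamma> F"
    using conn_edge[OF x e', of \<Gamma>] conn_sym[OF conn_edge[OF _ e', of "x \<otimes> inv (lab \<Gamma> e)" \<Gamma>]] x l
    by (auto simp: m_assoc)
  show "((x, src \<Gamma> e'), (x \<otimes> lab \<Gamma> e', tgt \<Gamma> e')) \<in> conn (flip \<Gamma> e) F"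
    using conn_edge[OF x e', of "flip \<Gamma> e"] conn_sym[OF conn_edge[OF _ e', of "x \<otimes> lab \<Gamma> e" "flip \<Gamma> e"]] x l
    by (cases "e' = e") (auto simp: m_assoc)
qed

lemma carrier_graph_flip:
  assumes \<Gamma>: "carrier_graph \<Gamma> b H r" and e: "e \<in> edges \<Gamma>"
  shows "carrier_graph (flip \<Gamma> e) b H r"
proof -
  have wf: "wf_graph \<Gamma>" using \<Gamma> by (simp add: carrier_graph_def)
  have le: "lab \<Gamma> e \<in> carrier G" using wf e wf_graphD by blast
  have wf': "wf_graph (flip \<Gamma> e)" using wf e by (auto simp: wf_graph_def)
  have "acyclic_graph (flip \<Gamma> e) b"
    unfolding acyclic_graph_def
  proof (intro allI impI)
    fix \<sigma> :: "nat \<Rightarrow> (nat \<times> bool) list \<Rightarrow> (nat \<times> bool) list" and w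
    assume "\<forall>e' \<in> edges (flip \<Gamma> e). bij (\<sigma> e')"
    then have \<sigma>: "bij (\<sigma> e')" if "e' \<in> edges \<Gamma>" for e' using that by simp
    then have "\<forall>e' \<in> edges \<Gamma>. bij ((\<sigma>(e := inv_into UNIV (\<sigma> e))) e')"
      using e by (auto intro: bij_imp_bij_inv)
    then obtain \<phi> where \<phi>: "\<phi> (\<one>, b) = w" "potential \<Gamma> (edges \<Gamma>) (\<sigma>(e := inv_into UNIV (\<sigma> e))) \<phi>"
      using \<Gamma> unfolding carrier_graph_def acyclic_graph_def by blast
    have "\<phi> (x \<otimes> inv (lab \<Gamma> e), src \<Gamma> e) = \<sigma> e (\<phi> (x, tgt \<Gamma> e))" if x: "x \<in> carrier G" for x
    proof -
      have "\<phi> (x \<otimes> inv (lab \<Gamma> e) \<otimes> lab \<Gamma> e, tgt \<Gamma> e) = inv_into UNIV (\<sigma> e) (\<phi> (x \<otimes> inv (lab \<Gamma> e), src \<Gamma> e))"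
        using \<phi>(2) e x le unfolding potential_def by auto
      with \<sigma>[OF e] x le show ?thesis by (simp add: m_assoc bij_is_surj surj_f_inv_f)
    qed
    then have "potential (flip \<Gamma> e) (edges (flip \<Gamma> e)) \<sigma> \<phi>"
      using \<phi>(2) by (auto simp: potential_def)
    with \<phi>(1) show "\<exists>\<phi>. \<phi> (\<one>, b) = w \<and> potential (flip \<Gamma> e) (edges (flip \<Gamma> e)) \<sigma> \<phi>" by blast
  qed
  then show ?thesis
    using \<Gamma> wf' conn_flip[OF wf e] unfolding carrier_graph_def loops_def by simp
qed

definition add_leaf :: "'a lgraph \<Rightarrow> nat \<Rightarrow> nat \<Rightarrow> nat \<Rightarrow> 'a \<Rightarrow> 'a lgraph" where
  "add_leaf \<Gamma> e i k g = \<Gamma>\<lparr>verts := insert k (verts \<Gamma>), edges := insert e (edges \<Gamma>),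
    src := (src \<Gamma>)(e := i), tgt := (tgt \<Gamma>)(e := k), lab := (lab \<Gamma>)(e := g)\<rparr>"

lemma add_leaf_simps [simp]:
  "verts (add_leaf \<Gamma> e i k g) = insert k (verts \<Gamma>)" "edges (add_leaf \<Gamma> e i k g) = insert e (edges \<Gamma>)"
  "src (add_leaf \<Gamma> e i k g) = (src \<Gamma>)(e := i)" "tgt (add_leaf \<Gamma> e i k g) = (tgt \<Gamma>)(e := k)"
  "lab (add_leaf \<Gamma> e i k g) = (lab \<Gamma>)(e := g)"
  by (simp_all add: add_leaf_def)

text \<open>The retraction p pushes lifts of the new vertex back along the new edge, so no loops are
  gained. Used to subdivide edges.\<close>

lemma carrier_graph_add_leaf:
  assumes \<Gamma>: "carrier_graph \<Gamma> b H r" and e: "e \<notin> edges \<Gamma>" and k: "k \<notin> verts \<Gamma>"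
    and i: "i \<in> verts \<Gamma>" and g: "g \<in> carrier G"
  shows "carrier_graph (add_leaf \<Gamma> e i k g) b H r"
proof -
  define \<Gamma>' where "\<Gamma>' = add_leaf \<Gamma> e i k g"
  have wf: "wf_graph \<Gamma>" and b: "b \<in> verts \<Gamma>" using \<Gamma> by (simp_all add: carrier_graph_def)
  have wf': "wf_graph \<Gamma>'" using wf e i g by (auto simp: \<Gamma>'_def wf_graph_def)
  have "conn \<Gamma> (edges \<Gamma>) = conn \<Gamma>' (edges \<Gamma>)" by (rule conn_cong) (use e in \<open>auto simp: \<Gamma>'_def\<close>)
  then have sub: "conn \<Gamma> (edges \<Gamma>) \<subseteq> conn \<Gamma>' (edges \<Gamma>')"
    using conn_mono[of "edges \<Gamma>" "edges \<Gamma>'" \<Gamma>'] by (auto simp: \<Gamma>'_def)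
  define p where "p v = (if snd v = k then (fst v \<otimes> inv g, i) else v)" for v
  have p: "(p u, p v) \<in> conn \<Gamma> (edges \<Gamma>)" if "(u, v) \<in> conn \<Gamma>' (edges \<Gamma>')" for u v
    using that
  proof (rule conn_map)
    fix x e' assume x: "x \<in> carrier G" and e': "e' \<in> edges \<Gamma>'"
    show "(p (x, src \<Gamma>' e'), p (x \<otimes> lab \<Gamma>' e', tgt \<Gamma>' e')) \<in> conn \<Gamma> (edges \<Gamma>)"
    proof (cases "e' = e")
      case False
      then have "e' \<in> edges \<Gamma>" using e' by (simp add: \<Gamma>'_def)
      moreover from this have "src \<Gamma> e' \<noteq> k" "tgt \<Gamma> e' \<noteq> k" using wf wf_graphD k by blast+
      ultimately show ?thesis using conn_edge[OF x, of e' "edges \<Gamma>" \<Gamma>] False by (simp add: \<Gamma>'_def p_def)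
    qed (use i k x g in \<open>auto simp: \<Gamma>'_def p_def m_assoc\<close>)
  qed
  have "b \<noteq> k" using b k by blast
  then have "((\<one>, b), (x, b)) \<in> conn \<Gamma> (edges \<Gamma>)" if "((\<one>, b), (x, b)) \<in> conn \<Gamma>' (edges \<Gamma>')" for x
    using p[OF that] by (simp add: p_def)
  then have "loops \<Gamma>' (edges \<Gamma>') b = loops \<Gamma> (edges \<Gamma>) b"
    using sub by (auto simp: loops_def)
  then have loops: "loops \<Gamma>' (edges \<Gamma>') b = H" using \<Gamma> by (simp add: carrier_graph_def)
  have con: "\<exists>x \<in> carrier G. ((\<one>, b), (x, j)) \<in> conn \<Gamma>' (edges \<Gamma>')" if j: "j \<in> verts \<Gamma>'" for j
  proof -
    have old: "\<exists>x \<in> carrier G. ((\<one>, b), (x, j)) \<in> conn \<Gamma>' (edges \<Gamma>')" if "j \<in> verts \<Gamma>" for j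
      using that \<Gamma> sub unfolding carrier_graph_def by blast
    obtain y where y: "y \<in> carrier G" "((\<one>, b), (y, i)) \<in> conn \<Gamma>' (edges \<Gamma>')" using old[OF i] by blast
    have "((y, i), (y \<otimes> g, k)) \<in> conn \<Gamma>' (edges \<Gamma>')"
      using conn_edge[OF y(1), of e "edges \<Gamma>'" \<Gamma>'] by (simp add: \<Gamma>'_def)
    then have "((\<one>, b), (y \<otimes> g, k)) \<in> conn \<Gamma>' (edges \<Gamma>')" using y(2) conn_trans by blast
    moreover have "y \<otimes> g \<in> carrier G" using y g by blast
    ultimately show ?thesis using j old by (auto simp: \<Gamma>'_def)
  qed
  have "acyclic_graph \<Gamma>' b"
    unfolding acyclic_graph_def
  proof (intro allI impI)
    fix \<sigma> :: "nat \<Rightarrow> (nat \<times> bool) list \<Rightarrow> (nat \<times> bool) list" and w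
    assume "\<forall>e \<in> edges \<Gamma>'. bij (\<sigma> e)"
    then have "\<forall>e \<in> edges \<Gamma>. bij (\<sigma> e)" by (simp add: \<Gamma>'_def)
    then obtain \<phi> where \<phi>: "\<phi> (\<one>, b) = w" "potential \<Gamma> (edges \<Gamma>) \<sigma> \<phi>"
      using \<Gamma> unfolding carrier_graph_def acyclic_graph_def by blast
    define \<phi>' where "\<phi>' v = (if snd v = k then \<sigma> e (\<phi> (fst v \<otimes> inv g, i)) else \<phi> v)" for v
    have "potential \<Gamma>' (edges \<Gamma>') \<sigma> \<phi>'"
      unfolding potential_def
    proof (intro ballI)
      fix x e' assume x: "x \<in> carrier G" and e': "e' \<in> edges \<Gamma>'"
      show "\<phi>' (x \<otimes> lab \<Gamma>' e', tgt \<Gamma>' e') = \<sigma> e' (\<phi>' (x, src \<Gamma>' e'))"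
      proof (cases "e' = e")
        case False
        then have "e' \<in> edges \<Gamma>" using e' by (simp add: \<Gamma>'_def)
        moreover from this have "src \<Gamma> e' \<noteq> k" "tgt \<Gamma> e' \<noteq> k" using wf wf_graphD k by blast+
        ultimately show ?thesis using \<phi>(2) x False by (simp add: \<Gamma>'_def \<phi>'_def potential_def)
      qed (use i k x g in \<open>auto simp: \<Gamma>'_def \<phi>'_def m_assoc\<close>)
    qed
    moreover have "\<phi>' (\<one>, b) = w" using \<phi>(1) b k by (auto simp: \<phi>'_def)
    ultimately show "\<exists>\<phi>. \<phi> (\<one>, b) = w \<and> potential \<Gamma>' (edges \<Gamma>') \<sigma> \<phi>" by blast
  qed
  moreover have "card (edges \<Gamma>') + 1 \<le> card (verts \<Gamma>') + r"
    using \<Gamma> e k by (simp add: carrier_graph_def \<Gamma>'_def wf_graph_def)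
  ultimately show ?thesis
    using wf' b loops con unfolding carrier_graph_def \<Gamma>'_def by simp
qed

text \<open>A lift (x, k) of the vanishing vertex is identified with (x \<otimes> inv g, i); the
  factors added to the labels express this change of coordinates at k.\<close>

definition contract :: "'a lgraph \<Rightarrow> nat \<Rightarrow> 'a lgraph" where
  "contract \<Gamma> f = (let k = tgt \<Gamma> f; i = src \<Gamma> f; g = lab \<Gamma> f in
    \<lparr>verts = verts \<Gamma> - {k}, edges = edges \<Gamma> - {f},
     src = (\<lambda>e. if src \<Gamma> e = k then i else src \<Gamma> e),
     tgt = (\<lambda>e. if tgt \<Gamma> e = k then i else tgt \<Gamma> e),
     lab = (\<lambda>e. (if src \<Gamma> e = k then g else \<one>) \<otimes> lab \<Gamma> e \<otimes> (if tgt \<Gamma> e = k then inv g else \<one>))\<rparr>)"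

lemma contract_simps [simp]:
  "verts (contract \<Gamma> f) = verts \<Gamma> - {tgt \<Gamma> f}" "edges (contract \<Gamma> f) = edges \<Gamma> - {f}"
  "src (contract \<Gamma> f) e = (if src \<Gamma> e = tgt \<Gamma> f then src \<Gamma> f else src \<Gamma> e)"
  "tgt (contract \<Gamma> f) e = (if tgt \<Gamma> e = tgt \<Gamma> f then src \<Gamma> f else tgt \<Gamma> e)"
  "lab (contract \<Gamma> f) e = (if src \<Gamma> e = tgt \<Gamma> f then lab \<Gamma> f else \<one>) \<otimes> lab \<Gamma> e \<otimes>
    (if tgt \<Gamma> e = tgt \<Gamma> f then inv (lab \<Gamma> f) else \<one>)"
  by (simp_all add: contract_def Let_def)

lemma contract_conn:
  assumes wf: "wf_graph \<Gamma>" and f: "f \<in> F" "F \<subseteq> edges \<Gamma>" "src \<Gamma> f \<noteq> tgt \<Gamma> f"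
  shows "(u, v) \<in> conn \<Gamma> F \<Longrightarrow>
      ((if snd u = tgt \<Gamma> f then (fst u \<otimes> inv (lab \<Gamma> f), src \<Gamma> f) else u),
       (if snd v = tgt \<Gamma> f then (fst v \<otimes> inv (lab \<Gamma> f), src \<Gamma> f) else v)) \<in> conn (contract \<Gamma> f) (F - {f})"
    and "conn (contract \<Gamma> f) (F - {f}) \<subseteq> conn \<Gamma> F"
proof -
  define \<Gamma>' where "\<Gamma>' = contract \<Gamma> f"
  have g: "lab \<Gamma> f \<in> carrier G" using wf f wf_graphD by blast
  have l: "lab \<Gamma> e \<in> carrier G" if "e \<in> F" for e using that wf f wf_graphD by blast
  define p where "p u = (if snd u = tgt \<Gamma> f then (fst u \<otimes> inv (lab \<Gamma> f), src \<Gamma> f) else u)" for u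
  have "(p u, p v) \<in> conn \<Gamma>' (F - {f})" if "(u, v) \<in> conn \<Gamma> F"
    using that
  proof (rule conn_map)
    fix x e assume x: "x \<in> carrier G" and e: "e \<in> F"
    show "(p (x, src \<Gamma> e), p (x \<otimes> lab \<Gamma> e, tgt \<Gamma> e)) \<in> conn \<Gamma>' (F - {f})"
    proof (cases "e = f")
      case True
      then show ?thesis using x g f(3) by (simp add: p_def m_assoc)
    next
      case False
      define y where "y = (if src \<Gamma> e = tgt \<Gamma> f then x \<otimes> inv (lab \<Gamma> f) else x)"
      have y: "y \<in> carrier G" using x g by (simp add: y_def)
      have "p (x, src \<Gamma> e) = (y, src \<Gamma>' e)" "p (x \<otimes> lab \<Gamma> e, tgt \<Gamma> e) = (y \<otimes> lab \<Gamma>' e, tgt \<Gamma>' e)"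
        using x g l[OF e] by (auto simp: p_def y_def \<Gamma>'_def m_assoc)
      then show ?thesis using conn_edge[OF y, of e "F - {f}" \<Gamma>'] e False by simp
    qed
  qed
  then show "(u, v) \<in> conn \<Gamma> F \<Longrightarrow>
      ((if snd u = tgt \<Gamma> f then (fst u \<otimes> inv (lab \<Gamma> f), src \<Gamma> f) else u),
       (if snd v = tgt \<Gamma> f then (fst v \<otimes> inv (lab \<Gamma> f), src \<Gamma> f) else v)) \<in> conn (contract \<Gamma> f) (F - {f})"
    by (simp add: p_def \<Gamma>'_def)
  have move: "((x, src \<Gamma> f), (x \<otimes> lab \<Gamma> f, tgt \<Gamma> f)) \<in> conn \<Gamma> F" if "x \<in> carrier G" for x
    using conn_edge[OF that f(1), of \<Gamma>] .
  show "conn (contract \<Gamma> f) (F - {f}) \<subseteq> conn \<Gamma> F"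
    unfolding \<Gamma>'_def[symmetric]
  proof (rule conn_subset)
    fix x e assume x: "x \<in> carrier G" and e: "e \<in> F - {f}"
    define y where "y = (if src \<Gamma> e = tgt \<Gamma> f then x \<otimes> lab \<Gamma> f else x)"
    have y: "y \<in> carrier G" using x g by (simp add: y_def)
    have le: "lab \<Gamma> e \<in> carrier G" using l e by simp
    have 1: "((x, src \<Gamma>' e), (y, src \<Gamma> e)) \<in> conn \<Gamma> F"
      using move[OF x] by (simp add: y_def \<Gamma>'_def)
    have 2: "((y, src \<Gamma> e), (y \<otimes> lab \<Gamma> e, tgt \<Gamma> e)) \<in> conn \<Gamma> F"
      using e by (intro conn_edge[OF y]) auto
    have 3: "((x \<otimes> lab \<Gamma>' e, tgt \<Gamma>' e), (y \<otimes> lab \<Gamma> e, tgt \<Gamma> e)) \<in> conn \<Gamma> F"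
      using move[of "y \<otimes> lab \<Gamma> e \<otimes> inv (lab \<Gamma> f)"] x g le by (auto simp: y_def \<Gamma>'_def m_assoc)
    show "((x, src \<Gamma>' e), (x \<otimes> lab \<Gamma>' e, tgt \<Gamma>' e)) \<in> conn \<Gamma> F"
      using 1 2 3 conn_trans conn_sym by metis
  qed
qed

lemma carrier_graph_contract:
  assumes \<Gamma>: "carrier_graph \<Gamma> b H r" and f: "f \<in> edges \<Gamma>" "src \<Gamma> f \<noteq> tgt \<Gamma> f" "tgt \<Gamma> f \<noteq> b"
  shows "carrier_graph (contract \<Gamma> f) b H r"
proof -
  define \<Gamma>' where "\<Gamma>' = contract \<Gamma> f"
  have wf: "wf_graph \<Gamma>" and b: "b \<in> verts \<Gamma>" using \<Gamma> by (simp_all add: carrier_graph_def)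
  have g: "lab \<Gamma> f \<in> carrier G" and fv: "src \<Gamma> f \<in> verts \<Gamma>" "tgt \<Gamma> f \<in> verts \<Gamma>"
    using wf f wf_graphD by blast+
  have wf': "wf_graph \<Gamma>'" using wf f fv g unfolding wf_graph_def \<Gamma>'_def by auto
  note conn = contract_conn[OF wf f(1) subset_refl f(2), folded \<Gamma>'_def]
  have fwd: "((\<one>, b), (x, j)) \<in> conn \<Gamma>' (edges \<Gamma>')"
    if "((\<one>, b), (x, j)) \<in> conn \<Gamma> (edges \<Gamma>)" "j \<noteq> tgt \<Gamma> f" for x j
    using conn(1)[OF that(1)] that(2) f(3) by (simp add: \<Gamma>'_def)
  have "loops \<Gamma>' (edges \<Gamma>') b = loops \<Gamma> (edges \<Gamma>) b"
    using fwd[of _ b] conn(2) f(3) by (auto simp: loops_def \<Gamma>'_def)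
  then have loops: "loops \<Gamma>' (edges \<Gamma>') b = H" using \<Gamma> by (simp add: carrier_graph_def)
  have con: "\<exists>x \<in> carrier G. ((\<one>, b), (x, j)) \<in> conn \<Gamma>' (edges \<Gamma>')" if "j \<in> verts \<Gamma>'" for j
  proof -
    have "j \<in> verts \<Gamma>" "j \<noteq> tgt \<Gamma> f" using that by (auto simp: \<Gamma>'_def)
    then show ?thesis using \<Gamma> fwd[of _ j] unfolding carrier_graph_def by blast
  qed
  have "acyclic_graph \<Gamma>' b"
    unfolding acyclic_graph_def
  proof (intro allI impI)
    fix \<sigma> :: "nat \<Rightarrow> (nat \<times> bool) list \<Rightarrow> (nat \<times> bool) list" and w
    assume "\<forall>e \<in> edges \<Gamma>'. bij (\<sigma> e)"
    \<comment> \<open>With the identity on the collapsed edge, the potential agrees at both of its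
      ends and descends to the contracted graph.\<close>
    then have "\<forall>e \<in> edges \<Gamma>. bij ((\<sigma>(f := id)) e)" by (simp add: \<Gamma>'_def)
    then obtain \<phi> where \<phi>: "\<phi> (\<one>, b) = w" "potential \<Gamma> (edges \<Gamma>) (\<sigma>(f := id)) \<phi>"
      using \<Gamma> unfolding carrier_graph_def acyclic_graph_def by blast
    have \<phi>f: "\<phi> (x, src \<Gamma> f) = \<phi> (x \<otimes> lab \<Gamma> f, tgt \<Gamma> f)" if "x \<in> carrier G" for x
      using \<phi>(2) f that unfolding potential_def by simp
    have "potential \<Gamma>' (edges \<Gamma>') \<sigma> \<phi>"
      unfolding potential_def
    proof (intro ballI)
      fix x e assume x: "x \<in> carrier G" and "e \<in> edges \<Gamma>'"
      then have e: "e \<in> edges \<Gamma>" "e \<noteq> f" by (auto simp: \<Gamma>'_def)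
      have le: "lab \<Gamma> e \<in> carrier G" using e wf wf_graphD by blast
      define y where "y = (if src \<Gamma> e = tgt \<Gamma> f then x \<otimes> lab \<Gamma> f else x)"
      have y: "y \<in> carrier G" using x g by (simp add: y_def)
      have "\<phi> (y \<otimes> lab \<Gamma> e, tgt \<Gamma> e) = \<sigma> e (\<phi> (y, src \<Gamma> e))"
        using \<phi>(2) y e unfolding potential_def by simp
      moreover have "\<phi> (y, src \<Gamma> e) = \<phi> (x, src \<Gamma>' e)"
        using \<phi>f[OF x] by (simp add: y_def \<Gamma>'_def)
      moreover have "\<phi> (y \<otimes> lab \<Gamma> e, tgt \<Gamma> e) = \<phi> (x \<otimes> lab \<Gamma>' e, tgt \<Gamma>' e)"
        using \<phi>f[of "y \<otimes> lab \<Gamma> e \<otimes> inv (lab \<Gamma> f)"] x y g le by (auto simp: y_def \<Gamma>'_def m_assoc)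
      ultimately show "\<phi> (x \<otimes> lab \<Gamma>' e, tgt \<Gamma>' e) = \<sigma> e (\<phi> (x, src \<Gamma>' e))" by simp
    qed
    with \<phi>(1) show "\<exists>\<phi>. \<phi> (\<one>, b) = w \<and> potential \<Gamma>' (edges \<Gamma>') \<sigma> \<phi>" by blast
  qed
  moreover have "card (edges \<Gamma>') + 1 \<le> card (verts \<Gamma>') + r"
  proof -
    have "card (verts \<Gamma>) > 0" "card (edges \<Gamma>) > 0" using wf b f by (auto simp: wf_graph_def card_gt_0_iff)
    moreover have "card (verts \<Gamma>') = card (verts \<Gamma>) - 1" "card (edges \<Gamma>') = card (edges \<Gamma>) - 1"
      using f fv wf by (simp_all add: \<Gamma>'_def wf_graph_def)
    moreover have "card (edges \<Gamma>) + 1 \<le> card (verts \<Gamma>) + r" using \<Gamma> by (simp add: carrier_graph_def)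
    ultimately show ?thesis by linarith
  qed
  ultimately show ?thesis
    using wf' b f(3) loops con unfolding carrier_graph_def \<Gamma>'_def by simp
qed

end

section \<open>Roses, change of base vertex, and bases read off a graph\<close>

context group
begin

text \<open>One loop per basis element: the graph that starts the minimisation.\<close>

lemma carrier_graph_rose:
  assumes bg: "based_group G H X" and X: "finite X" "card X = r"
  shows "\<exists>\<Gamma>. carrier_graph \<Gamma> 0 H r"
proof -
  interpret based_group G H X by (rule bg)
  obtain f where f: "bij_betw f {..<r} X"
    using X ex_bij_betw_nat_finite[OF X(1)] by (auto simp: lessThan_atLeast0)
  define \<Gamma> where "\<Gamma> = \<lparr>verts = {0}, edges = {..<r}, src = (\<lambda>_. 0), tgt = (\<lambda>_. 0), lab = f\<rparr>"
  have fX: "f e \<in> X" if "e < r" for e using f that by (auto simp: bij_betw_def)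
  have fc: "f e \<in> carrier G" if "e < r" for e using fX[OF that] X_carrier by auto
  have wf: "wf_graph \<Gamma>" using fc by (auto simp: \<Gamma>_def wf_graph_def)
  have "fst v \<in> H" if "((\<one>, 0), v) \<in> conn \<Gamma> {..<r}" for v
    using that
  proof (induction rule: conn_induct)
    case refl
    show ?case using subgroup.one_closed[OF H] by simp
  next
    case (step x e)
    have fe: "f e \<in> H" "f e \<in> carrier G" using fX[of e] step X_H fc by auto
    have "x = (x \<otimes> f e) \<otimes> inv (f e)" using step fe by (simp add: m_assoc)
    then have "x \<in> H \<longleftrightarrow> x \<otimes> f e \<in> H"
      using subgroup.m_closed[OF H] subgroup.m_inv_closed[OF H] fe by metis
    then show ?case by (simp add: \<Gamma>_def)
  qed
  moreover have "((\<one>, 0), (h, 0)) \<in> conn \<Gamma> {..<r}" if "h \<in> H" for h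
  proof -
    have "((\<one>, 0), (word_val G w, 0)) \<in> conn \<Gamma> {..<r}" if "w \<in> words X" for w
      using that
    proof (induction w rule: rev_induct)
      case (snoc l w)
      then have w: "w \<in> words X" "fst l \<in> X" by auto
      have wc: "word_val G w \<in> carrier G" using w X_carrier by auto
      obtain e where e: "e < r" "fst l = f e" using w f by (auto simp: bij_betw_def)
      have "((word_val G w, 0), (word_val G w \<otimes> letter_val G l, 0)) \<in> conn \<Gamma> {..<r}"
      proof (cases "snd l")
        case True
        then have "letter_val G l = f e" using e by (cases l) auto
        then show ?thesis using conn_edge[OF wc, of e "{..<r}" \<Gamma>] e by (simp add: \<Gamma>_def)
      next
        case False
        then have "letter_val G l = inv (f e)" using e by (cases l) auto
        then show ?thesis
          using conn_sym[OF conn_edge[of "word_val G w \<otimes> inv (f e)" e "{..<r}" \<Gamma>]] e wc fc[of e]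
          by (simp add: \<Gamma>_def m_assoc)
      qed
      then show ?case using snoc.IH[OF w(1)] conn_trans word_val_snoc[OF w X_carrier] by metis
    qed simp
    then show ?thesis using rw rw_words that by metis
  qed
  ultimately have loops: "loops \<Gamma> (edges \<Gamma>) 0 = H"
    using H_carrier by (fastforce simp: loops_def \<Gamma>_def)
  have "acyclic_graph \<Gamma> 0"
    unfolding acyclic_graph_def
  proof (intro allI impI)
    fix \<sigma> :: "nat \<Rightarrow> (nat \<times> bool) list \<Rightarrow> (nat \<times> bool) list" and w
    assume "\<forall>e \<in> edges \<Gamma>. bij (\<sigma> e)"
    then have \<sigma>: "\<And>e. e \<in> {..<r} \<Longrightarrow> bij (\<sigma> e)" by (simp add: \<Gamma>_def)
    obtain \<psi> where \<psi>: "\<psi> \<one> = w" "\<And>h e. h \<in> H \<Longrightarrow> e \<in> {..<r} \<Longrightarrow> \<psi> (h \<otimes> f e) = \<sigma> e (\<psi> h)"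
      using potential[of f "{..<r}" \<sigma> w] f \<sigma> by metis
    \<comment> \<open>The components of the unfolded rose are the left cosets of H. Representatives,
      with \<one> for H itself, transport \<psi> from H to all cosets.\<close>
    define c where "c x = (if x \<in> H then \<one> else SOME y. y \<in> x <# H)" for x
    have c: "inv (c x) \<otimes> x \<in> H \<and> c x \<in> carrier G" if x: "x \<in> carrier G" for x
    proof (cases "x \<in> H")
      case False
      have "\<one> \<in> H" using subgroup.one_closed[OF H] .
      then have "x \<in> x <# H" using x by (force simp: l_coset_def)
      then have "c x \<in> x <# H" using False someI[of "\<lambda>y. y \<in> x <# H" x] by (simp add: c_def)
      then obtain h where h: "h \<in> H" "c x = x \<otimes> h" by (auto simp: l_coset_def)
      then have "inv (c x) \<otimes> x = inv h" "c x \<in> carrier G"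
        using x H_carrier by (auto simp: inv_mult_group m_assoc subset_iff)
      then show ?thesis using h subgroup.m_inv_closed[OF H] by simp
    qed (use x in \<open>simp add: c_def\<close>)
    have cc: "c (x \<otimes> f e) = c x" if x: "x \<in> carrier G" and e: "e < r" for x e
    proof -
      have fe: "f e \<in> H" using fX[OF e] X_H by auto
      have 1: "x \<otimes> f e <# H = x <# H"
        using lcos_m_assoc[of H x "f e"] H_carrier x fc[OF e] coset_join3[of "f e" H] fe H by simp
      have "x = (x \<otimes> f e) \<otimes> inv (f e)" using x fc[OF e] by (simp add: m_assoc)
      then have "x \<otimes> f e \<in> H \<longleftrightarrow> x \<in> H"
        using subgroup.m_closed[OF H] subgroup.m_inv_closed[OF H] fe by metis
      with 1 show ?thesis by (simp add: c_def)
    qed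
    define \<phi> where "\<phi> v = \<psi> (inv (c (fst v)) \<otimes> fst v)" for v :: "'a \<times> nat"
    have "potential \<Gamma> (edges \<Gamma>) \<sigma> \<phi>"
      unfolding potential_def
    proof (intro ballI)
      fix x e assume x: "x \<in> carrier G" and "e \<in> edges \<Gamma>"
      then have e: "e < r" by (simp add: \<Gamma>_def)
      have "inv (c x) \<otimes> (x \<otimes> f e) = (inv (c x) \<otimes> x) \<otimes> f e"
        using c[OF x] x fc[OF e] by (simp add: m_assoc)
      then show "\<phi> (x \<otimes> lab \<Gamma> e, tgt \<Gamma> e) = \<sigma> e (\<phi> (x, src \<Gamma> e))"
        using \<psi>(2)[of "inv (c x) \<otimes> x" e] c[OF x] e cc[OF x e] by (simp add: \<phi>_def \<Gamma>_def)
    qed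
    moreover have "\<phi> (\<one>, 0) = w" using \<psi>(1) subgroup.one_closed[OF H] by (simp add: \<phi>_def c_def)
    ultimately show "\<exists>\<phi>. \<phi> (\<one>, 0) = w \<and> potential \<Gamma> (edges \<Gamma>) \<sigma> \<phi>" by blast
  qed
  moreover have "0 \<in> verts \<Gamma>" "card (edges \<Gamma>) + 1 \<le> card (verts \<Gamma>) + r"
    "\<forall>i \<in> verts \<Gamma>. \<exists>x \<in> carrier G. ((\<one>, 0), (x, i)) \<in> conn \<Gamma> (edges \<Gamma>)"
    by (auto simp: \<Gamma>_def intro!: bexI[of _ \<one>])
  ultimately show ?thesis using wf loops unfolding carrier_graph_def by blast
qed

text \<open>Lets statements about loops at the base be applied at every vertex, at the price of a
  conjugation.\<close>

lemma carrier_graph_rebase: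
  assumes \<Gamma>: "carrier_graph \<Gamma> b H r" and i: "i \<in> verts \<Gamma>" and x: "x \<in> carrier G"
    and c: "((\<one>, b), (x, i)) \<in> conn \<Gamma> (edges \<Gamma>)"
  shows "carrier_graph \<Gamma> i ((\<lambda>h. inv x \<otimes> h \<otimes> x) ` H) r"
proof -
  have wf: "wf_graph \<Gamma>" using \<Gamma> by (simp add: carrier_graph_def)
  note left = conn_left[OF _ subset_refl wf]
  have c': "((inv x, b), (\<one>, i)) \<in> conn \<Gamma> (edges \<Gamma>)" using left[OF c, of "inv x"] x by simp
  have con: "\<exists>y \<in> carrier G. ((\<one>, i), (y, j)) \<in> conn \<Gamma> (edges \<Gamma>)" if j: "j \<in> verts \<Gamma>" for j
  proof -
    obtain y where y: "y \<in> carrier G" "((\<one>, b), (y, j)) \<in> conn \<Gamma> (edges \<Gamma>)"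
      using \<Gamma> j unfolding carrier_graph_def by blast
    have "((inv x, b), (inv x \<otimes> y, j)) \<in> conn \<Gamma> (edges \<Gamma>)" using left[OF y(2), of "inv x"] x by simp
    then have "((\<one>, i), (inv x \<otimes> y, j)) \<in> conn \<Gamma> (edges \<Gamma>)" using c' conn_sym conn_trans by blast
    then show ?thesis using x y by blast
  qed
  have H: "H = loops \<Gamma> (edges \<Gamma>) b" using \<Gamma> by (simp add: carrier_graph_def)
  have "loops \<Gamma> (edges \<Gamma>) i = (\<lambda>h. inv x \<otimes> h \<otimes> x) ` H"
  proof (intro subset_antisym subsetI)
    fix y assume "y \<in> loops \<Gamma> (edges \<Gamma>) i"
    then have y: "y \<in> carrier G" "((\<one>, i), (y, i)) \<in> conn \<Gamma> (edges \<Gamma>)" by (auto simp: loops_def)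
    have 1: "((x, i), (x \<otimes> y, i)) \<in> conn \<Gamma> (edges \<Gamma>)" using left[OF y(2) x] x by simp
    have 2: "((x \<otimes> y \<otimes> inv x, b), (x \<otimes> y, i)) \<in> conn \<Gamma> (edges \<Gamma>)"
      using left[OF c', of "x \<otimes> y"] x y by simp
    have "((\<one>, b), (x \<otimes> y \<otimes> inv x, b)) \<in> conn \<Gamma> (edges \<Gamma>)"
      using c 1 2 conn_sym conn_trans by blast
    then have "x \<otimes> y \<otimes> inv x \<in> H" using x y by (simp add: H loops_def)
    moreover have "y = inv x \<otimes> (x \<otimes> y \<otimes> inv x) \<otimes> x" using x y by (simp add: m_assoc)
    ultimately show "y \<in> (\<lambda>h. inv x \<otimes> h \<otimes> x) ` H" by blast
  next
    fix y assume "y \<in> (\<lambda>h. inv x \<otimes> h \<otimes> x) ` H"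
    then obtain h where h: "h \<in> carrier G" "((\<one>, b), (h, b)) \<in> conn \<Gamma> (edges \<Gamma>)" "y = inv x \<otimes> h \<otimes> x"
      by (auto simp: H loops_def)
    have 1: "((inv x, b), (inv x \<otimes> h, b)) \<in> conn \<Gamma> (edges \<Gamma>)" using left[OF h(2), of "inv x"] x by simp
    have 2: "((inv x \<otimes> h, b), (inv x \<otimes> h \<otimes> x, i)) \<in> conn \<Gamma> (edges \<Gamma>)"
      using left[OF c, of "inv x \<otimes> h"] x h by simp
    have "((\<one>, i), (inv x \<otimes> h \<otimes> x, i)) \<in> conn \<Gamma> (edges \<Gamma>)" using c' 1 2 conn_sym conn_trans by blast
    then show "y \<in> loops \<Gamma> (edges \<Gamma>) i" using h x by (simp add: loops_def)
  qed
  moreover have "acyclic_graph \<Gamma> i"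
    unfolding acyclic_graph_def
  proof (intro allI impI)
    fix \<sigma> :: "nat \<Rightarrow> (nat \<times> bool) list \<Rightarrow> (nat \<times> bool) list" and w
    assume \<sigma>: "\<forall>e \<in> edges \<Gamma>. bij (\<sigma> e)"
    obtain \<tau> where \<tau>: "bij \<tau>" "\<And>g \<phi>. g \<in> carrier G \<Longrightarrow> potential \<Gamma> (edges \<Gamma>) \<sigma> \<phi> \<Longrightarrow>
        \<phi> (g \<otimes> x, i) = \<tau> (\<phi> (g \<otimes> \<one>, b))"
      using potential_transport[OF c subset_refl wf one_closed, of \<sigma>] \<sigma> by auto
    obtain \<phi> where \<phi>: "\<phi> (\<one>, b) = inv_into UNIV \<tau> w" "potential \<Gamma> (edges \<Gamma>) \<sigma> \<phi>"
      using \<Gamma> \<sigma> unfolding carrier_graph_def acyclic_graph_def by blast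
    have "\<phi> (x, i) = w"
      using \<tau>(2)[OF one_closed \<phi>(2)] \<phi>(1) \<tau>(1) x by (simp add: bij_is_surj surj_f_inv_f)
    moreover have "potential \<Gamma> (edges \<Gamma>) \<sigma> (\<lambda>v. \<phi> (x \<otimes> fst v, snd v))"
      using \<phi>(2) x wf_graphD(3)[OF wf] unfolding potential_def by (simp flip: m_assoc)
    ultimately show "\<exists>\<phi>. \<phi> (\<one>, i) = w \<and> potential \<Gamma> (edges \<Gamma>) \<sigma> \<phi>"
      using x by (intro exI[of _ "\<lambda>v. \<phi> (x \<otimes> fst v, snd v)"]) simp
  qed
  ultimately show ?thesis using \<Gamma> i con unfolding carrier_graph_def by simp
qed

lemma single_vertex_loops:
  assumes wf: "wf_graph \<Gamma>" and F: "F \<subseteq> edges \<Gamma>" and b: "\<And>e. e \<in> F \<Longrightarrow> src \<Gamma> e = b \<and> tgt \<Gamma> e = b"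
  shows "loops \<Gamma> F b = word_val G ` words (lab \<Gamma> ` F)"
proof (intro subset_antisym subsetI)
  have lc: "lab \<Gamma> ` F \<subseteq> carrier G" using wf F wf_graphD by blast
  fix x assume "x \<in> loops \<Gamma> F b"
  then have "((\<one>, b), (x, b)) \<in> conn \<Gamma> F" by (simp add: loops_def)
  then have "fst (x, b) \<in> word_val G ` words (lab \<Gamma> ` F)"
  proof (induction rule: conn_induct)
    case refl
    show ?case by (auto intro!: image_eqI[of _ _ "[]"])
  next
    case (step y e)
    have sub: "subgroup (word_val G ` words (lab \<Gamma> ` F)) G" by (rule subgroup_word_vals[OF lc])
    have le: "lab \<Gamma> e \<in> word_val G ` words (lab \<Gamma> ` F)"
      using step lc by (intro image_eqI[of _ _ "[(lab \<Gamma> e, True)]"]) auto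
    have "y = (y \<otimes> lab \<Gamma> e) \<otimes> inv (lab \<Gamma> e)" using step lc by (auto simp: m_assoc)
    then show ?case
      using subgroup.m_closed[OF sub] subgroup.m_inv_closed[OF sub] le by (metis fst_conv)
  qed
  then show "x \<in> word_val G ` words (lab \<Gamma> ` F)" by simp
next
  have lc: "lab \<Gamma> ` F \<subseteq> carrier G" using wf F wf_graphD by blast
  fix x assume "x \<in> word_val G ` words (lab \<Gamma> ` F)"
  then have "x \<in> generate G (lab \<Gamma> ` F)" using generate_eq_word_vals[OF lc] by simp
  moreover have "lab \<Gamma> ` F \<subseteq> loops \<Gamma> F b"
    using conn_edge[OF one_closed, of _ F \<Gamma>] b lc by (fastforce simp: loops_def)
  ultimately show "x \<in> loops \<Gamma> F b"
    using generate_subgroup_incl[OF _ subgroup_loops[OF wf F]] by blast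
qed

text \<open>Acyclicity, applied to the permutations \<open>ract\<close> of words over the edges,
  yields the potential that \<open>basis_of_potential\<close> requires.\<close>

lemma basis_of_rose:
  assumes \<Gamma>: "carrier_graph \<Gamma> b H r" and v: "verts \<Gamma> = {b}"
  shows "inj_on (lab \<Gamma>) (edges \<Gamma>)" "basis (lab \<Gamma> ` edges \<Gamma>) H"
proof -
  have wf: "wf_graph \<Gamma>" using \<Gamma> by (simp add: carrier_graph_def)
  have e: "src \<Gamma> e = b \<and> tgt \<Gamma> e = b" if "e \<in> edges \<Gamma>" for e
    using wf_graphD[OF wf that] v by simp
  have lc: "lab \<Gamma> ` edges \<Gamma> \<subseteq> carrier G" using wf wf_graphD by blast
  have "\<forall>e \<in> edges \<Gamma>. bij (ract (e, True))" by (simp add: bij_ract)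
  then obtain \<phi> where \<phi>: "\<phi> (\<one>, b) = []" "potential \<Gamma> (edges \<Gamma>) (\<lambda>e. ract (e, True)) \<phi>"
    using \<Gamma> unfolding carrier_graph_def acyclic_graph_def by metis
  have *: "\<phi> (x \<otimes> lab \<Gamma> e', b) = ract (e', True) (\<phi> (x, b))" if "x \<in> carrier G" "e' \<in> edges \<Gamma>" for x e'
    using \<phi>(2) that e[OF that(2)] unfolding potential_def by metis
  note ** = basis_of_potential[OF lc, of "\<lambda>x. \<phi> (x, b)", OF \<phi>(1) *]
  have "H = word_val G ` words (lab \<Gamma> ` edges \<Gamma>)"
    using \<Gamma> single_vertex_loops[OF wf subset_refl e] by (simp add: carrier_graph_def)
  with ** show "inj_on (lab \<Gamma>) (edges \<Gamma>)" "basis (lab \<Gamma> ` edges \<Gamma>) H" by simp_all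
qed

text \<open>Contract a spanning tree of \<open>\<Gamma>\<close> that extends a spanning tree of the subgraph; the labels of the
  remaining loops form the basis.\<close>

lemma subgraph_basis:
  assumes "carrier_graph \<Gamma> b H r" "F \<subseteq> edges \<Gamma>"
    and "\<And>e. e \<in> F \<Longrightarrow> \<exists>x. ((\<one>, b), (x, src \<Gamma> e)) \<in> conn \<Gamma> F"
  shows "\<exists>Y Z. finite (Y \<union> Z) \<and> Y \<inter> Z = {} \<and> basis (Y \<union> Z) H \<and> loops \<Gamma> F b = word_val G ` words Y"
  using assms
proof (induction "card (verts \<Gamma>)" arbitrary: \<Gamma> F rule: less_induct)
  case less
  note \<Gamma> = less.prems(1) and F = less.prems(2) and cF = less.prems(3)
  have wf: "wf_graph \<Gamma>" and b: "b \<in> verts \<Gamma>" using \<Gamma> by (simp_all add: carrier_graph_def)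
  show ?case
  proof (cases "verts \<Gamma> = {b}")
    case True
    have F1: "src \<Gamma> e = b \<and> tgt \<Gamma> e = b" if "e \<in> F" for e using wf_graphD[OF wf] that F True by blast
    have "loops \<Gamma> F b = word_val G ` words (lab \<Gamma> ` F)" by (rule single_vertex_loops[OF wf F F1])
    moreover have "lab \<Gamma> ` F \<union> lab \<Gamma> ` (edges \<Gamma> - F) = lab \<Gamma> ` edges \<Gamma>" using F by auto
    moreover have "lab \<Gamma> ` F \<inter> lab \<Gamma> ` (edges \<Gamma> - F) = {}"
      using basis_of_rose(1)[OF \<Gamma> True] F by (auto simp: inj_on_def)
    moreover have "finite (lab \<Gamma> ` edges \<Gamma>)" using wf by (simp add: wf_graph_def)
    ultimately show ?thesis using basis_of_rose(2)[OF \<Gamma> True] by metis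
  next
    case False
    \<comment> \<open>Contraction of an edge f leaving b, possibly after a flip. By
      \<open>dich\<close> the loops of F at b survive: either f is collapsed inside F, or F does not
      meet the vertex that disappears.\<close>
    have step: ?thesis
      if \<Gamma>1: "carrier_graph \<Gamma>1 b H r" "verts \<Gamma>1 = verts \<Gamma>" "edges \<Gamma>1 = edges \<Gamma>" "conn \<Gamma>1 F = conn \<Gamma> F"
        and cF1: "\<And>e. e \<in> F \<Longrightarrow> \<exists>x. ((\<one>, b), (x, src \<Gamma>1 e)) \<in> conn \<Gamma>1 F"
        and f: "f \<in> edges \<Gamma>1" "src \<Gamma>1 f = b" "tgt \<Gamma>1 f \<noteq> b"
        and dich: "f \<in> F \<or> (\<forall>e \<in> F. src \<Gamma>1 e \<noteq> tgt \<Gamma>1 f \<and> tgt \<Gamma>1 e \<noteq> tgt \<Gamma>1 f)" for \<Gamma>1 f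
    proof -
      have wf1: "wf_graph \<Gamma>1" using \<Gamma>1 by (simp add: carrier_graph_def)
      define \<Gamma>2 where "\<Gamma>2 = contract \<Gamma>1 f"
      have \<Gamma>2: "carrier_graph \<Gamma>2 b H r"
        unfolding \<Gamma>2_def by (rule carrier_graph_contract) (use \<Gamma>1 f in auto)
      have "tgt \<Gamma>1 f \<in> verts \<Gamma>" using wf_graphD(2)[OF wf1 f(1)] \<Gamma>1 by simp
      moreover have "finite (verts \<Gamma>)" using wf by (simp add: wf_graph_def)
      ultimately have card: "card (verts \<Gamma>2) < card (verts \<Gamma>)"
        using \<Gamma>1(2) by (simp add: \<Gamma>2_def card_Diff1_less del: card_Diff_insert)
      have F1: "F \<subseteq> edges \<Gamma>1" using F \<Gamma>1 by simp
      have key: "loops \<Gamma>2 (F - {f}) b = loops \<Gamma>1 F b \<and>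
          (\<forall>e \<in> F - {f}. \<exists>x. ((\<one>, b), (x, src \<Gamma>2 e)) \<in> conn \<Gamma>2 (F - {f}))"
      proof (cases "f \<in> F")
        case True
        have ne: "src \<Gamma>1 f \<noteq> tgt \<Gamma>1 f" using f by simp
        note conn = contract_conn[OF wf1 True F1 ne, folded \<Gamma>2_def]
        have "((\<one>, b), (x, b)) \<in> conn \<Gamma>2 (F - {f})" if "((\<one>, b), (x, b)) \<in> conn \<Gamma>1 F" for x
          using conn(1)[OF that] f by simp
        then have "loops \<Gamma>2 (F - {f}) b = loops \<Gamma>1 F b" using conn(2) by (auto simp: loops_def)
        moreover have "\<exists>x. ((\<one>, b), (x, src \<Gamma>2 e)) \<in> conn \<Gamma>2 (F - {f})" if e: "e \<in> F - {f}" for e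
        proof -
          obtain x where "((\<one>, b), (x, src \<Gamma>1 e)) \<in> conn \<Gamma>1 F" using cF1[of e] e by blast
          from conn(1)[OF this] f show ?thesis by (auto simp: \<Gamma>2_def split: if_splits)
        qed
        ultimately show ?thesis by blast
      next
        case False
        then have F2: "src \<Gamma>1 e \<noteq> tgt \<Gamma>1 f" "tgt \<Gamma>1 e \<noteq> tgt \<Gamma>1 f" if "e \<in> F" for e using that dich by auto
        have "conn \<Gamma>2 F = conn \<Gamma>1 F"
          by (rule conn_cong) (use F2 wf_graphD(3)[OF wf1] F1 in \<open>auto simp: \<Gamma>2_def\<close>)
        moreover have "src \<Gamma>2 e = src \<Gamma>1 e" if "e \<in> F" for e using F2 that by (simp add: \<Gamma>2_def)
        ultimately show ?thesis using False cF1 by (simp add: loops_def)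
      qed
      have "loops \<Gamma>1 F b = loops \<Gamma> F b" using \<Gamma>1 by (simp add: loops_def)
      with less.hyps[OF card \<Gamma>2, of "F - {f}"] key F1 show ?thesis by (auto simp: \<Gamma>2_def)
    qed
    have cE: "\<exists>f \<in> edges \<Gamma>. (src \<Gamma> f = b \<and> tgt \<Gamma> f \<noteq> b) \<or> (src \<Gamma> f \<noteq> b \<and> tgt \<Gamma> f = b)"
    proof (rule ccontr)
      assume "\<not> ?thesis"
      then have 1: "src \<Gamma> f = b \<longleftrightarrow> tgt \<Gamma> f = b" if "f \<in> edges \<Gamma>" for f using that by blast
      obtain j where j: "j \<in> verts \<Gamma>" "j \<noteq> b" using False b by blast
      then obtain x where "((\<one>, b), (x, j)) \<in> conn \<Gamma> (edges \<Gamma>)" using \<Gamma> unfolding carrier_graph_def by blast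
      then have "snd (x, j) = b"
        by (induction rule: conn_induct) (use 1 in auto)
      with j show False by simp
    qed
    define bad where "bad f \<longleftrightarrow> (src \<Gamma> f = b \<and> tgt \<Gamma> f \<noteq> b) \<or> (src \<Gamma> f \<noteq> b \<and> tgt \<Gamma> f = b)" for f
    \<comment> \<open>Edges of F come first, as long as F reaches beyond b, so that the spanning
      tree extends one of F. Afterwards F consists of loops at b and any edge joining b to another
      vertex will do.\<close>
    have "\<exists>f \<in> edges \<Gamma>. bad f \<and> (f \<in> F \<or> (\<forall>e \<in> F. src \<Gamma> e = b \<and> tgt \<Gamma> e = b))"
    proof (cases "\<exists>f \<in> F. bad f")
      case True
      with F show ?thesis by blast
    next
      case nb: False
      then have 1: "src \<Gamma> f = b \<longleftrightarrow> tgt \<Gamma> f = b" if "f \<in> F" for f using that by (auto simp: bad_def)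
      have "src \<Gamma> e = b" if e: "e \<in> F" for e
      proof -
        obtain x where "((\<one>, b), (x, src \<Gamma> e)) \<in> conn \<Gamma> F" using cF[OF e] by blast
        then have "snd (x, src \<Gamma> e) = b"
          by (induction rule: conn_induct) (use 1 in auto)
        then show ?thesis by simp
      qed
      with 1 cE show ?thesis unfolding bad_def by blast
    qed
    then obtain f where f: "f \<in> edges \<Gamma>" "bad f" "f \<in> F \<or> (\<forall>e \<in> F. src \<Gamma> e = b \<and> tgt \<Gamma> e = b)" by blast
    show ?thesis
    proof (cases "src \<Gamma> f = b")
      case True
      then have "tgt \<Gamma> f \<noteq> b" using f by (auto simp: bad_def)
      with True f show ?thesis by (intro step[OF \<Gamma> refl refl refl cF, of f]) auto
    next
      case nb: False
      then have tb: "tgt \<Gamma> f = b" using f by (auto simp: bad_def)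
      have cfl: "conn (flip \<Gamma> f) F = conn \<Gamma> F" by (rule conn_flip[OF wf f(1) F])
      show ?thesis
      proof (rule step[of "flip \<Gamma> f" f])
        show "carrier_graph (flip \<Gamma> f) b H r" by (rule carrier_graph_flip[OF \<Gamma> f(1)])
        show "\<exists>x. ((\<one>, b), (x, src (flip \<Gamma> f) e)) \<in> conn (flip \<Gamma> f) F" if "e \<in> F" for e
          using cF[OF that] cfl tb by (cases "e = f") (auto intro: exI[of _ \<one>])
        show "f \<in> F \<or> (\<forall>e \<in> F. src (flip \<Gamma> f) e \<noteq> tgt (flip \<Gamma> f) f \<and> tgt (flip \<Gamma> f) e \<noteq> tgt (flip \<Gamma> f) f)"
          using f(3) nb by auto
      qed (use f cfl tb nb in auto)
    qed
  qed
qed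

lemma conn_component:
  assumes c: "(u, v) \<in> conn \<Gamma> F"
  shows "(u, v) \<in> conn \<Gamma> {e \<in> F. \<exists>x. (u, (x, src \<Gamma> e)) \<in> conn \<Gamma> F}"
proof -
  define K where "K = {e \<in> F. \<exists>x. (u, (x, src \<Gamma> e)) \<in> conn \<Gamma> F}"
  have sub: "conn \<Gamma> K \<subseteq> conn \<Gamma> F" by (rule conn_mono) (auto simp: K_def)
  show ?thesis
    unfolding K_def[symmetric] using c
  proof (induction rule: conn_induct)
    case (step x e)
    have "(u, (x, src \<Gamma> e)) \<in> conn \<Gamma> F"
      if "(u, (x \<otimes> lab \<Gamma> e, tgt \<Gamma> e)) \<in> conn \<Gamma> F"
      using that conn_edge[OF step, of \<Gamma>] conn_sym conn_trans by blast
    then have "(u, (x, src \<Gamma> e)) \<in> conn \<Gamma> K \<or> (u, (x \<otimes> lab \<Gamma> e, tgt \<Gamma> e)) \<in> conn \<Gamma> K \<Longrightarrow> e \<in> K"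
      using sub step by (auto simp: K_def)
    then show ?case using conn_edge[OF step(1), of e K \<Gamma>] conn_sym conn_trans by metis
  qed simp
qed

text \<open>Edges of F outside the component of b carry no loops at b; dropping them makes the
  subgraph connected, as \<open>subgraph_basis\<close> wants it.\<close>

lemma loops_basis:
  assumes \<Gamma>: "carrier_graph \<Gamma> b H r" and F: "F \<subseteq> edges \<Gamma>"
  shows "\<exists>Y Z. finite (Y \<union> Z) \<and> Y \<inter> Z = {} \<and> basis (Y \<union> Z) H \<and> loops \<Gamma> F b = word_val G ` words Y"
proof -
  define K where "K = {e \<in> F. \<exists>x. ((\<one>, b), (x, src \<Gamma> e)) \<in> conn \<Gamma> F}"
  have c: "((\<one>, b), v) \<in> conn \<Gamma> F \<Longrightarrow> ((\<one>, b), v) \<in> conn \<Gamma> K" for v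
    unfolding K_def by (rule conn_component)
  have "conn \<Gamma> K \<subseteq> conn \<Gamma> F" by (rule conn_mono) (auto simp: K_def)
  with c have "loops \<Gamma> F b = loops \<Gamma> K b" by (auto simp: loops_def)
  moreover have "K \<subseteq> edges \<Gamma>" using F by (auto simp: K_def)
  moreover have "\<exists>x. ((\<one>, b), (x, src \<Gamma> e)) \<in> conn \<Gamma> K" if "e \<in> K" for e
    using that c by (auto simp: K_def)
  ultimately show ?thesis using subgraph_basis[OF \<Gamma>] by metis
qed

end

section \<open>Minimal carrier graphs\<close>

text \<open>The flag treats the two ends of an edge alike: facts are proved for \<open>True\<close>
  and transferred by \<open>flip\<close>.\<close>

definition (in group) ostep :: "'a lgraph \<Rightarrow> nat \<Rightarrow> bool \<Rightarrow> 'a \<times> nat \<Rightarrow> 'a \<times> nat \<Rightarrow> bool" where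
  "ostep \<Gamma> e s v v' \<longleftrightarrow> e \<in> edges \<Gamma> \<and> (\<exists>x \<in> carrier G.
    (if s then v = (x, src \<Gamma> e) \<and> v' = (x \<otimes> lab \<Gamma> e, tgt \<Gamma> e)
     else v = (x \<otimes> lab \<Gamma> e, tgt \<Gamma> e) \<and> v' = (x, src \<Gamma> e)))"

lemma (in group) ostep_flip_same:
  assumes "wf_graph \<Gamma>" "ostep \<Gamma> e s v v'"
  shows "ostep (flip \<Gamma> e) e (\<not> s) v v'"
proof -
  have le: "lab \<Gamma> e \<in> carrier G" using assms by (auto simp: ostep_def wf_graph_def)
  obtain x where x: "x \<in> carrier G" "if s then v = (x, src \<Gamma> e) \<and> v' = (x \<otimes> lab \<Gamma> e, tgt \<Gamma> e)
     else v = (x \<otimes> lab \<Gamma> e, tgt \<Gamma> e) \<and> v' = (x, src \<Gamma> e)" using assms by (auto simp: ostep_def)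
  show ?thesis
    using x assms(2) le unfolding ostep_def
    by (intro conjI bexI[of _ "x \<otimes> lab \<Gamma> e"]) (auto simp: m_assoc)
qed

lemma (in group) ostep_flip_other: "e \<noteq> e' \<Longrightarrow> ostep (flip \<Gamma> e') e s v v' \<longleftrightarrow> ostep \<Gamma> e s v v'"
  by (simp add: ostep_def)

lemma (in group) ostep_reverse: "ostep \<Gamma> e s v v' \<longleftrightarrow> ostep \<Gamma> e (\<not> s) v' v"
  by (auto simp: ostep_def)

lemma (in group) ostepE:
  assumes "ostep \<Gamma> e s v v'"
  obtains x where "e \<in> edges \<Gamma>" "x \<in> carrier G" "s" "v = (x, src \<Gamma> e)" "v' = (x \<otimes> lab \<Gamma> e, tgt \<Gamma> e)"
  | x where "e \<in> edges \<Gamma>" "x \<in> carrier G" "\<not> s" "v = (x \<otimes> lab \<Gamma> e, tgt \<Gamma> e)" "v' = (x, src \<Gamma> e)"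
  using assms unfolding ostep_def by (cases s) auto

lemma (in group) ostep_closed:
  assumes "wf_graph \<Gamma>" "ostep \<Gamma> e s v v'"
  shows "fst v \<in> carrier G" "fst v' \<in> carrier G" "snd v \<in> verts \<Gamma>" "snd v' \<in> verts \<Gamma>" "e \<in> edges \<Gamma>"
  using assms(2) by (cases rule: ostepE; use wf_graphD[OF assms(1)] in force)+

lemma (in group) ostep_conn: "ostep \<Gamma> e s v v' \<Longrightarrow> e \<in> F \<Longrightarrow> (v, v') \<in> conn \<Gamma> F"
  by (erule ostepE) (auto intro: conn_edge conn_sym[OF conn_edge])

context hyp_group
begin

text \<open>The summand 1 per edge makes contraction at a vertex of small valence strictly
  profitable even for labels of length 0; in return, a subdivision costs 1.\<close>

definition cost :: "'a lgraph \<Rightarrow> nat" where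
  "cost \<Gamma> = (\<Sum>e \<in> edges \<Gamma>. len (lab \<Gamma> e) + 1)"

definition minimal_graph :: "'a lgraph \<Rightarrow> 'a set \<Rightarrow> nat \<Rightarrow> bool" where
  "minimal_graph \<Gamma> H r \<longleftrightarrow> carrier_graph \<Gamma> 0 H r \<and>
    (\<forall>\<Gamma>'. carrier_graph \<Gamma>' 0 H r \<longrightarrow> cost \<Gamma> \<le> cost \<Gamma>')"

lemma minimal_graphD: "minimal_graph \<Gamma> H r \<Longrightarrow> carrier_graph \<Gamma> 0 H r" "minimal_graph \<Gamma> H r \<Longrightarrow> wf_graph \<Gamma>"
  by (auto simp: minimal_graph_def carrier_graph_def)

lemma minimal_graph_ex: "carrier_graph \<Gamma> 0 H r \<Longrightarrow> \<exists>\<Gamma>'. minimal_graph \<Gamma>' H r"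
  unfolding minimal_graph_def by (rule ex_has_least_nat)

lemma minimal_flip:
  assumes "minimal_graph \<Gamma> H r" "e \<in> edges \<Gamma>"
  shows "minimal_graph (flip \<Gamma> e) H r"
proof -
  have "lab \<Gamma> e \<in> carrier G" using assms minimal_graphD wf_graphD by blast
  then have "cost (flip \<Gamma> e) = cost \<Gamma>" unfolding cost_def by (intro sum.cong) auto
  then show ?thesis using assms carrier_graph_flip by (simp add: minimal_graph_def)
qed

lemma ostep_dist:
  assumes "wf_graph \<Gamma>" "ostep \<Gamma> e s v v'"
  shows "d (fst v) (fst v') = len (lab \<Gamma> e)"
  using assms(2)
proof (cases rule: ostepE)
  case (1 x)
  with wf_graphD(3)[OF assms(1)] show ?thesis by (simp add: d_mult_right)
next
  case (2 x)
  with wf_graphD(3)[OF assms(1)] d_sym[of "x \<otimes> lab \<Gamma> e" x] show ?thesis by (simp add: d_mult_right)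
qed

lemma cost_remove: "finite (edges \<Gamma>) \<Longrightarrow> e \<in> edges \<Gamma> \<Longrightarrow>
    cost \<Gamma> = len (lab \<Gamma> e) + 1 + (\<Sum>e' \<in> edges \<Gamma> - {e}. len (lab \<Gamma> e') + 1)"
  by (simp add: cost_def sum.remove)

text \<open>Sliding the origin of the traversal from v to u yields a competitor in which only the
  label of e differs; its new length is the distance from u to v'.\<close>

lemma minimal_slide:
  assumes "minimal_graph \<Gamma> H r" "ostep \<Gamma> e s v v'" "(v, u) \<in> conn \<Gamma> F" "F \<subseteq> edges \<Gamma> - {e}"
  shows "d (fst v) (fst v') \<le> d (fst u) (fst v')"
proof -
  have main: "d (fst v) (fst v') \<le> d (fst u) (fst v')"
    if m: "minimal_graph \<Gamma> H r" and o: "ostep \<Gamma> e True v v'" and c: "(v, u) \<in> conn \<Gamma> F" and F: "F \<subseteq> edges \<Gamma> - {e}" for \<Gamma>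
  proof -
    note \<Gamma> = minimal_graphD(1)[OF m] and wf = minimal_graphD(2)[OF m]
    obtain x y k where x: "x \<in> carrier G" "v = (x, src \<Gamma> e)" "v' = (x \<otimes> lab \<Gamma> e, tgt \<Gamma> e)" "e \<in> edges \<Gamma>"
      and u: "u = (y, k)" using o by (cases u) (auto simp: ostep_def)
    have le: "lab \<Gamma> e \<in> carrier G" using wf x wf_graphD by blast
    have FE: "F \<subseteq> edges \<Gamma>" using F by auto
    have y: "y \<in> carrier G" and k: "k \<in> verts \<Gamma>"
      using conn_closed[OF _ FE wf x(1)] conn_vertex[OF _ FE wf wf_graphD(1)[OF wf x(4)]] c x u by auto
    have "((inv y \<otimes> y, k), (inv y \<otimes> x, src \<Gamma> e)) \<in> conn \<Gamma> F"
      by (rule conn_left[OF conn_sym[OF c[unfolded x(2) u]] FE wf]) (use y in simp)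
    then have "((\<one>, k), (inv y \<otimes> x, src \<Gamma> e)) \<in> conn \<Gamma> (edges \<Gamma> - {e})" using conn_mono[OF F] y by auto
    from carrier_graph_slide[OF \<Gamma> x(4) k _ this] x y
    have "cost \<Gamma> \<le> cost (slide \<Gamma> e k (inv y \<otimes> x))" using m by (simp add: minimal_graph_def)
    moreover have "finite (edges \<Gamma>)" using wf by (simp add: wf_graph_def)
    ultimately have "len (lab \<Gamma> e) \<le> len (inv y \<otimes> x \<otimes> lab \<Gamma> e)"
      using x(4) by (simp add: cost_remove[of _ e])
    then show ?thesis
      using x y le ostep_dist[OF wf o] by (simp add: u d_def m_assoc)
  qed
  show ?thesis
  proof (cases s)
    case True
    then show ?thesis using main[OF assms(1) _ assms(3,4)] assms(2) by simp
  next
    case False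
    have wf: "wf_graph \<Gamma>" and e: "e \<in> edges \<Gamma>" using assms minimal_graphD by (auto simp: ostep_def)
    have FE: "F \<subseteq> edges \<Gamma>" using assms(4) by auto
    show ?thesis
      using main[of "flip \<Gamma> e"] minimal_flip[OF assms(1) e] ostep_flip_same[OF wf assms(2)] False
        conn_flip[OF wf e FE] assms(3,4) by simp
  qed
qed

text \<open>Attach a leaf with label g at the origin of e and slide e to its end. The new vertex may
  be placed at any group element, not only on a geodesic.\<close>

lemma subdivide:
  assumes \<Gamma>: "carrier_graph \<Gamma> b H r" and e: "e \<in> edges \<Gamma>" and g: "g \<in> carrier G"
  obtains a k \<Gamma>' where "carrier_graph \<Gamma>' b H r" "a \<notin> edges \<Gamma>"
    "edges \<Gamma>' = insert a (edges \<Gamma>)" "k \<in> verts \<Gamma>'" "src \<Gamma>' = (src \<Gamma>)(a := src \<Gamma> e, e := k)"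
    "tgt \<Gamma>' = (tgt \<Gamma>)(a := k)" "lab \<Gamma>' = (lab \<Gamma>)(a := g, e := inv g \<otimes> lab \<Gamma> e)"
    "((\<one>, k), (inv g, src \<Gamma> e)) \<in> conn \<Gamma>' {a}"
proof -
  have wf: "wf_graph \<Gamma>" using \<Gamma> by (simp add: carrier_graph_def)
  have fin: "finite (edges \<Gamma>)" "finite (verts \<Gamma>)" using wf by (auto simp: wf_graph_def)
  obtain a where a: "a \<notin> edges \<Gamma>" using fin(1) by (metis ex_new_if_finite infinite_UNIV_nat)
  obtain k where k: "k \<notin> verts \<Gamma>" using fin(2) by (metis ex_new_if_finite infinite_UNIV_nat)
  have ae: "a \<noteq> e" using a e by auto
  define \<Gamma>1 where "\<Gamma>1 = add_leaf \<Gamma> a (src \<Gamma> e) k g"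
  have 1: "carrier_graph \<Gamma>1 b H r"
    unfolding \<Gamma>1_def by (rule carrier_graph_add_leaf[OF \<Gamma> a k wf_graphD(1)[OF wf e] g])
  have leaf: "((\<one>, k), (inv g, src \<Gamma> e)) \<in> conn \<Gamma>1 {a}"
    using conn_sym[OF conn_edge[of "inv g" a "{a}" \<Gamma>1]] g by (simp add: \<Gamma>1_def)
  define \<Gamma>2 where "\<Gamma>2 = slide \<Gamma>1 e k (inv g)"
  have "carrier_graph \<Gamma>2 b H r"
    unfolding \<Gamma>2_def
  proof (rule carrier_graph_slide[OF 1])
    have "conn \<Gamma>1 {a} \<subseteq> conn \<Gamma>1 (edges \<Gamma>1 - {e})" by (rule conn_mono) (use ae in \<open>auto simp: \<Gamma>1_def\<close>)
    then show "((\<one>, k), (inv g, src \<Gamma>1 e)) \<in> conn \<Gamma>1 (edges \<Gamma>1 - {e})"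
      using leaf ae by (auto simp: \<Gamma>1_def)
  qed (use e g in \<open>auto simp: \<Gamma>1_def\<close>)
  moreover have "conn \<Gamma>2 {a} = conn \<Gamma>1 {a}" by (rule conn_cong) (use ae in \<open>simp add: \<Gamma>2_def\<close>)
  ultimately show thesis
    using that[of \<Gamma>2 a k] a leaf ae by (simp add: \<Gamma>2_def \<Gamma>1_def fun_upd_twist)
qed

text \<open>The competitor subdivides e at z and slides the origin of e' to the new vertex. Its
  three pieces have the lengths on the right, and the additional edge contributes 1.\<close>

lemma minimal_fold:
  assumes "minimal_graph \<Gamma> H r" "ostep \<Gamma> e s v v'" "ostep \<Gamma> e' s' u u'" "e \<noteq> e'"
    "(v, u) \<in> conn \<Gamma> F" "F \<subseteq> edges \<Gamma> - {e, e'}" and z: "z \<in> carrier G"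
  shows "d (fst v) (fst v') + d (fst u) (fst u') \<le> d (fst v) z + d z (fst v') + d z (fst u') + 1"
proof -
  have main: "d (fst v) (fst v') + d (fst u) (fst u') \<le> d (fst v) z + d z (fst v') + d z (fst u') + 1"
    if m: "minimal_graph \<Gamma> H r" and o: "ostep \<Gamma> e True v v'" and o': "ostep \<Gamma> e' True u u'"
      and c: "(v, u) \<in> conn \<Gamma> F" and F: "F \<subseteq> edges \<Gamma> - {e, e'}" for \<Gamma>
  proof -
    note \<Gamma> = minimal_graphD(1)[OF m] and wf = minimal_graphD(2)[OF m]
    obtain q where q: "q \<in> carrier G" "v = (q, src \<Gamma> e)" "v' = (q \<otimes> lab \<Gamma> e, tgt \<Gamma> e)" "e \<in> edges \<Gamma>"
      using o by (auto simp: ostep_def)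
    obtain q' where q': "q' \<in> carrier G" "u = (q', src \<Gamma> e')" "u' = (q' \<otimes> lab \<Gamma> e', tgt \<Gamma> e')" "e' \<in> edges \<Gamma>"
      using o' by (auto simp: ostep_def)
    have l: "lab \<Gamma> e \<in> carrier G" "lab \<Gamma> e' \<in> carrier G" using wf q q' wf_graphD by blast+
    have fin: "finite (edges \<Gamma>)" using wf by (auto simp: wf_graph_def)
    define g where "g = inv q \<otimes> z"
    have g: "g \<in> carrier G" "inv g = inv z \<otimes> q" using q z by (auto simp: g_def inv_mult_group)
    obtain a k \<Gamma>2 where 2: "carrier_graph \<Gamma>2 0 H r" "a \<notin> edges \<Gamma>"
      "edges \<Gamma>2 = insert a (edges \<Gamma>)" "k \<in> verts \<Gamma>2" "src \<Gamma>2 = (src \<Gamma>)(a := src \<Gamma> e, e := k)"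
      "tgt \<Gamma>2 = (tgt \<Gamma>)(a := k)" "lab \<Gamma>2 = (lab \<Gamma>)(a := g, e := inv g \<otimes> lab \<Gamma> e)"
      "((\<one>, k), (inv g, src \<Gamma> e)) \<in> conn \<Gamma>2 {a}"
      using subdivide[OF \<Gamma> q(4) g(1)] by metis
    have ae: "a \<noteq> e" "a \<noteq> e'" "a \<notin> F" using 2(2) q q' F by auto
    define \<Gamma>3 where "\<Gamma>3 = slide \<Gamma>2 e' k (inv z \<otimes> q')"
    have 3: "carrier_graph \<Gamma>3 0 H r"
      unfolding \<Gamma>3_def
    proof (rule carrier_graph_slide[OF 2(1) _ 2(4)])
      have "((inv z \<otimes> q, src \<Gamma> e), (inv z \<otimes> q', src \<Gamma> e')) \<in> conn \<Gamma> F"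
        using conn_left[OF c[unfolded q(2) q'(2)] _ wf, of "inv z"] F z by auto
      moreover have "conn \<Gamma> F = conn \<Gamma>2 F" by (rule conn_cong) (use F ae in \<open>auto simp: 2\<close>)
      moreover have "conn \<Gamma>2 X \<subseteq> conn \<Gamma>2 (edges \<Gamma>2 - {e'})" if "X = F \<or> X = {a}" for X
        by (rule conn_mono) (use that F ae in \<open>auto simp: 2\<close>)
      ultimately show "((\<one>, k), (inv z \<otimes> q', src \<Gamma>2 e')) \<in> conn \<Gamma>2 (edges \<Gamma>2 - {e'})"
        using 2(8) ae(2) assms(4) unfolding g(2) by (auto simp: 2(5) intro: conn_trans)
    qed (use q' z in \<open>auto simp: 2\<close>)
    have e3: "edges \<Gamma>3 = insert a (edges \<Gamma>)" by (simp add: \<Gamma>3_def 2)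
    have l3: "lab \<Gamma>3 = (lab \<Gamma>)(a := g, e := inv z \<otimes> q \<otimes> lab \<Gamma> e, e' := inv z \<otimes> q' \<otimes> lab \<Gamma> e')"
      using ae assms(4) by (auto simp: \<Gamma>3_def 2 g(2))
    define R where "R = (\<Sum>e'' \<in> edges \<Gamma> - {e, e'}. len (lab \<Gamma> e'') + 1)"
    have E: "edges \<Gamma> = insert e (insert e' (edges \<Gamma> - {e, e'}))" using q q' by auto
    have "cost \<Gamma> = (len (lab \<Gamma> e) + 1) + ((len (lab \<Gamma> e') + 1) + R)"
      unfolding cost_def R_def by (subst E) (use fin assms(4) in \<open>simp\<close>)
    moreover have "cost \<Gamma>3 = (len g + 1) + ((len (inv z \<otimes> q \<otimes> lab \<Gamma> e) + 1) + ((len (inv z \<otimes> q' \<otimes> lab \<Gamma> e') + 1) + R))"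
    proof -
      have "(\<Sum>e'' \<in> edges \<Gamma> - {e, e'}. len (lab \<Gamma>3 e'') + 1) = R"
        unfolding R_def by (rule sum.cong) (use 2(2) in \<open>auto simp: l3\<close>)
      then show ?thesis
        unfolding cost_def e3 by (subst E) (use fin assms(4) ae 2(2) in \<open>simp add: l3\<close>)
    qed
    moreover have "cost \<Gamma> \<le> cost \<Gamma>3" using m 3 by (simp add: minimal_graph_def)
    ultimately have "len (lab \<Gamma> e) + len (lab \<Gamma> e') \<le> len g + len (inv z \<otimes> q \<otimes> lab \<Gamma> e) + len (inv z \<otimes> q' \<otimes> lab \<Gamma> e') + 1"
      by linarith
    moreover have "d (fst v) z = len g" by (simp add: q d_def g_def)
    moreover have "d z (fst v') = len (inv z \<otimes> q \<otimes> lab \<Gamma> e)" "d z (fst u') = len (inv z \<otimes> q' \<otimes> lab \<Gamma> e')"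
      using q q' z l by (auto simp: d_def m_assoc)
    ultimately show ?thesis using ostep_dist[OF wf o] ostep_dist[OF wf o'] by simp
  qed
  have wf: "wf_graph \<Gamma>" and e: "e \<in> edges \<Gamma>" and e': "e' \<in> edges \<Gamma>"
    using assms minimal_graphD by (auto simp: ostep_def)
  have FE: "F \<subseteq> edges \<Gamma>" using assms(6) by auto
  have half: "d (fst v) (fst v') + d (fst u) (fst u') \<le> d (fst v) z + d z (fst v') + d z (fst u') + 1"
    if m: "minimal_graph \<Gamma> H r" and o: "ostep \<Gamma> e True v v'" and o': "ostep \<Gamma> e' s' u u'"
      and c: "(v, u) \<in> conn \<Gamma> F" and F: "F \<subseteq> edges \<Gamma> - {e, e'}" for \<Gamma>
  proof (cases s')
    case True
    then show ?thesis using main[OF m o _ c F] o' by simp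
  next
    case False
    have wf: "wf_graph \<Gamma>" and e': "e' \<in> edges \<Gamma>" using m o' minimal_graphD by (auto simp: ostep_def)
    have FE: "F \<subseteq> edges \<Gamma>" using F by auto
    show ?thesis
      using main[of "flip \<Gamma> e'"] minimal_flip[OF m e'] ostep_flip_other[OF assms(4)]
        ostep_flip_same[OF wf o'] o c F False conn_flip[OF wf e' FE] by auto
  qed
  show ?thesis
  proof (cases s)
    case True
    then show ?thesis using half[OF assms(1) _ assms(3,5,6)] assms(2) by simp
  next
    case False
    show ?thesis
      using half[of "flip \<Gamma> e"] minimal_flip[OF assms(1) e] ostep_flip_other[of e' e]
        ostep_flip_same[OF wf assms(2)] assms(3-6) False conn_flip[OF wf e FE] by auto
  qed
qed

text \<open>Subdivide e at z. The translation by fst u \<otimes> inv (fst v') takes v' to u, which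
  is connected to v and thus to z; so the remaining piece of e can be replaced by a loop at the new
  vertex, going from z to the translate of z.\<close>

lemma minimal_fold_self:
  assumes "minimal_graph \<Gamma> H r" "ostep \<Gamma> e s v v'" "ostep \<Gamma> e (\<not> s) u u'"
    "(v, u) \<in> conn \<Gamma> F" "F \<subseteq> edges \<Gamma> - {e}" and z: "z \<in> carrier G"
  shows "d (fst v) (fst v') \<le> d (fst v) z + d z (fst u \<otimes> inv (fst v') \<otimes> z) + 1"
proof -
  have main: "d (fst v) (fst v') \<le> d (fst v) z + d z (fst u \<otimes> inv (fst v') \<otimes> z) + 1"
    if m: "minimal_graph \<Gamma> H r" and o: "ostep \<Gamma> e True v v'" and o': "ostep \<Gamma> e False u u'"
      and c: "(v, u) \<in> conn \<Gamma> F" and F: "F \<subseteq> edges \<Gamma> - {e}" for \<Gamma>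
  proof -
    note \<Gamma> = minimal_graphD(1)[OF m] and wf = minimal_graphD(2)[OF m]
    obtain q where q: "q \<in> carrier G" "v = (q, src \<Gamma> e)" "v' = (q \<otimes> lab \<Gamma> e, tgt \<Gamma> e)" "e \<in> edges \<Gamma>"
      using o by (auto simp: ostep_def)
    obtain p' where p': "p' \<in> carrier G" "u = (p' \<otimes> lab \<Gamma> e, tgt \<Gamma> e)" "u' = (p', src \<Gamma> e)"
      using o' by (auto simp: ostep_def)
    have l: "lab \<Gamma> e \<in> carrier G" using wf q wf_graphD by blast
    define p q' where "p = q \<otimes> lab \<Gamma> e" and "q' = p' \<otimes> lab \<Gamma> e"
    define h where "h = q' \<otimes> inv p"
    have cc: "p \<in> carrier G" "q' \<in> carrier G" "h \<in> carrier G" using q p' l by (auto simp: p_def q'_def h_def)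
    have fin: "finite (edges \<Gamma>)" using wf by (auto simp: wf_graph_def)
    define g where "g = inv q \<otimes> z"
    have g: "g \<in> carrier G" "inv g = inv z \<otimes> q" using q z by (auto simp: g_def inv_mult_group)
    obtain a k \<Gamma>2 where 2: "carrier_graph \<Gamma>2 0 H r" "a \<notin> edges \<Gamma>"
      "edges \<Gamma>2 = insert a (edges \<Gamma>)" "k \<in> verts \<Gamma>2" "src \<Gamma>2 = (src \<Gamma>)(a := src \<Gamma> e, e := k)"
      "tgt \<Gamma>2 = (tgt \<Gamma>)(a := k)" "lab \<Gamma>2 = (lab \<Gamma>)(a := g, e := inv g \<otimes> lab \<Gamma> e)"
      "((\<one>, k), (inv g, src \<Gamma> e)) \<in> conn \<Gamma>2 {a}"
      using subdivide[OF \<Gamma> q(4) g(1)] by metis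
    have ae: "a \<noteq> e" "a \<notin> F" using 2(2) q F by auto
    have e2: "e \<in> edges \<Gamma>2" using q by (simp add: 2)
    \<comment> \<open>\<open>slide\<close> moves origins, so the end of e is first turned into its
      origin.\<close>
    define \<Gamma>3 where "\<Gamma>3 = flip \<Gamma>2 e"
    have 3: "carrier_graph \<Gamma>3 0 H r" unfolding \<Gamma>3_def by (rule carrier_graph_flip[OF 2(1) e2])
    define \<Gamma>4 where "\<Gamma>4 = slide \<Gamma>3 e k (inv z \<otimes> q')"
    have 4: "carrier_graph \<Gamma>4 0 H r"
      unfolding \<Gamma>4_def
    proof (rule carrier_graph_slide[OF 3])
      have mono: "conn \<Gamma>3 X \<subseteq> conn \<Gamma>3 (edges \<Gamma>3 - {e})" if "X = F \<or> X = {a}" for X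
        by (rule conn_mono) (use that F ae in \<open>auto simp: \<Gamma>3_def 2\<close>)
      have "conn \<Gamma>2 {a} = conn \<Gamma>3 {a}" by (rule conn_cong) (use ae in \<open>auto simp: \<Gamma>3_def 2\<close>)
      then have "((\<one>, k), (inv z \<otimes> q, src \<Gamma> e)) \<in> conn \<Gamma>3 (edges \<Gamma>3 - {e})"
        using 2(8) mono g(2) by auto
      moreover have "conn \<Gamma> F = conn \<Gamma>3 F" by (rule conn_cong) (use F ae in \<open>auto simp: \<Gamma>3_def 2\<close>)
      then have "((inv z \<otimes> q, src \<Gamma> e), (inv z \<otimes> q', tgt \<Gamma> e)) \<in> conn \<Gamma>3 (edges \<Gamma>3 - {e})"
        using conn_left[OF c[unfolded q(2) p'(2)] _ wf, of "inv z"] F z mono by (auto simp: q'_def)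
      ultimately have "((\<one>, k), (inv z \<otimes> q', tgt \<Gamma> e)) \<in> conn \<Gamma>3 (edges \<Gamma>3 - {e})"
        by (rule conn_trans)
      then show "((\<one>, k), (inv z \<otimes> q', src \<Gamma>3 e)) \<in> conn \<Gamma>3 (edges \<Gamma>3 - {e})"
        using ae by (simp add: \<Gamma>3_def 2)
    qed (use q z cc in \<open>auto simp: \<Gamma>3_def 2\<close>)
    have e4: "edges \<Gamma>4 = insert a (edges \<Gamma>)" by (simp add: \<Gamma>4_def \<Gamma>3_def 2)
    define c where "c = inv z \<otimes> q' \<otimes> inv (inv z \<otimes> q \<otimes> lab \<Gamma> e)"
    have l4: "lab \<Gamma>4 = (lab \<Gamma>)(a := g, e := c)"
      using ae by (auto simp: \<Gamma>4_def \<Gamma>3_def 2 g(2) c_def)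
    have "c = inv z \<otimes> (h \<otimes> z)"
      using z q l cc by (simp add: c_def h_def p_def inv_mult_group m_assoc)
    then have dc: "d z (h \<otimes> z) = len c" by (simp add: d_def)
    define R where "R = (\<Sum>e'' \<in> edges \<Gamma> - {e}. len (lab \<Gamma> e'') + 1)"
    have "cost \<Gamma> = (len (lab \<Gamma> e) + 1) + R"
      unfolding R_def by (rule cost_remove[OF fin(1) q(4)])
    moreover have "cost \<Gamma>4 = (len g + 1) + ((len c + 1) + R)"
    proof -
      have "(\<Sum>e'' \<in> edges \<Gamma> - {e}. len (lab \<Gamma>4 e'') + 1) = R"
        unfolding R_def by (rule sum.cong) (use 2(2) in \<open>auto simp: l4\<close>)
      then show ?thesis
        using cost_remove[of \<Gamma>4 a] sum.remove[OF fin(1) q(4), of "\<lambda>e. len (lab \<Gamma>4 e) + 1"] fin ae 2(2)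
        by (simp add: e4 l4)
    qed
    moreover have "cost \<Gamma> \<le> cost \<Gamma>4" using m 4 by (simp add: minimal_graph_def)
    ultimately have "len (lab \<Gamma> e) \<le> len g + len c + 1" by linarith
    moreover have "d (fst v) z = len g" by (simp add: q d_def g_def)
    moreover have "fst u \<otimes> inv (fst v') \<otimes> z = h \<otimes> z" by (simp add: h_def q p' p_def q'_def)
    ultimately show ?thesis using ostep_dist[OF wf o] dc by simp
  qed
  show ?thesis
  proof (cases s)
    case True
    with main assms show ?thesis by auto
  next
    case False
    have wf: "wf_graph \<Gamma>" and e: "e \<in> edges \<Gamma>" using assms minimal_graphD by (auto simp: ostep_def)
    have FE: "F \<subseteq> edges \<Gamma>" using assms(5) by auto
    show ?thesis
      using main[of "flip \<Gamma> e"] minimal_flip[OF assms(1) e] ostep_flip_same[OF wf assms(2)]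
        ostep_flip_same[OF wf assms(3)] False conn_flip[OF wf e FE] assms(4,5) by simp
  qed
qed

section \<open>The size of minimal graphs\<close>

lemma length_contract:
  assumes wf: "wf_graph \<Gamma>" and f: "f \<in> edges \<Gamma>" and e: "e \<in> edges \<Gamma>"
  shows "len (lab (contract \<Gamma> f) e) \<le> len (lab \<Gamma> e) + len (lab \<Gamma> f) *
    (of_bool (src \<Gamma> e = tgt \<Gamma> f) + of_bool (tgt \<Gamma> e = tgt \<Gamma> f))"
proof -
  note l = wf_graphD(3)[OF wf e] wf_graphD(3)[OF wf f]
  define a where "a = (if src \<Gamma> e = tgt \<Gamma> f then lab \<Gamma> f else \<one>)"
  define c where "c = (if tgt \<Gamma> e = tgt \<Gamma> f then inv (lab \<Gamma> f) else \<one>)"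
  have ac: "a \<in> carrier G" "c \<in> carrier G" using l by (auto simp: a_def c_def)
  have "len (a \<otimes> lab \<Gamma> e \<otimes> c) \<le> len a + len (lab \<Gamma> e) + len c"
    using len_mult[of "a \<otimes> lab \<Gamma> e" c] len_mult[of a "lab \<Gamma> e"] ac l by simp
  moreover have "len a = len (lab \<Gamma> f) * of_bool (src \<Gamma> e = tgt \<Gamma> f)"
    "len c = len (lab \<Gamma> f) * of_bool (tgt \<Gamma> e = tgt \<Gamma> f)"
    using l by (auto simp: a_def c_def)
  ultimately show ?thesis by (simp add: a_def c_def algebra_simps)
qed

text \<open>If the valence of \<open>k\<close> were at most two, contracting an edge at \<open>k\<close> would decrease the cost.\<close>

lemma minimal_valence:
  assumes m: "minimal_graph \<Gamma> H r" and k: "k \<in> verts \<Gamma>" "k \<noteq> 0"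
  shows "3 \<le> (\<Sum>e \<in> edges \<Gamma>. of_bool (src \<Gamma> e = k) + of_bool (tgt \<Gamma> e = k) :: nat)"
proof -
  have main: "3 \<le> (\<Sum>e \<in> edges \<Gamma>. of_bool (src \<Gamma> e = k) + of_bool (tgt \<Gamma> e = k) :: nat)"
    if m: "minimal_graph \<Gamma> H r" and f: "f \<in> edges \<Gamma>" "tgt \<Gamma> f = k" "src \<Gamma> f \<noteq> k" for \<Gamma> f
  proof (rule ccontr)
    define v :: "nat \<Rightarrow> nat" where "v e = of_bool (src \<Gamma> e = k) + of_bool (tgt \<Gamma> e = k)" for e
    assume "\<not> ?thesis"
    then have sm: "(\<Sum>e \<in> edges \<Gamma>. v e) \<le> 2" by (simp add: v_def)
    note \<Gamma> = minimal_graphD(1)[OF m] and wf = minimal_graphD(2)[OF m]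
    have fin: "finite (edges \<Gamma>)" using wf by (simp add: wf_graph_def)
    have "v f = 1" using f by (simp add: v_def)
    \<comment> \<open>f is not a loop and uses one of at most two edge ends at k, so the label of f
      is added to at most one other end.\<close>
    then have sm': "(\<Sum>e \<in> edges \<Gamma> - {f}. v e) \<le> 1" using sm sum.remove[OF fin f(1), of v] by simp
    have "cost (contract \<Gamma> f) = (\<Sum>e \<in> edges \<Gamma> - {f}. len (lab (contract \<Gamma> f) e) + 1)"
      by (simp add: cost_def)
    also have "\<dots> \<le> (\<Sum>e \<in> edges \<Gamma> - {f}. (len (lab \<Gamma> e) + 1) + len (lab \<Gamma> f) * v e)"
      by (rule sum_mono) (use length_contract[OF wf f(1)] f in \<open>simp add: v_def\<close>)
    also have "\<dots> = (\<Sum>e \<in> edges \<Gamma> - {f}. len (lab \<Gamma> e) + 1) + len (lab \<Gamma> f) * (\<Sum>e \<in> edges \<Gamma> - {f}. v e)"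
      by (simp only: sum.distrib sum_distrib_left)
    also have "\<dots> \<le> (\<Sum>e \<in> edges \<Gamma> - {f}. len (lab \<Gamma> e) + 1) + len (lab \<Gamma> f)"
      using mult_le_mono2[OF sm', of "len (lab \<Gamma> f)"] by simp
    also have "\<dots> < cost \<Gamma>" using cost_remove[OF fin f(1)] by simp
    finally have "cost (contract \<Gamma> f) < cost \<Gamma>" .
    moreover have "carrier_graph (contract \<Gamma> f) 0 H r"
      by (rule carrier_graph_contract[OF \<Gamma>]) (use f k in auto)
    ultimately show False using m by (auto simp: minimal_graph_def not_less[symmetric])
  qed
  note \<Gamma> = minimal_graphD(1)[OF m] and wf = minimal_graphD(2)[OF m]
  have "\<exists>f \<in> edges \<Gamma>. \<not> (src \<Gamma> f = k \<longleftrightarrow> tgt \<Gamma> f = k)"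
  proof (rule ccontr)
    assume "\<not> ?thesis"
    then have 1: "src \<Gamma> f = k \<longleftrightarrow> tgt \<Gamma> f = k" if "f \<in> edges \<Gamma>" for f using that by blast
    obtain x where "((\<one>, 0), (x, k)) \<in> conn \<Gamma> (edges \<Gamma>)"
      using \<Gamma> k unfolding carrier_graph_def by blast
    then have "snd (x, k) \<noteq> k"
      by (induction rule: conn_induct) (use 1 k in auto)
    then show False by simp
  qed
  then obtain f where f: "f \<in> edges \<Gamma>" "\<not> (src \<Gamma> f = k \<longleftrightarrow> tgt \<Gamma> f = k)" by blast
  show ?thesis
  proof (cases "tgt \<Gamma> f = k")
    case True
    with f main[OF m f(1)] show ?thesis by blast
  next
    case False
    have "3 \<le> (\<Sum>e \<in> edges \<Gamma>. of_bool (src (flip \<Gamma> f) e = k) + of_bool (tgt (flip \<Gamma> f) e = k) :: nat)"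
      using main[of "flip \<Gamma> f" f] minimal_flip[OF m f(1)] f False by simp
    also have "\<dots> = (\<Sum>e \<in> edges \<Gamma>. of_bool (src \<Gamma> e = k) + of_bool (tgt \<Gamma> e = k))"
      by (rule sum.cong) auto
    finally show ?thesis .
  qed
qed

text \<open>Counting edge ends, 3 (V - 1) <= 2 E, where the base is exempt because it must not be
  contracted away; combine this with E <= V + r - 1.\<close>

lemma minimal_card:
  assumes m: "minimal_graph \<Gamma> H r"
  shows "card (verts \<Gamma>) \<le> 2 * r + 1" "card (edges \<Gamma>) \<le> 3 * r"
proof -
  note \<Gamma> = minimal_graphD(1)[OF m] and wf = minimal_graphD(2)[OF m]
  have fin: "finite (edges \<Gamma>)" "finite (verts \<Gamma>)" and z: "0 \<in> verts \<Gamma>"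
    and ev: "card (edges \<Gamma>) + 1 \<le> card (verts \<Gamma>) + r"
    using wf \<Gamma> by (auto simp: wf_graph_def carrier_graph_def)
  define v :: "nat \<Rightarrow> nat \<Rightarrow> nat" where "v e k = of_bool (src \<Gamma> e = k) + of_bool (tgt \<Gamma> e = k)" for e k
  have "3 * (card (verts \<Gamma>) - 1) = (\<Sum>k \<in> verts \<Gamma> - {0}. 3)" using z fin by simp
  also have "\<dots> \<le> (\<Sum>k \<in> verts \<Gamma> - {0}. \<Sum>e \<in> edges \<Gamma>. v e k)"
    by (rule sum_mono) (use minimal_valence[OF m] in \<open>auto simp: v_def\<close>)
  also have "\<dots> \<le> (\<Sum>k \<in> verts \<Gamma>. \<Sum>e \<in> edges \<Gamma>. v e k)" by (rule sum_mono2) (use fin in auto)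
  also have "\<dots> = (\<Sum>e \<in> edges \<Gamma>. \<Sum>k \<in> verts \<Gamma>. v e k)" by (rule sum.swap)
  also have "\<dots> = (\<Sum>e \<in> edges \<Gamma>. 2)"
  proof (rule sum.cong[OF refl])
    fix e assume "e \<in> edges \<Gamma>"
    then have "src \<Gamma> e \<in> verts \<Gamma>" "tgt \<Gamma> e \<in> verts \<Gamma>" using wf wf_graphD by blast+
    then show "(\<Sum>k \<in> verts \<Gamma>. v e k) = 2"
      using fin by (simp add: v_def sum.distrib of_bool_def sum.delta sum.delta')
  qed
  finally have "3 * (card (verts \<Gamma>) - 1) \<le> 2 * card (edges \<Gamma>)" by simp
  moreover have "card (verts \<Gamma>) \<ge> 1" using z fin by (metis card_0_eq empty_iff less_one not_le)
  ultimately show "card (verts \<Gamma>) \<le> 2 * r + 1" "card (edges \<Gamma>) \<le> 3 * r" using ev by linarith+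
qed

end

section \<open>Long edges in minimal carrier graphs\<close>

context hyp_group
begin

section \<open>Estimates with Gromov products\<close>

lemma gp_le_dist: "x \<in> carrier G \<Longrightarrow> y \<in> carrier G \<Longrightarrow> w \<in> carrier G \<Longrightarrow> gp x y w \<le> d w x"
  "x \<in> carrier G \<Longrightarrow> y \<in> carrier G \<Longrightarrow> w \<in> carrier G \<Longrightarrow> gp x y w \<le> d w y"
  using d_triangle[of y x w] d_triangle[of x y w] d_sym[of x y] d_sym[of x w] d_sym[of y w]
  by (auto simp: gp_def)

lemma gp_perturb: "x \<in> carrier G \<Longrightarrow> x' \<in> carrier G \<Longrightarrow> y \<in> carrier G \<Longrightarrow> w \<in> carrier G \<Longrightarrow>
    gp x y w \<le> gp x' y w + d x x'"
  using d_triangle[of x x' w] d_triangle[of x' x y] d_sym[of x x'] by (simp add: gp_def field_simps)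

lemma gp_hyp3:
  "\<lbrakk>x \<in> carrier G; y \<in> carrier G; z \<in> carrier G; u \<in> carrier G; w \<in> carrier G;
    t \<le> gp x y w; t \<le> gp y z w; t \<le> gp z u w\<rbrakk> \<Longrightarrow> t - 2 * \<delta> \<le> gp x u w"
  using gp_hyp[of x y z w] gp_hyp[of x z u w] \<delta>_nonneg by (smt (verit))

text \<open>Up to the time given by the product, the geodesics from q to p and to
  \<open>q \<otimes> a\<close> are 4 \<delta> close, and the second one is Q-close to the translate
  of A. As q is nearest to p, that time is at most 4 \<delta> + Q; rounding it to an integer adds
  1.\<close>

lemma gp_projection:
  assumes A: "A \<subseteq> carrier G" "qconvex Q A" "a \<in> A" and qp: "q \<in> carrier G" "p \<in> carrier G"
    and closest: "\<And>a'. a' \<in> A \<Longrightarrow> d q p \<le> d (q \<otimes> a') p"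
  shows "gp (q \<otimes> a) p q \<le> 4 * \<delta> + Q + 1"
proof (rule ccontr)
  assume neg: "\<not> ?thesis"
  have a: "a \<in> carrier G" using A by auto
  define y where "y = q \<otimes> a"
  have y: "y \<in> carrier G" using a qp by (simp add: y_def)
  have "gp y p q \<ge> 0" using d_triangle[OF y qp(1) qp(2)] d_sym[OF y qp(1)] d_sym[OF qp] by (simp add: gp_def)
  define t where "t = nat \<lfloor>gp y p q\<rfloor>"
  have t: "real t \<le> gp y p q" "gp y p q < real t + 1" using \<open>gp y p q \<ge> 0\<close> by (auto simp: t_def)
  have ty: "real t \<le> d q y" "real t \<le> d q p" using gp_le_dist[OF y qp(2,1)] t by auto
  obtain z where z: "z \<in> carrier G" "d q z = t" "d z p = d q p - t" using between_ex[OF qp ty(2)] .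
  obtain z' where z': "z' \<in> carrier G" "d q z' = t" "d z' y = d q y - t" using between_ex[OF qp(1) y ty(1)] .
  have "gp z z' q \<ge> t - 2 * \<delta>"
  proof (rule gp_hyp3[OF z(1) qp(2) y z'(1) qp(1)])
    show "real t \<le> gp z p q" using z d_sym[OF z(1) qp(1)] d_sym[OF qp] by (simp add: gp_def)
    show "real t \<le> gp p y q" using t gp_sym[OF qp(2) y] by simp
    show "real t \<le> gp y z' q"
      using z' d_sym[OF z'(1) qp(1)] d_sym[OF y qp(1)] d_sym[OF y z'(1)] by (simp add: gp_def)
  qed
  then have zz: "d z z' \<le> 4 * \<delta>"
    using z z' d_sym[OF z(1) qp(1)] d_sym[OF z'(1) qp(1)] by (simp add: gp_def)
  define z1 where "z1 = inv q \<otimes> z'"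
  have z1: "z1 \<in> carrier G" "z' = q \<otimes> z1" using qp z' by (auto simp: z1_def)
  have "d \<one> z1 = d q z'" "d z1 a = d z' y" "d \<one> a = d q y"
    using d_left[OF qp(1) one_closed z1(1)] d_left[OF qp(1) z1(1) a] d_left[OF qp(1) one_closed a] qp z1
    by (auto simp: y_def)
  then obtain a' where a': "a' \<in> A" "d z1 a' \<le> Q" using A z1 z' unfolding qconvex_def by force
  have a'c: "a' \<in> carrier G" "q \<otimes> a' \<in> carrier G" using a' A qp by auto
  have "d z' (q \<otimes> a') \<le> Q" using a' z1 qp a'c by simp
  moreover have "d q p \<le> d (q \<otimes> a') p" using closest a' by blast
  ultimately have "d q p \<le> Q + 4 * \<delta> + (d q p - t)"
    using d_triangle[OF a'c(2) z'(1) qp(2)] d_triangle[OF z'(1) z(1) qp(2)] zz z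
      d_sym[OF a'c(2) z'(1)] d_sym[OF z(1) z'(1)] by linarith
  with neg t show False by (simp add: y_def)
qed

text \<open>With bounded turns at q and q' and a long side between them, hyperbolicity keeps p
  behind q as seen from q', so the path p, q, q', p' is almost geodesic.\<close>

lemma two_projections:
  assumes c: "q \<in> carrier G" "q' \<in> carrier G" "p \<in> carrier G" "p' \<in> carrier G"
    and D: "gp q' p q \<le> D" "gp q p' q' \<le> D" "d q q' > 2 * D + \<delta>"
  shows "d q p + d q' p' + d q q' - 4 * D - 2 * \<delta> \<le> d p p'"
proof -
  have 1: "d p q' \<ge> d q p + d q q' - 2 * D"
    using D(1) d_sym[OF c(1,2)] d_sym[OF c(1,3)] d_sym[OF c(2,3)] by (simp add: gp_def)
  have "gp p q q' = d q q' - gp q' p q"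
    using d_sym[OF c(1,2)] d_sym[OF c(1,3)] d_sym[OF c(2,3)] by (simp add: gp_def field_simps)
  then have "gp p q q' > D + \<delta>" using D by linarith
  moreover have "gp q p' q' \<ge> min (gp q p q') (gp p p' q') - \<delta>"
    by (rule gp_hyp) (use c in auto)
  ultimately have "gp p p' q' \<le> D + \<delta>"
    using D(2) gp_sym[OF c(1,3)] by (smt (verit))
  then show ?thesis using 1 d_sym[OF c(2,4)] by (simp add: gp_def)
qed

text \<open>Measured from q instead of q', distances along the second side change by at most B;
  \<open>gp_hyp3\<close> along z, p, p', z' then gives a product close to t.\<close>

lemma near_fellow:
  assumes c: "q \<in> carrier G" "q' \<in> carrier G" "p \<in> carrier G" "p' \<in> carrier G" "z \<in> carrier G" "z' \<in> carrier G"
    and B: "d q q' \<le> B" and t: "t \<le> gp p p' q - B"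
    and z: "d q z = t" "d z p = d q p - t" and z': "d q' z' = t" "d z' p' = d q' p' - t"
  shows "d z z' \<le> 3 * B + 4 * \<delta>"
proof -
  note s = d_sym[OF c(1,2)] d_sym[OF c(5,1)] d_sym[OF c(6,1)] d_sym[OF c(3,1)] d_sym[OF c(4,1)]
    d_sym[OF c(4,6)] d_sym[OF c(4,3)]
  have B0: "0 \<le> B" using B d_nonneg[of q q'] by linarith
  have 1: "d q z' \<le> t + B" "d q z' \<ge> t - B" "d q p' \<ge> d q' p' - B"
    using d_triangle[OF c(1,2,6)] d_triangle[OF c(2,1,6)] d_triangle[OF c(2,1,4)] z' B s by linarith+
  have "t - B - 2 * \<delta> \<le> gp z z' q"
  proof (rule gp_hyp3[OF c(5,3,4,6,1)])
    show "t - B \<le> gp z p q" using z s B0 by (simp add: gp_def)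
    show "t - B \<le> gp p p' q" using t B0 by simp
    show "t - B \<le> gp p' z' q" using z' s 1 by (simp add: gp_def)
  qed
  then show ?thesis using z 1 s by (simp add: gp_def)
qed

text \<open>The sets R n of vertices joined to i by a label of length at most n * N grow until they
  stabilise, after at most as many steps as there are vertices. The path ends at some lift of i, not
  necessarily at the given one.\<close>

lemma component_near:
  assumes wf: "wf_graph \<Gamma>" and F: "F \<subseteq> edges \<Gamma>" "\<And>e. e \<in> F \<Longrightarrow> len (lab \<Gamma> e) \<le> N"
    and i: "i \<in> verts \<Gamma>" and c: "((x, i), (y, j)) \<in> conn \<Gamma> F"
  shows "\<exists>g \<in> carrier G. ((\<one>, j), (g, i)) \<in> conn \<Gamma> F \<and> len g \<le> card (verts \<Gamma>) * N"
proof -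
  define R where "R n = {j \<in> verts \<Gamma>. \<exists>g \<in> carrier G. ((\<one>, j), (g, i)) \<in> conn \<Gamma> F \<and> len g \<le> n * N}" for n
  have fin: "finite (verts \<Gamma>)" using wf by (simp add: wf_graph_def)
  have Ri: "i \<in> R n" for n using i by (auto simp: R_def intro!: bexI[of _ \<one>])
  have mono: "R n \<subseteq> R (Suc n)" for n by (fastforce simp: R_def)
  have finR: "finite (R n)" "R n \<subseteq> verts \<Gamma>" for n using fin by (auto simp: R_def)
  have "\<exists>n \<le> card (verts \<Gamma>). R n = R (Suc n)"
  proof (rule ccontr)
    assume neg: "\<not> ?thesis"
    have "n \<le> Suc (card (verts \<Gamma>)) \<Longrightarrow> n + 1 \<le> card (R n)" for n
    proof (induction n)
      case 0
      then show ?case using Ri finR by (metis Suc_eq_plus1 Suc_leI add_0 card_gt_0_iff empty_iff)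
    next
      case (Suc n)
      then have "R n \<noteq> R (Suc n)" using neg by auto
      then have "card (R n) < card (R (Suc n))" using mono[of n] finR by (intro psubset_card_mono) auto
      with Suc show ?case by simp
    qed
    from this[of "card (verts \<Gamma>)"] card_mono[OF fin finR(2), of "card (verts \<Gamma>)"] show False by simp
  qed
  then obtain n where n: "n \<le> card (verts \<Gamma>)" "R n = R (Suc n)" by blast
  have "snd (y, j) \<in> R n"
    using c
  proof (induction rule: conn_induct)
    case (step z e)
    note l = wf_graphD[OF wf subsetD[OF F(1) step(2)]]
    have le: "len (lab \<Gamma> e) \<le> N" using F step by blast
    have e: "((\<one>, src \<Gamma> e), (lab \<Gamma> e, tgt \<Gamma> e)) \<in> conn \<Gamma> F"
      using conn_edge[OF one_closed step(2), of \<Gamma>] l by simp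
    have "tgt \<Gamma> e \<in> R (Suc n)" if "src \<Gamma> e \<in> R n"
    proof -
      obtain g where g: "g \<in> carrier G" "((\<one>, src \<Gamma> e), (g, i)) \<in> conn \<Gamma> F" "len g \<le> n * N"
        using \<open>src \<Gamma> e \<in> R n\<close> by (auto simp: R_def)
      have "((lab \<Gamma> e, tgt \<Gamma> e), (g, i)) \<in> conn \<Gamma> F" using e g conn_sym conn_trans by blast
      from conn_left[OF this F(1) wf, of "inv (lab \<Gamma> e)"]
      have "((\<one>, tgt \<Gamma> e), (inv (lab \<Gamma> e) \<otimes> g, i)) \<in> conn \<Gamma> F" using l by simp
      moreover have "len (inv (lab \<Gamma> e) \<otimes> g) \<le> Suc n * N"
        using len_mult[of "inv (lab \<Gamma> e)" g] l g le by simp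
      ultimately show ?thesis using l g by (auto simp: R_def intro!: bexI[of _ "inv (lab \<Gamma> e) \<otimes> g"])
    qed
    moreover have "src \<Gamma> e \<in> R (Suc n)" if "tgt \<Gamma> e \<in> R n"
    proof -
      obtain g where g: "g \<in> carrier G" "((\<one>, tgt \<Gamma> e), (g, i)) \<in> conn \<Gamma> F" "len g \<le> n * N"
        using \<open>tgt \<Gamma> e \<in> R n\<close> by (auto simp: R_def)
      from conn_left[OF g(2) F(1) wf, of "lab \<Gamma> e"]
      have "((\<one>, src \<Gamma> e), (lab \<Gamma> e \<otimes> g, i)) \<in> conn \<Gamma> F" using l e conn_trans by auto
      moreover have "len (lab \<Gamma> e \<otimes> g) \<le> Suc n * N"
        using len_mult[of "lab \<Gamma> e" g] l g le by simp
      ultimately show ?thesis using l g by (auto simp: R_def intro!: bexI[of _ "lab \<Gamma> e \<otimes> g"])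
    qed
    ultimately show ?case using n(2) by auto
  qed (use Ri in simp)
  then obtain g where "g \<in> carrier G" "((\<one>, j), (g, i)) \<in> conn \<Gamma> F" "len g \<le> n * N" by (auto simp: R_def)
  moreover have "n * N \<le> card (verts \<Gamma>) * N" using n by simp
  ultimately show ?thesis by (meson le_trans)
qed

text \<open>Schreier generators: with short paths \<gamma> j from i to the vertices j of its
  component and \<gamma> i = \<one>, every loop is a product of elements \<gamma> (src e) \<otimes>
  lab e \<otimes> inv (\<gamma> (tgt e)) and inverses, of length at most C + N + C.\<close>

lemma loops_generated:
  assumes wf: "wf_graph \<Gamma>" and F: "F \<subseteq> edges \<Gamma>" "\<And>e. e \<in> F \<Longrightarrow> len (lab \<Gamma> e) \<le> N"
    and i: "i \<in> verts \<Gamma>" and C: "card (verts \<Gamma>) * N \<le> C"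
  shows "loops \<Gamma> F i = generate G (loops \<Gamma> F i \<inter> {g. len g \<le> 2 * C + N})"
proof
  define X where "X = loops \<Gamma> F i \<inter> {g. len g \<le> 2 * C + N}"
  note sub = subgroup_loops[OF wf F(1), of i]
  show "generate G X \<subseteq> loops \<Gamma> F i" using generate_subgroup_incl[OF _ sub, of X] by (simp add: X_def)
  define good where "good j g \<longleftrightarrow> g \<in> carrier G \<and> ((\<one>, i), (g, j)) \<in> conn \<Gamma> F \<and> len g \<le> C \<and> (j = i \<longrightarrow> g = \<one>)" for j g
  define \<gamma> where "\<gamma> j = (SOME g. good j g)" for j
  have \<gamma>: "good j (\<gamma> j)" if c: "((\<one>, i), (y, j)) \<in> conn \<Gamma> F" for y j
  proof -
    have "\<exists>g. good j g"
    proof (cases "j = i")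
      case True
      then show ?thesis by (intro exI[of _ \<one>]) (simp add: good_def)
    next
      case False
      obtain g where g: "g \<in> carrier G" "((\<one>, j), (g, i)) \<in> conn \<Gamma> F" "len g \<le> card (verts \<Gamma>) * N"
        using component_near[OF wf F i c] by blast
      from conn_left[OF g(2) F(1) wf, of "inv g"]
      have "((\<one>, i), (inv g, j)) \<in> conn \<Gamma> F" using g conn_sym by simp
      with g C False have "good j (inv g)" by (simp add: good_def)
      then show ?thesis by blast
    qed
    then show ?thesis unfolding \<gamma>_def by (rule someI_ex)
  qed
  have Xc: "X \<subseteq> carrier G" using subgroup.subset[OF sub] by (auto simp: X_def)
  have gs: "subgroup (generate G X) G" by (rule generate_is_subgroup[OF Xc])
  show "loops \<Gamma> F i \<subseteq> generate G X"
  proof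
    fix x assume x: "x \<in> loops \<Gamma> F i"
    then have "((\<one>, i), (x, i)) \<in> conn \<Gamma> F" by (simp add: loops_def)
    then have "((\<one>, i), (x, i)) \<in> conn \<Gamma> F \<and> fst (x, i) \<otimes> inv (\<gamma> (snd (x, i))) \<in> generate G X"
    proof (induction rule: conn_induct)
      case refl
      show ?case using \<gamma>[of \<one> i] generate.one by (simp add: good_def)
    next
      case (step y e)
      note l = wf_graphD[OF wf subsetD[OF F(1) step(2)]]
      have e: "((y, src \<Gamma> e), (y \<otimes> lab \<Gamma> e, tgt \<Gamma> e)) \<in> conn \<Gamma> F" by (rule conn_edge[OF step])
      have eq: "((\<one>, i), (y, src \<Gamma> e)) \<in> conn \<Gamma> F \<longleftrightarrow> ((\<one>, i), (y \<otimes> lab \<Gamma> e, tgt \<Gamma> e)) \<in> conn \<Gamma> F"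
        using e conn_sym conn_trans by blast
      have "y \<otimes> inv (\<gamma> (src \<Gamma> e)) \<in> generate G X \<longleftrightarrow> y \<otimes> lab \<Gamma> e \<otimes> inv (\<gamma> (tgt \<Gamma> e)) \<in> generate G X"
        if c: "((\<one>, i), (y, src \<Gamma> e)) \<in> conn \<Gamma> F"
      proof -
        define g g' where "g = \<gamma> (src \<Gamma> e)" and "g' = \<gamma> (tgt \<Gamma> e)"
        have g: "good (src \<Gamma> e) g" "good (tgt \<Gamma> e) g'"
          using \<gamma>[OF c] \<gamma>[of "y \<otimes> lab \<Gamma> e" "tgt \<Gamma> e"] eq c by (auto simp: g_def g'_def)
        then have gc: "g \<in> carrier G" "g' \<in> carrier G" by (auto simp: good_def)
        define k where "k = g \<otimes> lab \<Gamma> e \<otimes> inv g'"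
        have "((g, src \<Gamma> e), (g \<otimes> lab \<Gamma> e, tgt \<Gamma> e)) \<in> conn \<Gamma> F" by (rule conn_edge[OF gc(1) step(2)])
        then have 1: "((\<one>, i), (g \<otimes> lab \<Gamma> e, tgt \<Gamma> e)) \<in> conn \<Gamma> F" using conn_trans g(1) unfolding good_def by blast
        have "((k \<otimes> \<one>, i), (k \<otimes> g', tgt \<Gamma> e)) \<in> conn \<Gamma> F"
          using g(2) gc l by (intro conn_left[OF _ F(1) wf]) (auto simp: good_def k_def)
        then have "((k, i), (g \<otimes> lab \<Gamma> e, tgt \<Gamma> e)) \<in> conn \<Gamma> F" using gc l by (simp add: k_def m_assoc)
        then have "((\<one>, i), (k, i)) \<in> conn \<Gamma> F" using 1 conn_sym conn_trans by blast
        moreover have "len k \<le> 2 * C + N"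
          using len_mult[of "g \<otimes> lab \<Gamma> e" "inv g'"] len_mult[of g "lab \<Gamma> e"] gc l g F(2)[OF step(2)]
          by (simp add: k_def good_def)
        ultimately have k: "k \<in> generate G X" "k \<in> carrier G"
          using gc l by (auto simp: X_def loops_def k_def intro!: generate.incl)
        have "y \<otimes> lab \<Gamma> e \<otimes> inv g' = (y \<otimes> inv g) \<otimes> k"
          "y \<otimes> inv g = (y \<otimes> lab \<Gamma> e \<otimes> inv g') \<otimes> inv k"
          using step gc l by (simp_all add: k_def m_assoc inv_mult_group)
        then show ?thesis
          using subgroup.m_closed[OF gs] subgroup.m_inv_closed[OF gs] k unfolding g_def g'_def by metis
      qed
      with eq show ?case by auto
    qed
    moreover have "\<gamma> i = \<one>" using \<gamma>[of \<one> i] by (simp add: good_def)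
    ultimately show "x \<in> generate G X" using x by (simp add: loops_def)
  qed
qed

end

section \<open>The constants that determine the gap\<close>

locale gap_constants = hyp_group +
  fixes r N :: nat and Q L :: real
  assumes Q_nonneg: "0 \<le> Q" and L_nonneg: "0 \<le> L"
begin

text \<open>Components of short edges stay \<open>C\<close>-close to orbits of their stabilizers. \<open>Da\<close> measures by how much
  a long edge fails to be perpendicular to such a component. Two long edges leaving a component at
  distance more than \<open>B\<close> diverge by hyperbolicity alone; otherwise they fellow travel for time less
  than \<open>B + t0\<close>.\<close>

definition C :: nat where "C = (2 * r + 1) * N"
definition Da :: real where "Da = 4 * \<delta> + Q + 1 + C"
definition B :: real where "B = 2 * Da + \<delta>"
definition Dz :: real where "Dz = 3 * B + 4 * \<delta>"
text \<open>One more than the size of a ball, for the pigeonhole argument in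
  \<open>Mb_power\<close>.\<close>

definition Mb :: nat where "Mb = card {g \<in> carrier G. len g \<le> nat \<lfloor>B\<rfloor>} + 1"
definition t0 :: nat where "t0 = nat \<lceil>Dz + Mb * Dz + 4 * Da + 2 * \<delta>\<rceil> + 2"
text \<open>The losses in the two cases of \<open>divergence\<close>: 4 B + 2 t0 for close origins,
  4 Da + 2 \<delta> for distant ones.\<close>

definition Db :: real where "Db = 4 * B + 2 * t0 + 4 * Da + 2 * \<delta>"
text \<open>Dominates Da, the bound at the first long edge of a path, and Db / 2 + \<delta>, the
  bound reproduced at each later one.\<close>

definition D' :: real where "D' = Da + Db / 2 + \<delta>"
definition gap :: real where "gap = 2 * t0 + 4 * D' + 4 * Da + 4 * \<delta> + 2 * Db + L"

lemma constants_nonneg: "0 \<le> Da" "0 \<le> B" "0 \<le> Dz" "0 \<le> Db" "0 \<le> D'"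
  using \<delta>_nonneg Q_nonneg by (auto simp: Da_def B_def Dz_def Db_def D'_def)

lemma t0: "Dz + Mb * Dz + 4 * Da + 2 * \<delta> + 2 \<le> t0"
  unfolding t0_def using real_nat_ceiling_ge[of "Dz + Mb * Dz + 4 * Da + 2 * \<delta>"] by simp

text \<open>Otherwise Mb distinct powers would fit into a ball with Mb - 1 elements.\<close>

lemma Mb_power:
  assumes a: "a \<in> carrier G" and tf: "\<And>n. 0 < n \<Longrightarrow> a [^] (n::nat) \<noteq> \<one>"
  obtains n where "n \<le> Mb" "real (len (a [^] n)) > B"
proof -
  have "inj_on (\<lambda>n::nat. a [^] n) {1..Mb}"
  proof (rule linorder_inj_onI')
    fix i j :: nat assume ij: "i < j"
    show "a [^] i \<noteq> a [^] j"
    proof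
      assume eq: "a [^] i = a [^] j"
      have "a [^] j = a [^] i \<otimes> a [^] (j - i)" using a ij by (simp add: nat_pow_mult)
      then have "a [^] (j - i) = \<one>" using a eq by (metis l_cancel_one' nat_pow_closed)
      with tf[of "j - i"] ij show False by simp
    qed
  qed
  then have "card ((\<lambda>n::nat. a [^] n) ` {1..Mb}) = Mb" by (simp add: card_image)
  then have "\<not> (\<lambda>n::nat. a [^] n) ` {1..Mb} \<subseteq> {g \<in> carrier G. len g \<le> nat \<lfloor>B\<rfloor>}"
    using card_mono[OF finite_len_ball, of "(\<lambda>n::nat. a [^] n) ` {1..Mb}" "nat \<lfloor>B\<rfloor>"] by (auto simp: Mb_def)
  then obtain n where "n \<in> {1..Mb}" "a [^] n \<notin> {g \<in> carrier G. len g \<le> nat \<lfloor>B\<rfloor>}" by blast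
  then have "n \<le> Mb" "nat \<lfloor>B\<rfloor> < len (a [^] n)" using a by auto
  then show thesis using that[of n] by linarith
qed

end

lemma (in group) ostep_left:
  assumes "wf_graph \<Gamma>" "ostep \<Gamma> e s (x, i) (y, j)" "h \<in> carrier G"
  shows "ostep \<Gamma> e s (h \<otimes> x, i) (h \<otimes> y, j)"
  using assms(2)
proof (cases rule: ostepE)
  case (1 z)
  with assms(3) wf_graphD(3)[OF assms(1)] show ?thesis
    unfolding ostep_def by (auto simp: m_assoc intro!: bexI[of _ "h \<otimes> z"])
next
  case (2 z)
  with assms(3) wf_graphD(3)[OF assms(1)] show ?thesis
    unfolding ostep_def by (auto simp: m_assoc intro!: bexI[of _ "h \<otimes> z"])
qed

lemma (in group) ostep_translate:
  assumes "wf_graph \<Gamma>" "ostep \<Gamma> e s v v'" "ostep \<Gamma> e s u u'"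
  shows "snd u = snd v" "snd u' = snd v'" "fst u' = fst u \<otimes> inv (fst v) \<otimes> fst v'"
proof -
  have "snd u = snd v \<and> snd u' = snd v' \<and> fst u' = fst u \<otimes> inv (fst v) \<otimes> fst v'"
    using assms(2)
  proof (cases rule: ostepE)
    case v: (1 x)
    show ?thesis
      using assms(3)
    proof (cases rule: ostepE)
      case u: (1 y)
      with v wf_graphD(3)[OF assms(1) v(1)] show ?thesis by (simp add: m_assoc)
    qed (use v in simp)
  next
    case v: (2 x)
    show ?thesis
      using assms(3)
    proof (cases rule: ostepE)
      case u: (2 y)
      with v wf_graphD(3)[OF assms(1) v(1)] show ?thesis by (simp add: m_assoc inv_mult_group)
    qed (use v in simp)
  qed
  then show "snd u = snd v" "snd u' = snd v'" "fst u' = fst u \<otimes> inv (fst v) \<otimes> fst v'" by auto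
qed

section \<open>Long edges are nearly perpendicular to components and diverge\<close>

locale gap_graph = gap_constants +
  fixes \<Gamma> :: "'a lgraph" and H :: "'a set" and J :: "nat set"
  assumes min: "minimal_graph \<Gamma> H r"
    and J: "J = {e \<in> edges \<Gamma>. len (lab \<Gamma> e) \<le> N}"
    and long: "\<And>e. e \<in> edges \<Gamma> - J \<Longrightarrow> gap < len (lab \<Gamma> e)"
    and qc: "\<And>i. i \<in> verts \<Gamma> \<Longrightarrow> qconvex Q (loops \<Gamma> J i)"
    and tf: "\<And>i a n. i \<in> verts \<Gamma> \<Longrightarrow> a \<in> loops \<Gamma> J i \<Longrightarrow> a \<noteq> \<one> \<Longrightarrow> 0 < n \<Longrightarrow> a [^] (n::nat) \<noteq> \<one>"
begin

lemma wf: "wf_graph \<Gamma>" and JE: "J \<subseteq> edges \<Gamma>"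
  using min minimal_graphD J by auto

definition lstep :: "nat \<Rightarrow> bool \<Rightarrow> 'a \<times> nat \<Rightarrow> 'a \<times> nat \<Rightarrow> bool" where
  "lstep e s v v' \<longleftrightarrow> ostep \<Gamma> e s v v' \<and> e \<notin> J"

lemma lstep_closed:
  assumes "lstep e s v v'"
  shows "fst v \<in> carrier G" "fst v' \<in> carrier G" "snd v \<in> verts \<Gamma>" "snd v' \<in> verts \<Gamma>"
  using assms ostep_closed[OF wf, of e s v v'] by (auto simp: lstep_def)

lemma lstep_long: "lstep e s v v' \<Longrightarrow> gap < d (fst v) (fst v')"
  using ostep_dist[OF wf, of e s v v'] ostep_closed(5)[OF wf, of e s v v'] long[of e]
  by (simp add: lstep_def)

lemma lstep_rev: "lstep e s v v' \<Longrightarrow> lstep e (\<not> s) v' v"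
  using ostep_reverse[of \<Gamma> e s v v'] by (simp add: lstep_def)

lemma conn_carrier: "(v, u) \<in> conn \<Gamma> J \<Longrightarrow> fst v \<in> carrier G \<Longrightarrow> fst u \<in> carrier G"
  using conn_closed[OF _ JE wf, of "fst v" "snd v" "fst u" "snd u"] by simp

text \<open>By \<open>minimal_slide\<close> the origin of a long edge is nearest to its far end
  among the lifts of that vertex in the component, so \<open>gp_projection\<close> applies;
  \<open>component_near\<close> replaces u by such a lift at distance at most C.\<close>

lemma perpendicular:
  assumes e: "lstep e s v v'" and c: "(v, u) \<in> conn \<Gamma> J"
  shows "gp (fst u) (fst v') (fst v) \<le> Da"
proof -
  obtain q i y k where v: "v = (q, i)" and u: "u = (y, k)" by (cases v; cases u) auto
  note cl = lstep_closed[OF e, unfolded v fst_conv snd_conv]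
  have y: "y \<in> carrier G" using conn_carrier[OF c] cl(1) v u by simp
  have e': "ostep \<Gamma> e s v v'" "J \<subseteq> edges \<Gamma> - {e}" using e JE by (auto simp: lstep_def)
  obtain g where g: "g \<in> carrier G" "((\<one>, k), (g, i)) \<in> conn \<Gamma> J" "len g \<le> card (verts \<Gamma>) * N"
    using component_near[OF wf JE _ cl(3) c[unfolded v u]] J by auto
  have "card (verts \<Gamma>) * N \<le> C" unfolding C_def using minimal_card(1)[OF min] by (rule mult_le_mono1)
  then have gC: "len g \<le> C" using g(3) by simp
  define a where "a = inv q \<otimes> (y \<otimes> g)"
  have a: "a \<in> carrier G" "q \<otimes> a = y \<otimes> g" using cl y g by (auto simp: a_def)
  have "((y, k), (y \<otimes> g, i)) \<in> conn \<Gamma> J" using conn_left[OF g(2) JE wf y] y by simp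
  then have "((q, i), (y \<otimes> g, i)) \<in> conn \<Gamma> J" using c v u conn_trans by blast
  from conn_left[OF this JE wf, of "inv q"] have al: "a \<in> loops \<Gamma> J i"
    using cl(1) a(1) by (simp add: loops_def a_def)
  have Lc: "loops \<Gamma> J i \<subseteq> carrier G" by (auto simp: loops_def)
  have "gp (q \<otimes> a) (fst v') q \<le> 4 * \<delta> + Q + 1"
  proof (rule gp_projection[OF Lc qc[OF cl(3)] al cl(1,2)])
    fix a' assume "a' \<in> loops \<Gamma> J i"
    then have "((q \<otimes> \<one>, i), (q \<otimes> a', i)) \<in> conn \<Gamma> J"
      by (intro conn_left[OF _ JE wf cl(1)]) (auto simp: loops_def)
    then have "(v, (q \<otimes> a', i)) \<in> conn \<Gamma> J" using cl(1) v by simp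
    from minimal_slide[OF min e'(1) this e'(2)] show "d q (fst v') \<le> d (q \<otimes> a') (fst v')" by (simp add: v)
  qed
  moreover have "gp y (fst v') q \<le> gp (q \<otimes> a) (fst v') q + d y (q \<otimes> a)"
    by (rule gp_perturb) (use y a(1) cl in auto)
  moreover have "d y (q \<otimes> a) \<le> C" using gC a(2) y g by (simp add: d_mult_right)
  ultimately show ?thesis by (simp add: v u Da_def)
qed

text \<open>Edges that fellow travelled for time \<open>t0\<close> could be folded, which would decrease the cost; this
  includes an edge and a translate of its own reverse. An edge and its translate by \<open>h\<close> with the same
  orientation cannot be folded, but a bounded power of \<open>h\<close> moves the origin of the edge further than
  \<open>B\<close>, so that hyperbolicity applies.\<close>

lemma fellow_bound:
  assumes e: "lstep e s v v'" and e': "lstep e' s' u u'" and c: "(v, u) \<in> conn \<Gamma> J"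
    and ne: "(e, s, v) \<noteq> (e', s', u)" and near: "d (fst v) (fst u) \<le> B"
  shows "gp (fst v') (fst u') (fst v) < B + t0"
proof (rule ccontr)
  assume neg: "\<not> ?thesis"
  define q p q' p' where "q = fst v" and "p = fst v'" and "q' = fst u" and "p' = fst u'"
  have T: "t0 \<le> gp p p' q - B" using neg by (simp add: q_def p_def p'_def)
  have cl: "q \<in> carrier G" "p \<in> carrier G" "q' \<in> carrier G" "p' \<in> carrier G"
    using lstep_closed[OF e] lstep_closed[OF e'] by (auto simp: q_def p_def q'_def p'_def)
  note n0 = constants_nonneg
  have qp: "gap < d q p" and qp': "gap < d q' p'" using lstep_long e e' by (auto simp: q_def p_def q'_def p'_def)
  have gt: "2 * t0 \<le> gap" unfolding gap_def using n0 \<delta>_nonneg L_nonneg by linarith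
  have t1: "t0 \<le> d q p" "t0 \<le> d q' p'" using gt qp qp' by linarith+
  have tb: "Dz + 1 < t0" "Mb * Dz + 4 * Da + 2 * \<delta> < 2 * t0"
  proof -
    have "0 \<le> Mb * Dz" using n0 by simp
    then show "Dz + 1 < t0" "Mb * Dz + 4 * Da + 2 * \<delta> < 2 * t0" using t0 n0 \<delta>_nonneg by linarith+
  qed
  \<comment> \<open>The point at time t0 on e. By \<open>near_fellow\<close> it is Dz-close to its
    counterpart on e', which makes it a profitable place to fold.\<close>
  obtain z where z: "z \<in> carrier G" "d q z = t0" "d z p = d q p - t0" using between_ex[OF cl(1,2) t1(1)] .
  have nearB: "d q q' \<le> B" using near by (simp add: q_def q'_def)
  have fellow: "d z z' \<le> Dz" if "z' \<in> carrier G" "d q' z' = t0" "d z' p' = d q' p' - t0" for z'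
    unfolding Dz_def using near_fellow[OF cl(1,3,2,4) z(1) that(1) nearB T z(2,3) that(2,3)] .
  have oe: "ostep \<Gamma> e s v v'" "e \<notin> J" and oe': "ostep \<Gamma> e' s' u u'" "e' \<notin> J"
    using e e' by (auto simp: lstep_def)
  show False
  proof (cases "e = e'")
    case False
    obtain z' where z': "z' \<in> carrier G" "d q' z' = t0" "d z' p' = d q' p' - t0"
      using between_ex[OF cl(3,4) t1(2)] .
    have "J \<subseteq> edges \<Gamma> - {e, e'}" using JE oe oe' by auto
    from minimal_fold[OF min oe(1) oe'(1) False c this z(1)]
    have "d q p + d q' p' \<le> d q z + d z p + d z p' + 1" by (simp add: q_def p_def q'_def p'_def)
    moreover have "d z p' \<le> Dz + (d q' p' - t0)"
      using d_triangle[OF z(1) z'(1) cl(4)] fellow[OF z'] z' by linarith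
    ultimately show False using z tb by linarith
  next
    case ee: True
    have JE': "J \<subseteq> edges \<Gamma> - {e}" using JE oe by auto
    show False
    proof (cases "s = s'")
      case False
      then have s': "s' = (\<not> s)" by auto
      define h where "h = q' \<otimes> inv p"
      have h: "h \<in> carrier G" using cl by (simp add: h_def)
      have oe2: "ostep \<Gamma> e s u' u" using oe'(1) ee s' ostep_reverse by auto
      have "p' = q' \<otimes> inv p \<otimes> q"
      proof -
        have "q' = p' \<otimes> inv q \<otimes> p" using ostep_translate(3)[OF wf oe(1) oe2] by (simp add: q_def p_def q'_def p'_def)
        then show ?thesis using cl by (simp add: m_assoc inv_mult_group)
      qed
      then have hq: "h \<otimes> q = p'" "h \<otimes> p = q'" using cl by (auto simp: h_def m_assoc)
      have "t0 \<le> d z p" using z qp gt by linarith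
      have "real (nat \<lfloor>d z p - t0\<rfloor>) = d z p - t0"
      proof -
        obtain n where "d z p = real n" using d_int .
        with \<open>t0 \<le> d z p\<close> show ?thesis by (simp flip: of_nat_diff)
      qed
      \<comment> \<open>The point at time t0 before the far end p. Its translate by h is at time t0
        on e' and hence near z, so h moves z by at most Dz plus the length d q p - 2 * t0 between w
        and z. This violates \<open>minimal_fold_self\<close>.\<close>
      then obtain w where w: "w \<in> carrier G" "d z w = d z p - t0" "d w p = t0"
        using between_ex[OF z(1) cl(2), of "nat \<lfloor>d z p - t0\<rfloor>"] by auto
      have wq: "d w q = d q p - t0"
        using w z d_triangle[OF w(1) z(1) cl(1)] d_triangle[OF cl(1) w(1) cl(2)]
          d_sym[OF w(1) cl(1)] d_sym[OF w(1) z(1)] d_sym[OF z(1) cl(1)] by linarith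
      have hw: "h \<otimes> w \<in> carrier G" using h w by simp
      have "d q' (h \<otimes> w) = t0" using d_left[OF h cl(2) w(1)] w d_sym[OF w(1) cl(2)] by (simp add: hq)
      moreover have "d q' p' = d q p" using d_left[OF h cl(2,1)] d_sym[OF cl(1,2)] by (simp add: hq)
      moreover have "d (h \<otimes> w) p' = d q p - t0" using d_left[OF h w(1) cl(1)] wq by (simp add: hq)
      ultimately have "d z (h \<otimes> w) \<le> Dz" using fellow[OF hw] by simp
      then have "d z (h \<otimes> z) \<le> Dz + (d q p - 2 * t0)"
        using d_triangle[OF z(1) hw, of "h \<otimes> z"] d_left[OF h w(1) z(1)] d_sym[OF z(1) w(1)] w z h by simp
      moreover have "d q p \<le> d q z + d z (h \<otimes> z) + 1"
        using minimal_fold_self[OF min oe(1) _ c JE' z(1), of u'] oe'(1) ee s'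
        by (simp add: q_def p_def q'_def h_def)
      ultimately show False using z tb by linarith
    next
      case True
      obtain i j where v: "v = (q, i)" "v' = (p, j)" by (cases v; cases v') (auto simp: q_def p_def)
      have tr: "snd u = i" "snd u' = j" "p' = q' \<otimes> inv q \<otimes> p"
        using ostep_translate[OF wf oe(1), of u u'] oe'(1) ee True v by (auto simp: q'_def p'_def)
      have u: "u = (q', i)" "u' = (p', j)" using tr by (auto simp: q'_def p'_def prod_eq_iff)
      have i: "i \<in> verts \<Gamma>" using lstep_closed[OF e] v by simp
      define a where "a = inv q \<otimes> q'"
      have ac: "a \<in> carrier G" using cl by (simp add: a_def)
      have al: "a \<in> loops \<Gamma> J i"
        using conn_left[OF c[unfolded v u] JE wf, of "inv q"] cl by (simp add: loops_def a_def)
      have "a \<noteq> \<one>"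
      proof
        assume "a = \<one>"
        then have "q = q'" using cl inv_mult_eq_one_iff by (simp add: a_def)
        then show False using ne ee True v u by simp
      qed
      then obtain n where n: "n \<le> Mb" "B < len (a [^] n)" using Mb_power[OF ac] tf[OF i al] by metis
      have an: "a [^] n \<in> loops \<Gamma> J i"
        using al subgroup_loops[OF wf JE, of i] by (induction n) (auto simp: subgroup.one_closed subgroup.m_closed)
      define h where "h = q' \<otimes> inv q"
      have h: "h \<in> carrier G" using cl by (simp add: h_def)
      \<comment> \<open>The powers of h, as conjugates of the powers of a; each factor moves z by at
        most Dz.\<close>
      define k where "k m = q \<otimes> a [^] m \<otimes> inv q" for m :: nat
      have kc: "k m \<in> carrier G" for m using cl ac by (simp add: k_def)
      have ha: "h = q \<otimes> a \<otimes> inv q" using cl by (simp add: h_def a_def m_assoc)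
      have hz: "d z (h \<otimes> z) \<le> Dz"
      proof (rule fellow)
        have hq: "h \<otimes> q = q'" "h \<otimes> p = p'" using cl tr by (auto simp: h_def m_assoc)
        show "d q' (h \<otimes> z) = t0" using d_left[OF h cl(1) z(1)] z hq by simp
        show "d (h \<otimes> z) p' = d q' p' - t0"
          using d_left[OF h z(1) cl(2)] d_left[OF h cl(1,2)] z hq by simp
      qed (use h z in simp)
      have kz: "d z (k m \<otimes> z) \<le> m * Dz" for m
      proof (induction m)
        case 0
        then show ?case using cl z by (simp add: k_def)
      next
        case (Suc m)
        have "k (Suc m) = k m \<otimes> h" using cl ac by (simp add: k_def ha m_assoc)
        then have "d (k m \<otimes> z) (k (Suc m) \<otimes> z) = d z (h \<otimes> z)"
          using d_left[OF kc z(1), of "h \<otimes> z" m] h z kc by (simp add: m_assoc)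
        moreover have "d z (k (Suc m) \<otimes> z) \<le> d z (k m \<otimes> z) + d (k m \<otimes> z) (k (Suc m) \<otimes> z)"
          by (rule d_triangle) (use z kc in auto)
        ultimately show ?case using Suc hz by (simp add: algebra_simps)
      qed
      \<comment> \<open>By the choice of n the translated origin is further than B from q. Hence the
        initial segments up to z and its translate diverge, and their ends are almost 2 * t0 + d q
        qn apart, against the bound Mb * Dz.\<close>
      define qn where "qn = k n \<otimes> q"
      have qn: "qn = q \<otimes> a [^] n" using cl ac by (simp add: qn_def k_def m_assoc)
      have qnc: "qn \<in> carrier G" using cl kc by (simp add: qn_def)
      have "((q \<otimes> \<one>, i), (q \<otimes> a [^] n, i)) \<in> conn \<Gamma> J"
        using an by (intro conn_left[OF _ JE wf cl(1)]) (auto simp: loops_def)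
      then have cn: "((q, i), (qn, i)) \<in> conn \<Gamma> J" using cl by (simp add: qn)
      \<comment> \<open>Shortening a side can only lower the product at its origin, so the bound of
        \<open>perpendicular\<close> passes from the whole edge to its part up to z.\<close>
      have mono: "gp y z' x \<le> gp y y' x"
        if "d x z' + d z' y' = d x y'" "y \<in> carrier G" "z' \<in> carrier G" "x \<in> carrier G" "y' \<in> carrier G" for x y z' y'
        using that d_triangle[OF that(2,3,5)] d_sym[OF that(3,4)] d_sym[OF that(5,4)] by (simp add: gp_def)
      have zp: "d q z + d z p = d q p" using z by simp
      have g1: "gp qn z q \<le> Da"
        using mono[OF zp qnc z(1) cl(1,2)] perpendicular[OF e, of "(qn, i)"] cn v by simp
      have en: "lstep e s (qn, i) (k n \<otimes> p, j)"
        using ostep_left[OF wf oe(1)[unfolded v] kc[of n]] oe(2) by (simp add: lstep_def qn_def)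
      have zp': "d qn (k n \<otimes> z) + d (k n \<otimes> z) (k n \<otimes> p) = d qn (k n \<otimes> p)"
        using zp cl z kc by (simp add: qn_def)
      have g2: "gp q (k n \<otimes> z) qn \<le> Da"
        using mono[OF zp' cl(1) _ qnc] perpendicular[OF en, of "(q, i)"] conn_sym[OF cn] kc z cl by force
      have dq: "d q qn = len (a [^] n)" using cl ac by (simp add: qn d_mult_right)
      have "d q z + d qn (k n \<otimes> z) + d q qn - 4 * Da - 2 * \<delta> \<le> d z (k n \<otimes> z)"
        by (rule two_projections) (use cl z kc qnc g1 g2 dq n in \<open>auto simp: B_def\<close>)
      moreover have "d qn (k n \<otimes> z) = t0" using z cl kc by (simp add: qn_def)
      moreover have "d z (k n \<otimes> z) \<le> Mb * Dz"
      proof -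
        have "real n * Dz \<le> real Mb * Dz" using n n0 by (intro mult_right_mono) auto
        with kz[of n] show ?thesis by linarith
      qed
      ultimately show False using z tb d_nonneg[of q qn] by linarith
    qed
  qed
qed

text \<open>Origins further apart than B are handled by \<open>two_projections\<close> with
  \<open>perpendicular\<close> at both ends, closer ones by \<open>fellow_bound\<close>.\<close>

lemma divergence:
  assumes e: "lstep e s v v'" and e': "lstep e' s' u u'" and c: "(v, u) \<in> conn \<Gamma> J"
    and ne: "(e, s, v) \<noteq> (e', s', u)"
  shows "d (fst v) (fst v') + d (fst u) (fst u') + d (fst v) (fst u) - Db \<le> d (fst v') (fst u')"
proof (cases "d (fst v) (fst u) \<le> B")
  case False
  have "d (fst v) (fst v') + d (fst u) (fst u') + d (fst v) (fst u) - 4 * Da - 2 * \<delta> \<le> d (fst v') (fst u')"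
    by (rule two_projections)
      (use lstep_closed[OF e] lstep_closed[OF e'] perpendicular[OF e c] perpendicular[OF e' conn_sym[OF c]] False
        in \<open>auto simp: B_def\<close>)
  then show ?thesis using constants_nonneg by (simp add: Db_def)
next
  case True
  note cl = lstep_closed[OF e] lstep_closed[OF e']
  have "gp (fst v') (fst u') (fst v) < B + t0" by (rule fellow_bound[OF e e' c ne True])
  moreover have "d (fst v) (fst u') \<ge> d (fst u) (fst u') - B"
    using d_triangle[OF cl(5,1,6)] True d_sym[OF cl(1,5)] by linarith
  ultimately show ?thesis
    using True constants_nonneg d_sym[OF cl(1,2)] d_sym[OF cl(1,6)] \<delta>_nonneg by (simp add: gp_def Db_def field_simps)
qed

section \<open>Paths without backtracking\<close>

text \<open>Of a path only the last long edge is recorded. The triple (e, \<not> s, v') is its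
  reverse traversal, so immediate backtracking is excluded, while another lift of the same edge may
  be crossed.\<close>

inductive chain :: "nat \<Rightarrow> bool \<Rightarrow> 'a \<times> nat \<Rightarrow> 'a \<times> nat \<Rightarrow> bool" where
  start: "((\<one>, 0), v) \<in> conn \<Gamma> J \<Longrightarrow> lstep e s v v' \<Longrightarrow> chain e s v v'"
| extend: "chain e s v v' \<Longrightarrow> (v', u) \<in> conn \<Gamma> J \<Longrightarrow> lstep e' s' u u' \<Longrightarrow>
    (e, \<not> s, v') \<noteq> (e', s', u) \<Longrightarrow> chain e' s' u u'"

lemma chain_lstep: "chain e s v v' \<Longrightarrow> lstep e s v v'"
  by (erule chain.cases) auto

text \<open>Seen from the start of the last edge, \<one> lies behind. The previous edge is so long
  that it shields the new turn from \<one>: \<open>divergence\<close> bounds that turn by Db / 2,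
  and errors do not accumulate along the chain.\<close>

lemma chain_gp: "chain e s v v' \<Longrightarrow> gp \<one> (fst v') (fst v) \<le> D'"
proof (induction rule: chain.induct)
  case (start v e s v')
  then have "gp \<one> (fst v') (fst v) \<le> Da" using perpendicular[of e s v v' "(\<one>, 0)"] conn_sym by simp
  then show ?case using constants_nonneg \<delta>_nonneg by (simp add: D'_def)
next
  case (extend e s v v' u e' s' u')
  define b q p q' p' where "b = \<one>" and "q = fst v" and "p = fst v'" and "q' = fst u" and "p' = fst u'"
  have l: "lstep e s v v'" using extend chain_lstep by blast
  have cl: "q \<in> carrier G" "p \<in> carrier G" "q' \<in> carrier G" "p' \<in> carrier G" "b \<in> carrier G"
    using lstep_closed[OF l] lstep_closed[OF extend(3)] by (auto simp: q_def p_def q'_def p'_def b_def)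
  have dv: "d q p + d q' p' + d p q' - Db \<le> d q p'"
    using divergence[OF lstep_rev[OF l] extend(3,2,4)] d_sym[OF cl(1,2)] by (simp add: q_def p_def q'_def p'_def)
  have qp: "gap < d q p" using lstep_long[OF l] by (simp add: q_def p_def)
  have gb: "2 * Db + 4 * D' + 4 * Da + 4 * \<delta> \<le> gap" unfolding gap_def using L_nonneg by simp
  note n0 = constants_nonneg
  note sy = d_sym[OF cl(1,2)] d_sym[OF cl(1,3)] d_sym[OF cl(2,3)] d_sym[OF cl(3,4)] d_sym[OF cl(1,5)] d_sym[OF cl(3,5)]
  have dqq: "d q q' \<ge> d q p + d p q' - Db"
    using dv d_triangle[OF cl(1,3,4)] by linarith
  have 1: "gp q p' q' \<le> Db / 2"
    using dv d_triangle[OF cl(1,2,3)] sy by (simp add: gp_def field_simps)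
  have 2: "gp q' p q \<ge> d q p - Db / 2" using dqq sy by (simp add: gp_def field_simps)
  have 3: "gp b p q \<ge> min (gp b q' q) (gp q' p q) - \<delta>" by (rule gp_hyp) (use cl in auto)
  have IH: "gp b p q \<le> D'" using extend.IH by (simp add: b_def p_def q_def)
  have 4: "gp b q' q \<le> D' + \<delta>" using 2 3 IH qp gb n0 \<delta>_nonneg by (smt (verit) field_sum_of_halves)
  have "gp q b q' = d q q' - gp b q' q" using sy by (simp add: gp_def field_simps)
  then have 5: "gp q b q' > Db / 2 + \<delta>"
    using 4 dqq qp gb n0 \<delta>_nonneg d_nonneg[of p q'] by linarith
  have "gp q p' q' \<ge> min (gp q b q') (gp b p' q') - \<delta>" by (rule gp_hyp) (use cl in auto)
  then have "gp b p' q' \<le> Db / 2 + \<delta>" using 1 5 by linarith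
  then show ?case using n0 by (simp add: b_def p'_def q'_def D'_def)
qed

lemma chain_cover:
  assumes "((\<one>, 0), w) \<in> conn \<Gamma> (edges \<Gamma>)"
  shows "((\<one>, 0), w) \<in> conn \<Gamma> J \<or> (\<exists>e s v v'. chain e s v v' \<and> (v', w) \<in> conn \<Gamma> J)"
proof -
  define P where "P w \<longleftrightarrow> ((\<one>, 0), w) \<in> conn \<Gamma> J \<or> (\<exists>e s v v'. chain e s v v' \<and> (v', w) \<in> conn \<Gamma> J)" for w
  have step: "P w'" if o: "ostep \<Gamma> e s w w'" and P: "P w" for e s w w'
  proof (cases "e \<in> J")
    case True
    then have "(w, w') \<in> conn \<Gamma> J" using ostep_conn[OF o] by blast
    with P show ?thesis unfolding P_def using conn_trans by blast
  next
    case False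
    then have l: "lstep e s w w'" using o by (simp add: lstep_def)
    show ?thesis
    proof (cases "((\<one>, 0), w) \<in> conn \<Gamma> J")
      case True
      with chain.start l show ?thesis unfolding P_def using conn_refl by blast
    next
      case False
      then obtain e1 s1 v v' where ch: "chain e1 s1 v v'" "(v', w) \<in> conn \<Gamma> J" using P by (auto simp: P_def)
      show ?thesis
      proof (cases "(e1, \<not> s1, v') = (e, s, w)")
        case False
        with chain.extend[OF ch l] show ?thesis unfolding P_def using conn_refl by blast
      next
        case True
        \<comment> \<open>The step undoes the last long edge: it leads back to v, which lies in the
          base component or in the one reached by the shorter chain.\<close>
        have o': "ostep \<Gamma> e s v' v"
          using chain_lstep[OF ch(1)] True ostep_reverse[of \<Gamma> e1 s1 v v'] by (auto simp: lstep_def)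
        have "fst w' = fst v"
          using ostep_translate(3)[OF wf o' o] ostep_closed(1,2)[OF wf o'] True by simp
        then have w': "w' = v" using ostep_translate(2)[OF wf o' o] by (simp add: prod_eq_iff)
        from ch(1) show ?thesis
          by (cases rule: chain.cases) (auto simp: P_def w')
      qed
    qed
  qed
  have "P w"
    using assms
  proof (induction rule: conn_induct)
    case refl
    show ?case by (simp add: P_def)
  next
    case (step x e)
    have "ostep \<Gamma> e True (x, src \<Gamma> e) (x \<otimes> lab \<Gamma> e, tgt \<Gamma> e)" "ostep \<Gamma> e False (x \<otimes> lab \<Gamma> e, tgt \<Gamma> e) (x, src \<Gamma> e)"
      using step by (auto simp: ostep_def)
    then show ?case using \<open>\<And>w' w s e. ostep \<Gamma> e s w w' \<Longrightarrow> P w \<Longrightarrow> P w'\<close> by blast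
  qed
  then show ?thesis by (simp add: P_def)
qed

text \<open>A chain leading to h would end with an edge longer than \<open>gap\<close>, with \<one>
  behind it by \<open>chain_gp\<close> and h beyond it by \<open>perpendicular\<close>, which forces
  the length of h above L. So h is reached inside the base component.\<close>

lemma short_elements:
  assumes h: "h \<in> H" "len h \<le> L"
  shows "h \<in> loops \<Gamma> J 0"
proof -
  have hl: "h \<in> loops \<Gamma> (edges \<Gamma>) 0" using h min minimal_graphD(1) by (auto simp: carrier_graph_def)
  then have hc: "h \<in> carrier G" "((\<one>, 0), (h, 0)) \<in> conn \<Gamma> (edges \<Gamma>)" by (auto simp: loops_def)
  have "False" if ch: "chain e s v v'" and c: "(v', (h, 0)) \<in> conn \<Gamma> J" for e s v v'
  proof -
    define b q p where "b = \<one>" and "q = fst v" and "p = fst v'"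
    have l: "lstep e s v v'" using ch chain_lstep by blast
    have cl: "q \<in> carrier G" "p \<in> carrier G" "b \<in> carrier G"
      using lstep_closed[OF l] by (auto simp: q_def p_def b_def)
    have qp: "gap < d q p" using lstep_long[OF l] by (simp add: q_def p_def)
    have gb: "4 * D' + 4 * Da + 4 * \<delta> + L \<le> gap" unfolding gap_def using constants_nonneg by simp
    note n0 = constants_nonneg
    note sy = d_sym[OF cl(1,2)] d_sym[OF cl(1,3)] d_sym[OF cl(2,3)] d_sym[OF cl(2) hc(1)]
    have 1: "gp h q p \<le> Da" using perpendicular[OF lstep_rev[OF l] c] by (simp add: q_def p_def)
    have 2: "gp b p q \<le> D'" using chain_gp[OF ch] by (simp add: b_def p_def q_def)
    have "gp b q p = d q p - gp b p q" using sy by (simp add: gp_def field_simps)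
    then have 3: "gp b q p > Da + \<delta>" using 2 qp gb n0 \<delta>_nonneg L_nonneg by linarith
    have "gp h q p \<ge> min (gp h b p) (gp b q p) - \<delta>" by (rule gp_hyp) (use cl hc in auto)
    then have 4: "gp h b p \<le> Da + \<delta>" using 1 3 by linarith
    have "d b p = d q p + d b q - 2 * gp b p q" using sy by (simp add: gp_def field_simps)
    then have "d b p \<ge> d q p - 2 * D'" using 2 d_nonneg[of b q] by linarith
    moreover have "d b h = d b p + d p h - 2 * gp h b p" using sy d_sym[OF cl(3) hc(1)] by (simp add: gp_def field_simps)
    ultimately have "d b h \<ge> d q p - 2 * D' - 2 * Da - 2 * \<delta>" using 4 d_nonneg[of p h] by linarith
    moreover have "d b h = len h" using hc by (simp add: b_def d_one)
    ultimately show False using qp gb h(2) n0 \<delta>_nonneg by linarith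
  qed
  then have "((\<one>, 0), (h, 0)) \<in> conn \<Gamma> J" using chain_cover[OF hc(2)] by blast
  then show ?thesis using hc by (simp add: loops_def)
qed

end

section \<open>Finiteness\<close>

text \<open>Otherwise each of the m + 1 disjoint windows between consecutive scales would contain
  the value of an element of K of its own.\<close>

lemma scale_gap:
  fixes l :: "'e \<Rightarrow> nat" and N :: "nat \<Rightarrow> nat"
  assumes "finite K" "card K \<le> m" and mono: "\<And>k. N k \<le> N (Suc k)"
  shows "\<exists>k\<le>m. \<forall>e \<in> K. l e \<le> N k \<or> N (Suc k) < l e"
proof (rule ccontr)
  assume neg: "\<not> ?thesis"
  have "\<exists>e. e \<in> K \<and> N k < l e \<and> l e \<le> N (Suc k)" if "k \<le> m" for k
    using neg that by (metis not_le)
  then obtain f where f: "\<And>k. k \<le> m \<Longrightarrow> f k \<in> K \<and> N k < l (f k) \<and> l (f k) \<le> N (Suc k)" by metis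
  have "inj_on f {..m}"
  proof (rule linorder_inj_onI')
    fix i j assume ij: "i \<in> {..m}" "j \<in> {..m}" "i < j"
    have 1: "N (Suc i) \<le> N j" by (rule lift_Suc_mono_le[of N, OF mono]) (use ij in simp)
    have 2: "l (f i) \<le> N (Suc i)" "N j < l (f j)" using f[of i] f[of j] ij(1,2) by simp_all
    show "f i \<noteq> f j"
    proof
      assume "f i = f j"
      then show False using 1 2 by simp
    qed
  qed
  moreover have "f ` {..m} \<subseteq> K" using f by auto
  ultimately have "card {..m} \<le> card K" using assms(1) card_inj_on_le by blast
  with assms(2) show False by simp
qed

context hyp_group
begin

lemma qconvex_mono: "qconvex Q A \<Longrightarrow> Q \<le> Q' \<Longrightarrow> qconvex Q' A"
  unfolding qconvex_def by (meson order_trans)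

text \<open>The ball has finitely many subsets F; take the maximum of the constants over those that
  generate a quasiconvex group.\<close>

lemma uniform_qconvex:
  "\<exists>Q\<ge>0. \<forall>F \<subseteq> {g \<in> carrier G. len g \<le> R}. (\<exists>Q'. qconvex Q' (generate G F)) \<longrightarrow> qconvex Q (generate G F)"
proof -
  define \<A> where "\<A> = {F. F \<subseteq> {g \<in> carrier G. len g \<le> R} \<and> (\<exists>Q'. qconvex Q' (generate G F))}"
  have fin: "finite \<A>" unfolding \<A>_def using finite_len_ball by simp
  have "\<forall>F \<in> \<A>. \<exists>Q'. qconvex Q' (generate G F)" by (simp add: \<A>_def)
  then obtain q where q: "\<And>F. F \<in> \<A> \<Longrightarrow> qconvex (q F) (generate G F)" by metis
  define Q where "Q = Max (insert 0 (q ` \<A>))"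
  have "0 \<le> Q" "\<And>F. F \<in> \<A> \<Longrightarrow> q F \<le> Q" using fin by (auto simp: Q_def)
  then have "qconvex Q (generate G F)" if "F \<in> \<A>" for F
    using qconvex_mono[OF q[OF that]] that by simp
  with \<open>0 \<le> Q\<close> show ?thesis by (intro exI[of _ Q]) (simp add: \<A>_def)
qed

text \<open>After a change of base vertex, \<open>loops_basis\<close> presents the loops at i as
  generated by part of a basis of a conjugate of H; \<open>free_factor_qconvex\<close> and
  \<open>torsion_free\<close> apply there.\<close>

lemma component_properties:
  assumes \<Gamma>: "carrier_graph \<Gamma> 0 H r" and H: "undistorted H" and F: "F \<subseteq> edges \<Gamma>" and i: "i \<in> verts \<Gamma>"
  shows "\<exists>Q. qconvex Q (loops \<Gamma> F i)"
    and "a \<in> loops \<Gamma> F i \<Longrightarrow> a \<noteq> \<one> \<Longrightarrow> 0 < n \<Longrightarrow> a [^] (n::nat) \<noteq> \<one>"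
proof -
  have wf: "wf_graph \<Gamma>" using \<Gamma> by (simp add: carrier_graph_def)
  obtain x where x: "x \<in> carrier G" "((\<one>, 0), (x, i)) \<in> conn \<Gamma> (edges \<Gamma>)"
    using \<Gamma> i unfolding carrier_graph_def by blast
  define K where "K = (\<lambda>h. inv x \<otimes> h \<otimes> x) ` H"
  have \<Gamma>i: "carrier_graph \<Gamma> i K r" unfolding K_def by (rule carrier_graph_rebase[OF \<Gamma> i x])
  have sub: "subgroup (loops \<Gamma> (edges \<Gamma>) b) G" for b by (rule subgroup_loops[OF wf subset_refl])
  have Ks: "subgroup K G" using sub[of i] \<Gamma>i by (simp add: carrier_graph_def)
  have Hs: "subgroup H G" using sub[of 0] \<Gamma> by (simp add: carrier_graph_def)
  have Ku: "undistorted K" unfolding K_def by (rule undistorted_conj[OF H subgroup.subset[OF Hs] x(1)])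
  obtain Y Z where YZ: "finite (Y \<union> Z)" "Y \<inter> Z = {}" "basis (Y \<union> Z) K" "loops \<Gamma> F i = word_val G ` words Y"
    using loops_basis[OF \<Gamma>i F] by blast
  interpret K: based_group G K "Y \<union> Z"
    by (intro based_group.intro based_group_axioms.intro group_axioms Ks YZ(3))
  show "\<exists>Q. qconvex Q (loops \<Gamma> F i)"
    unfolding YZ(4) by (rule free_factor_qconvex[OF K.based_group_axioms YZ(1) _ Ku]) simp
  have "loops \<Gamma> F i \<subseteq> K" unfolding YZ(4) using K.val_H words_mono[of _ Y "Y \<union> Z"] by blast
  then show "a \<in> loops \<Gamma> F i \<Longrightarrow> a \<noteq> \<one> \<Longrightarrow> 0 < n \<Longrightarrow> a [^] (n::nat) \<noteq> \<one>"
    using K.torsion_free by blast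
qed

lemma loops_free_factor:
  assumes \<Gamma>: "carrier_graph \<Gamma> 0 H r" and F: "F \<subseteq> edges \<Gamma>"
  shows "free_factor (loops \<Gamma> F 0) (G\<lparr>carrier := H\<rparr>)"
proof -
  have wf: "wf_graph \<Gamma>" using \<Gamma> by (simp add: carrier_graph_def)
  have Hs: "subgroup H G" using subgroup_loops[OF wf subset_refl, of 0] \<Gamma> by (simp add: carrier_graph_def)
  obtain Y Z where YZ: "Y \<inter> Z = {}" "basis (Y \<union> Z) H" "loops \<Gamma> F 0 = word_val G ` words Y"
    using loops_basis[OF \<Gamma> F] by blast
  interpret H: based_group G H "Y \<union> Z"
    by (intro based_group.intro based_group_axioms.intro group_axioms Hs YZ(2))
  show ?thesis unfolding free_factor_def YZ(3) using H.free_product_of_basis[OF refl YZ(1)] by blast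
qed

text \<open>A finite T replaces H because the constants see only the largest length L of its
  elements.\<close>

lemma finitely_many_overgroups:
  assumes T: "finite T" "T \<subseteq> carrier G"
  shows "finite {H'. subgroup H' G \<and> T \<subseteq> H' \<and> undistorted H' \<and>
    free_group_of_rank (G\<lparr>carrier := H'\<rparr>) r \<and>
    \<not> (\<exists>A. proper_free_factor A (G\<lparr>carrier := H'\<rparr>) \<and> T \<subseteq> A)}" (is "finite ?S")
proof -
  define L where "L = Max (insert 0 (len ` T))"
  have L: "\<And>t. t \<in> T \<Longrightarrow> len t \<le> L" using T by (auto simp: L_def)
  \<comment> \<open>The length of the generators from \<open>loops_generated\<close>, with 2 * r + 1
    bounding the number of vertices.\<close>
  define R where "R N = 2 * ((2 * r + 1) * N) + N" for N
  obtain Q where Q: "\<And>N. 0 \<le> Q N" "\<And>N F. F \<subseteq> {g \<in> carrier G. len g \<le> R N} \<Longrightarrow>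
      (\<exists>Q'. qconvex Q' (generate G F)) \<Longrightarrow> qconvex (Q N) (generate G F)"
    using uniform_qconvex[of "R _"] by metis
  \<comment> \<open>The next scale leaves room for the gap that N and its quasiconvexity constant
    require. Iteration from 0 fixes all scales before any H' is considered.\<close>
  define f where "f N = N + nat \<lceil>gap_constants.gap G S \<delta> r N (Q N) (real L)\<rceil>" for N
  define Nk where "Nk k = (f ^^ k) 0" for k
  have Nk_mono: "Nk k \<le> Nk (Suc k)" for k by (simp add: Nk_def f_def)
  have "?S \<subseteq> (\<Union>k \<le> 3 * r. generate G ` Pow {g \<in> carrier G. len g \<le> R (Nk k)})"
  proof
    fix H' assume "H' \<in> ?S"
    then have H': "subgroup H' G" "T \<subseteq> H'" "undistorted H'" "free_group_of_rank (G\<lparr>carrier := H'\<rparr>) r"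
      and nf: "\<not> (\<exists>A. proper_free_factor A (G\<lparr>carrier := H'\<rparr>) \<and> T \<subseteq> A)" by auto
    obtain X where X: "basis X H'" "finite X" "card X = r"
      using H'(4) free_basis_iff_basis[OF H'(1)] by (auto simp: free_group_of_rank_def)
    have "based_group G H' X"
      by (intro based_group.intro based_group_axioms.intro group_axioms H'(1) X(1))
    then obtain \<Gamma> where min: "minimal_graph \<Gamma> H' r"
      using carrier_graph_rose[OF _ X(2,3)] minimal_graph_ex by blast
    note \<Gamma> = minimal_graphD(1)[OF min] and wf = minimal_graphD(2)[OF min]
    have "finite (edges \<Gamma>)" using wf by (simp add: wf_graph_def)
    then obtain k where k: "k \<le> 3 * r" "\<And>e. e \<in> edges \<Gamma> \<Longrightarrow> len (lab \<Gamma> e) \<le> Nk k \<or> Nk (Suc k) < len (lab \<Gamma> e)"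
      using scale_gap[of "edges \<Gamma>" "3 * r" Nk "\<lambda>e. len (lab \<Gamma> e)"] minimal_card(2)[OF min] Nk_mono by blast
    define N where "N = Nk k"
    define J where "J = {e \<in> edges \<Gamma>. len (lab \<Gamma> e) \<le> N}"
    have short: "J \<subseteq> edges \<Gamma>" "\<And>e. e \<in> J \<Longrightarrow> len (lab \<Gamma> e) \<le> N" by (auto simp: J_def)
    have CN: "card (verts \<Gamma>) * N \<le> (2 * r + 1) * N"
      using minimal_card(1)[OF min] by (rule mult_le_mono1)
    have gen: "loops \<Gamma> J i = generate G (loops \<Gamma> J i \<inter> {g. len g \<le> R N})" if "i \<in> verts \<Gamma>" for i
      unfolding R_def by (rule loops_generated[OF wf short that CN])
    have ball: "loops \<Gamma> J i \<inter> {g. len g \<le> R N} \<subseteq> {g \<in> carrier G. len g \<le> R N}" for i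
      by (auto simp: loops_def)
    interpret gap_constants G S \<delta> r N "Q N" "real L"
      by unfold_locales (use Q in auto)
    interpret gap_graph G S \<delta> r N "Q N" "real L" \<Gamma> H' J
    proof unfold_locales
      show "minimal_graph \<Gamma> H' r" by (rule min)
      show "J = {e \<in> edges \<Gamma>. len (lab \<Gamma> e) \<le> N}" by (rule J_def)
      show "gap < len (lab \<Gamma> e)" if e: "e \<in> edges \<Gamma> - J" for e
      proof -
        have "Nk (Suc k) < len (lab \<Gamma> e)" using e k(2)[of e] by (auto simp: J_def N_def)
        moreover have "Nk (Suc k) = f N" by (simp add: Nk_def N_def)
        moreover have "gap \<le> f N" unfolding f_def by linarith
        ultimately show ?thesis by linarith
      qed
      show "qconvex (Q N) (loops \<Gamma> J i)" if i: "i \<in> verts \<Gamma>" for i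
        using Q(2)[OF ball] component_properties(1)[OF \<Gamma> H'(3) short(1) i] gen[OF i] by metis
      show "a [^] (n::nat) \<noteq> \<one>" if "i \<in> verts \<Gamma>" "a \<in> loops \<Gamma> J i" "a \<noteq> \<one>" "0 < n" for i a n
        by (rule component_properties(2)[OF \<Gamma> H'(3) short(1) that])
    qed
    \<comment> \<open>A free factor that contains T cannot be proper, so the short edges at the base
      already represent all of H'.\<close>
    have "T \<subseteq> loops \<Gamma> J 0" using short_elements L H'(2) by auto
    then have "loops \<Gamma> J 0 = H'"
      using nf loops_free_factor[OF \<Gamma> short(1)] by (auto simp: proper_free_factor_def)
    moreover have "0 \<in> verts \<Gamma>" using \<Gamma> by (simp add: carrier_graph_def)
    ultimately have "H' = generate G (loops \<Gamma> J 0 \<inter> {g. len g \<le> R N})" using gen by metis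
    with ball[of 0] show "H' \<in> (\<Union>k \<le> 3 * r. generate G ` Pow {g \<in> carrier G. len g \<le> R (Nk k)})"
      using k(1) unfolding N_def by blast
  qed
  moreover have "finite (\<Union>k \<le> 3 * r. generate G ` Pow {g \<in> carrier G. len g \<le> R (Nk k)})"
    using finite_len_ball by simp
  ultimately show ?thesis by (rule finite_subset)
qed

end

theorem theorem1p4:
  fixes G :: "('a, 'b) monoid_scheme" and r :: nat and H :: "'a set"
  assumes "hyperbolic_group G"
    and "subgroup H G"
    and "quasiconvex_subgroup H G"
    and "free_group (G\<lparr>carrier := H\<rparr>)"
  shows "finite {H'. subgroup H' G \<and> H \<subseteq> H' \<and>
            free_group (G\<lparr>carrier := H'\<rparr>) \<and>
            quasiconvex_subgroup H' G \<and>
            free_group_of_rank (G\<lparr>carrier := H'\<rparr>) r \<and>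
            \<not> (\<exists>A. proper_free_factor A (G\<lparr>carrier := H'\<rparr>) \<and> H \<subseteq> A)}"
    (is "finite ?S")
proof -
  obtain S \<delta> where G: "group G" "finite_generating_set G S" "\<delta> \<ge> 0"
    "gromov_hyperbolic \<delta> (carrier G) (word_metric G S)"
    using assms(1) by (auto simp: hyperbolic_group_def)
  interpret G: group G by (rule G(1))
  interpret hyp_group G S \<delta> by unfold_locales (use G in auto)
  obtain T where T: "finite_generating_set (G\<lparr>carrier := H\<rparr>) T"
    using assms(3) by (auto simp: quasiconvex_subgroup_def)
  interpret H: group "G\<lparr>carrier := H\<rparr>" by (rule subgroup.subgroup_is_group[OF assms(2) G(1)])
  interpret H: gen_group "G\<lparr>carrier := H\<rparr>" T by unfold_locales (rule T)
  have TH: "finite T" "T \<subseteq> H" using H.S_finite H.S_carrier by auto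
  then have Tc: "T \<subseteq> carrier G" using subgroup.subset[OF assms(2)] by blast
  \<comment> \<open>T generates H, so a subgroup contains one exactly if it contains the other; this
    transfers the condition on free factors from H to T.\<close>
  have gen: "H \<subseteq> A" if A: "subgroup A G" "T \<subseteq> A" for A
  proof
    fix h assume "h \<in> H"
    then have "h \<in> word_val (G\<lparr>carrier := H\<rparr>) ` words T" unfolding H.S_gen[symmetric] by simp
    then obtain w where w: "w \<in> words T" "word_val (G\<lparr>carrier := H\<rparr>) w = h" by blast
    then have "word_val G w = h" using G.word_val_subgroup(1)[OF assms(2) words_mono[OF w(1) TH(2)]] by simp
    then show "h \<in> A" using G.word_val_subgroup(2)[OF A(1) words_mono[OF w(1) A(2)]] by simp
  qed
  have "?S \<subseteq> {H'. subgroup H' G \<and> T \<subseteq> H' \<and> undistorted H' \<and>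
    free_group_of_rank (G\<lparr>carrier := H'\<rparr>) r \<and>
    \<not> (\<exists>A. proper_free_factor A (G\<lparr>carrier := H'\<rparr>) \<and> T \<subseteq> A)}"
  proof (intro subsetI CollectI conjI)
    fix H' assume H': "H' \<in> ?S"
    show "\<not> (\<exists>A. proper_free_factor A (G\<lparr>carrier := H'\<rparr>) \<and> T \<subseteq> A)"
    proof
      assume "\<exists>A. proper_free_factor A (G\<lparr>carrier := H'\<rparr>) \<and> T \<subseteq> A"
      then obtain A where A: "proper_free_factor A (G\<lparr>carrier := H'\<rparr>)" "T \<subseteq> A" by blast
      have "subgroup A (G\<lparr>carrier := H'\<rparr>)"
        using A(1) by (auto simp: proper_free_factor_def free_factor_def is_free_product_def)
      moreover have "subgroup H' G" using H' by blast
      ultimately have "subgroup A G" using G.incl_subgroup by blast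
      with gen A H' show False by blast
    qed
  qed (use TH undistorted_of_quasiconvex in auto)
  then show ?thesis using finitely_many_overgroups[OF TH(1) Tc] by (rule finite_subset)
qed

end
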